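(* There exists an absolute constant $C>0$ such that the following holds. Let $k\ge 3$ be an integer and let $W\in\mathcal{W}$ be an orderon. Let $G\sim\mathbf{G}(k,W)$. Then $$d_\triangle(W,W_G)\le C\left(\frac{\log\log k}{\log k}\right)^{1/3}$$ holds with probability at least $1-C\exp(-\sqrt{k}/C)$.
   Context: An orderon is a (Lebesgue) measurable function $W:([0,1]^2)^2\to[0,1]$ with $W(u,v)=W(v,u)$ for all $u,v\in[0,1]^2$; $\mathcal{W}$ is the set of all orderons. A measure-preserving bijection of $[0,1]^2$ is a bijection $f:[0,1]^2\to[0,1]^2$ such that both $f$ and $f^{-1}$ are measure preserving for Lebesgue measure; $\mathcal{F}$ is the set of all of them. For $f\in\mathcal{F}$, $W^f(u,v)=W(f(u),f(v))$, and $\mathrm{Shift}(f)=\sup_{(x,a)\in[0,1]^2}|x-\pi_1(f(x,a))|$, where $\pi_1(y,b)=y$. The cut-norm of a symmetric measurable $V:([0,1]^2)^2\to\mathbb{R}$ is $\|V\|_\square=\sup_{S,T\subseteq[0,1]^2}\left|\int_{S\times T}V(u,v)\,du\,dv\right|$ over measurable $S,T$. The cut-shift distance is $d_\triangle(W,U)=\inf_{f\in\mathcal{F}}\left(\mathrm{Shift}(f)+\|W-U^f\|_\square\right)$. The random simple ordered graph $\mathbf{G}(k,W)$ on $[k]$ is generated as follows: pick $k$ points of $[0,1]^2$ uniformly and independently, order them by first coordinate as $(x_1,a_1),\dots,(x_k,a_k)$ with $x_1\le\cdots\le x_k$, and for each pair $i<j$ put an edge between $i$ and $j$ with probability $W((x_i,a_i),(x_j,a_j))$,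 independently of the other pairs. For an ordered graph $G:[n]^2\to\{0,1\}$ (symmetric), its orderon representation is $W_G((x,a),(y,b))=G(Q_n(x),Q_n(y))$, where $Q_n(x)=\lceil nx\rceil$ for $x>0$ and $Q_n(0)=1$. $\log$ is the natural logarithm. *)

theory Defs
  imports "HOL-Probability.Probability"
begin

type_synonym point = "real \<times> real"

definition unit_square :: "point set" where
  "unit_square = {0..1} \<times> {0..1}"

(* As the domain is the unit square, values of W outside it are unconstrained; everything below
   only depends on the values inside. *)
definition orderons :: "(point \<times> point \<Rightarrow> real) set" where
  "orderons = {W. W \<in> borel_measurable (lebesgue_on (unit_square \<times> unit_square)) \<and>
     (\<forall>u\<in>unit_square. \<forall>v\<in>unit_square. 0 \<le> W (u, v) \<and> W (u, v) \<le> 1 \<and> W (u, v) = W (v, u))}"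

definition measure_preserving_map :: "'a measure \<Rightarrow> 'b measure \<Rightarrow> ('a \<Rightarrow> 'b) \<Rightarrow> bool" where
  "measure_preserving_map M N f \<longleftrightarrow> f \<in> measurable M N \<and> distr M N f = N"

definition mp_bijections :: "(point \<Rightarrow> point) set" where
  "mp_bijections = {f. bij_betw f unit_square unit_square \<and>
     measure_preserving_map (lebesgue_on unit_square) (lebesgue_on unit_square) f \<and>
     measure_preserving_map (lebesgue_on unit_square) (lebesgue_on unit_square)
       (inv_into unit_square f)}"

definition pullback :: "(point \<times> point \<Rightarrow> real) \<Rightarrow> (point \<Rightarrow> point) \<Rightarrow> point \<times> point \<Rightarrow> real" where
  "pullback W f = (\<lambda>(u, v). W (f u, f v))"

definition shift :: "(point \<Rightarrow> point) \<Rightarrow> real" where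
  "shift f = (SUP p\<in>unit_square. \<bar>fst p - fst (f p)\<bar>)"

definition cut_norm :: "(point \<times> point \<Rightarrow> real) \<Rightarrow> real" where
  "cut_norm V =
     (SUP (S, T) \<in> {(S, T). S \<in> sets lebesgue \<and> T \<in> sets lebesgue \<and>
                            S \<subseteq> unit_square \<and> T \<subseteq> unit_square}.
        \<bar>LINT z:S \<times> T|lebesgue. V z\<bar>)"

definition cut_shift_dist ::
    "(point \<times> point \<Rightarrow> real) \<Rightarrow> (point \<times> point \<Rightarrow> real) \<Rightarrow> real" where
  "cut_shift_dist W U =
     (INF f\<in>mp_bijections. shift f + cut_norm (\<lambda>z. W z - pullback U f z))"

definition Q :: "nat \<Rightarrow> real \<Rightarrow> nat" where
  "Q n x = (if x = 0 then 1 else nat \<lceil>real n * x\<rceil>)"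

(* An ordered graph on the vertex set {1..n} is given by its adjacency predicate. *)
definition graph_orderon :: "nat \<Rightarrow> (nat \<Rightarrow> nat \<Rightarrow> bool) \<Rightarrow> point \<times> point \<Rightarrow> real" where
  "graph_orderon n G = (\<lambda>((x, a), (y, b)). of_bool (G (Q n x) (Q n y)))"

(* The product measure is completed because an orderon is only Lebesgue measurable, so that
   evaluating it at two sample points need not be measurable for the product sigma-algebra. *)
definition sample_points :: "nat \<Rightarrow> (nat \<Rightarrow> point) measure" where
  "sample_points k = completion (PiM {1..k} (\<lambda>_. lebesgue_on unit_square))"

(* Ties between first coordinates (a null event) are broken by the index of the point. *)
definition ordered_point :: "nat \<Rightarrow> (nat \<Rightarrow> point) \<Rightarrow> nat \<Rightarrow> point" where
  "ordered_point k p i = sort_key fst (map p [1..<Suc k]) ! (i - 1)"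

definition graph_of_pairs :: "(nat \<times> nat \<Rightarrow> bool) \<Rightarrow> nat \<Rightarrow> nat \<Rightarrow> bool" where
  "graph_of_pairs e i j = (if i < j then e (i, j) else if j < i then e (j, i) else False)"

definition random_edges ::
    "nat \<Rightarrow> (point \<times> point \<Rightarrow> real) \<Rightarrow> (nat \<Rightarrow> point) \<Rightarrow> (nat \<Rightarrow> nat \<Rightarrow> bool) pmf" where
  "random_edges k W q =
     map_pmf graph_of_pairs
       (Pi_pmf {(i, j). 1 \<le> i \<and> i < j \<and> j \<le> k} False
          (\<lambda>(i, j). bernoulli_pmf (W (q i, q j))))"

definition random_graph ::
    "nat \<Rightarrow> (point \<times> point \<Rightarrow> real) \<Rightarrow> (nat \<Rightarrow> nat \<Rightarrow> bool) measure" where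
  "random_graph k W =
     sample_points k \<bind> (\<lambda>p. measure_pmf (random_edges k W (ordered_point k p)))"

end

theory Submission
  imports Defs "HOL-Real_Asymp.Real_Asymp"
begin

text \<open>
Why a random graph is close to its orderon. Choose an integer \<open>M\<close> that is a huge multiple of
\<open>k\<close> and cut the square into \<open>M \<times> M\<close> cells. Off a set of tiny measure, \<open>W\<close> is within \<open>\<epsilon>\<close> of
a kernel \<open>w\<close> that is constant on products of cells (\<open>orderon_grid_approximation\<close>), and the
orderon of \<open>G\<close> is constant on such products as well, because the strip of a vertex is a union of whole
columns of cells. Both objects are thus finite matrices indexed by cells, and every permutation of
the cells acts by translations as a measure preserving bijection (\<open>permute_cells_mp_bijection\<close>).
Group the \<open>k\<close> ranks into blocks of about \<open>\<epsilon> k\<close> consecutive ranks. A permutation that keeps every cell inside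
its block shifts first coordinates by at most the width of a block
(\<open>shift_permute_cells_le\<close>), and it remains to find one that makes the difference of the two matrices small
in cut norm.

Frieze-Kannan regularity (\<open>weak_regularity\<close>) gives \<open>4 ^ r\<close> classes of cells, with \<open>r\<close> about
\<open>1 / \<epsilon>\<^sup>2\<close>, and a kernel \<open>U\<close> that depends on classes only and is within \<open>\<epsilon>\<close> of \<open>w\<close> in cut norm. Write
\<open>Z i\<close> for the cell of the \<open>i\<close>-th sample point in the order of the graph. The permutation \<open>\<pi>\<close> is
chosen so that, for most cells \<open>c\<close>, the cell \<open>\<pi> c\<close> lies in the strip of a vertex \<open>i\<close> for which \<open>Z i\<close> has
the same class as \<open>c\<close>. Then the following are close in turn:
\<^item> \<open>w\<close> and \<open>U\<close>, by regularity;
\<^item> \<open>U\<close> and its sampled version \<open>U (Z i) (Z j)\<close> carried back by \<open>\<pi>\<close>, because few cells are misplaced: by Hoeffding's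
  inequality each pair of a block and a class receives about the right number of sample points, and
  sorting the sample puts almost all of them into the right block (\<open>aligning_permutation\<close>);
\<^item> \<open>U (Z i) (Z j)\<close> and \<open>w (Z i) (Z j)\<close>, because sampling preserves a small cut norm (\<open>sampled_cut_abs_le\<close>);
\<^item> \<open>w (Z i) (Z j)\<close> and the edge probabilities, unless a pair of sample points hits the exceptional set;
\<^item> the edge probabilities and the edges, by Hoeffding's inequality and a union bound over
  all \<open>4 ^ k\<close> pairs of vertex sets (\<open>random_edges_cut_le\<close>).

The central step is the third one. A set of rows that maximises the sum over a fixed set of columns consists of the
rows with positive sum, and the signs of these sums can be estimated from a short list of
sampled columns (\<open>sampled_rows\<close>). Hence only sets determined by short lists of sample points compete, and once the
points on the lists are fixed, the remaining points are independent of these sets.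

With \<open>\<epsilon> = ln k powr (-1/3)\<close> the number of classes is \<open>k\<close> to a power that tends to \<open>0\<close>. The relative deviation allowed for
each type count is a fixed negative power of \<open>k\<close>, so that the deviations remain negligible when they are added up over all
classes, and each bad event has probability at most \<open>exp (- sqrt k)\<close>. The
resulting distance \<open>9 * ln k powr (-1/3)\<close> is below the required bound as soon as \<open>ln (ln k) \<ge> 1\<close>; for the finitely many
\<open>k\<close> that are too small for these estimates, the constant makes the claimed probability nonpositive.
\<close>

section \<open>Cut norms of finite matrices and weak regularity\<close>

text \<open>A bilinear form on a product of two cubes attains its maximum at a pair of vertices: for
fixed \<open>\<beta>\<close> the best \<open>\<alpha>\<close> is the indicator of the rows with positive sum, and then the same holds for the columns.\<close>
lemma bilinear_le_of_subsets:
  fixes A :: "'a \<Rightarrow> 'b \<Rightarrow> real"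
  assumes fin: "finite X" "finite Y"
    and le: "\<And>S T. S \<subseteq> X \<Longrightarrow> T \<subseteq> Y \<Longrightarrow> (\<Sum>i\<in>S. \<Sum>j\<in>T. A i j) \<le> c"
    and \<alpha>: "\<And>i. i \<in> X \<Longrightarrow> 0 \<le> \<alpha> i \<and> \<alpha> i \<le> 1"
    and \<beta>: "\<And>j. j \<in> Y \<Longrightarrow> 0 \<le> \<beta> j \<and> \<beta> j \<le> 1"
  shows "(\<Sum>i\<in>X. \<Sum>j\<in>Y. \<alpha> i * \<beta> j * A i j) \<le> c"
proof -
  have round: "(\<Sum>i\<in>Z. \<gamma> i * g i) \<le> (\<Sum>i\<in>{i\<in>Z. g i > 0}. g i)"
    if "finite Z" "\<And>i. i \<in> Z \<Longrightarrow> 0 \<le> \<gamma> i \<and> \<gamma> i \<le> 1" for Z :: "'z set" and \<gamma> g :: "'z \<Rightarrow> real"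
  proof -
    have "(\<Sum>i\<in>Z. \<gamma> i * g i) \<le> (\<Sum>i\<in>Z. if g i > 0 then g i else 0)"
    proof (rule sum_mono)
      fix i assume "i \<in> Z"
      then show "\<gamma> i * g i \<le> (if g i > 0 then g i else 0)"
        using that(2)[of i] mult_right_mono[of "\<gamma> i" 1 "g i"] mult_nonneg_nonpos[of "\<gamma> i" "g i"] by auto
    qed
    also have "\<dots> = (\<Sum>i\<in>{i\<in>Z. g i > 0}. g i)"
      using that(1) by (simp add: sum.inter_filter)
    finally show ?thesis .
  qed
  define S where "S = {i\<in>X. (\<Sum>j\<in>Y. \<beta> j * A i j) > 0}"
  define T where "T = {j\<in>Y. (\<Sum>i\<in>S. A i j) > 0}"
  have "(\<Sum>i\<in>X. \<Sum>j\<in>Y. \<alpha> i * \<beta> j * A i j) = (\<Sum>i\<in>X. \<alpha> i * (\<Sum>j\<in>Y. \<beta> j * A i j))"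
    by (simp add: sum_distrib_left mult.assoc)
  also have "\<dots> \<le> (\<Sum>i\<in>S. \<Sum>j\<in>Y. \<beta> j * A i j)"
    unfolding S_def by (rule round) (use fin \<alpha> in auto)
  also have "\<dots> = (\<Sum>j\<in>Y. \<beta> j * (\<Sum>i\<in>S. A i j))"
    by (subst sum.swap) (simp add: sum_distrib_left)
  also have "\<dots> \<le> (\<Sum>j\<in>T. \<Sum>i\<in>S. A i j)"
    unfolding T_def by (rule round) (use fin \<beta> in auto)
  also have "\<dots> = (\<Sum>i\<in>S. \<Sum>j\<in>T. A i j)"
    by (rule sum.swap)
  also have "\<dots> \<le> c"
    by (rule le) (auto simp: S_def T_def)
  finally show ?thesis .
qed

text \<open>In this form the lemma reduces measurable subsets of the square to sets of
cells, and sets of cells to sets of vertices: the weights are the measures, or the numbers of cells, with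
which a set meets a cell or a strip.\<close>
lemma abs_bilinear_le_of_subsets:
  fixes A :: "'a \<Rightarrow> 'b \<Rightarrow> real"
  assumes fin: "finite X" "finite Y"
    and le: "\<And>S T. S \<subseteq> X \<Longrightarrow> T \<subseteq> Y \<Longrightarrow> \<bar>\<Sum>i\<in>S. \<Sum>j\<in>T. A i j\<bar> \<le> c"
    and \<alpha>: "\<And>i. i \<in> X \<Longrightarrow> 0 \<le> \<alpha> i \<and> \<alpha> i \<le> K"
    and \<beta>: "\<And>j. j \<in> Y \<Longrightarrow> 0 \<le> \<beta> j \<and> \<beta> j \<le> K"
    and K: "K > 0"
  shows "\<bar>\<Sum>i\<in>X. \<Sum>j\<in>Y. \<alpha> i * \<beta> j * A i j\<bar> \<le> K * K * c"
proof -
  have scale: "(\<Sum>i\<in>X. \<Sum>j\<in>Y. \<alpha> i * \<beta> j * A' i j) =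
      K * K * (\<Sum>i\<in>X. \<Sum>j\<in>Y. (\<alpha> i / K) * (\<beta> j / K) * A' i j)" for A' :: "'a \<Rightarrow> 'b \<Rightarrow> real"
    using K by (simp add: sum_distrib_left mult_ac)
  have "(\<Sum>i\<in>X. \<Sum>j\<in>Y. (\<alpha> i / K) * (\<beta> j / K) * A i j) \<le> c"
    by (rule bilinear_le_of_subsets)
       (use fin le \<alpha> \<beta> K in \<open>auto simp: abs_le_iff\<close>)
  moreover have "(\<Sum>i\<in>X. \<Sum>j\<in>Y. (\<alpha> i / K) * (\<beta> j / K) * (- A i j)) \<le> c"
    by (rule bilinear_le_of_subsets[where A="\<lambda>i j. - A i j"])
       (use fin le \<alpha> \<beta> K in \<open>auto simp: abs_le_iff sum_negf\<close>)
  ultimately have "(\<Sum>i\<in>X. \<Sum>j\<in>Y. \<alpha> i * \<beta> j * A i j) \<le> K * K * c"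
    "(\<Sum>i\<in>X. \<Sum>j\<in>Y. \<alpha> i * \<beta> j * (- A i j)) \<le> K * K * c"
    unfolding scale using K by (auto intro!: mult_left_mono simp del: mult_minus_right)
  then show ?thesis by (simp add: sum_negf abs_le_iff)
qed

text \<open>The energy increment argument. While some rectangle \<open>S \<times> T\<close> has discrepancy above \<open>\<epsilon> n\<^sup>2\<close>,
adding \<open>\<plusminus> \<epsilon>\<close> times its indicator to the approximation lowers the squared distance to \<open>w\<close> by at least \<open>\<epsilon>\<^sup>2 n\<^sup>2\<close>.
The increments have the fixed height \<open>\<epsilon>\<close>, instead of the average discrepancy over the rectangle, since this keeps the
approximation bounded by \<open>r * \<epsilon>\<close>. A class records the membership in all rectangle sides chosen so far, with two
bits per step, which are the digits of the class in base four.\<close>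
lemma weak_regularity_step:
  fixes w :: "'a \<Rightarrow> 'a \<Rightarrow> real"
  assumes fin: "finite \<Omega>" and w: "\<And>c d. c \<in> \<Omega> \<Longrightarrow> d \<in> \<Omega> \<Longrightarrow> \<bar>w c d\<bar> \<le> 1" and \<epsilon>: "\<epsilon> > 0"
  shows "\<exists>(cls :: 'a \<Rightarrow> nat) U. (\<forall>c. cls c < 4 ^ r) \<and> (\<forall>a b. \<bar>U a b\<bar> \<le> real r * \<epsilon>) \<and>
     ((\<forall>S\<subseteq>\<Omega>. \<forall>T\<subseteq>\<Omega>. \<bar>\<Sum>c\<in>S. \<Sum>d\<in>T. w c d - U (cls c) (cls d)\<bar> \<le> \<epsilon> * (real (card \<Omega>))\<^sup>2) \<or>
      (\<Sum>c\<in>\<Omega>. \<Sum>d\<in>\<Omega>. (w c d - U (cls c) (cls d))\<^sup>2) \<le> (real (card \<Omega>))\<^sup>2 * (1 - real r * \<epsilon>\<^sup>2))"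
proof (induction r)
  case 0
  have "(\<Sum>c\<in>\<Omega>. \<Sum>d\<in>\<Omega>. (w c d)\<^sup>2) \<le> (\<Sum>c\<in>\<Omega>. \<Sum>d\<in>\<Omega>. 1)"
    by (intro sum_mono) (use w in \<open>simp add: abs_square_le_1\<close>)
  then show ?case
    by (intro exI[of _ "\<lambda>_. 0"] exI[of _ "\<lambda>_ _. 0"]) (auto simp: power2_eq_square)
next
  case (Suc r)
  then obtain cls :: "'a \<Rightarrow> nat" and U where
    cls: "\<And>c. cls c < 4 ^ r" and U: "\<And>a b. \<bar>U a b\<bar> \<le> real r * \<epsilon>" and
    or: "(\<forall>S\<subseteq>\<Omega>. \<forall>T\<subseteq>\<Omega>. \<bar>\<Sum>c\<in>S. \<Sum>d\<in>T. w c d - U (cls c) (cls d)\<bar> \<le> \<epsilon> * (real (card \<Omega>))\<^sup>2) \<or>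
      (\<Sum>c\<in>\<Omega>. \<Sum>d\<in>\<Omega>. (w c d - U (cls c) (cls d))\<^sup>2) \<le> (real (card \<Omega>))\<^sup>2 * (1 - real r * \<epsilon>\<^sup>2)"
    by blast
  show ?case
  proof (cases "\<forall>S\<subseteq>\<Omega>. \<forall>T\<subseteq>\<Omega>. \<bar>\<Sum>c\<in>S. \<Sum>d\<in>T. w c d - U (cls c) (cls d)\<bar> \<le> \<epsilon> * (real (card \<Omega>))\<^sup>2")
    case True
    have "cls c < 4 ^ Suc r" for c
      using cls[of c] by simp
    moreover have "\<bar>U a b\<bar> \<le> real (Suc r) * \<epsilon>" for a b
      using U[of a b] \<epsilon> by (simp add: algebra_simps)
    ultimately show ?thesis using True by blast
  next
    case False
    define D where "D = (\<lambda>c d. w c d - U (cls c) (cls d))"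
    from False obtain S T where ST: "S \<subseteq> \<Omega>" "T \<subseteq> \<Omega>"
      and big: "\<bar>\<Sum>c\<in>S. \<Sum>d\<in>T. D c d\<bar> > \<epsilon> * (real (card \<Omega>))\<^sup>2"
      by (auto simp: D_def not_le)
    define s where "s = sgn (\<Sum>c\<in>S. \<Sum>d\<in>T. D c d)"
    have s: "\<bar>s\<bar> \<le> 1" "s * s \<le> 1" by (auto simp: s_def sgn_if)
    define ind where "ind = (\<lambda>c d. of_bool (c \<in> S \<and> d \<in> T) :: real)"
    \<comment> \<open>the two bits of a step: bit 1 for the row side \<open>S\<close>, bit 0 for the column side \<open>T\<close>\<close>
    define cls' where "cls' = (\<lambda>c. 4 * cls c + (if c \<in> S then 2 else 0) + (if c \<in> T then 1 else 0))"
    define U' where "U' = (\<lambda>a b. U (a div 4) (b div 4) + \<epsilon> * s * of_bool (a mod 4 \<ge> 2 \<and> odd b))"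
    have U'_cls: "U' (cls' c) (cls' d) = U (cls c) (cls d) + \<epsilon> * s * ind c d" for c d
    proof -
      have "cls' c div 4 = cls c" "cls' d div 4 = cls d" by (auto simp: cls'_def)
      moreover have "cls' c mod 4 \<ge> 2 \<longleftrightarrow> c \<in> S" "odd (cls' d) \<longleftrightarrow> d \<in> T"
        unfolding cls'_def by (auto simp: mod_Suc)
      ultimately show ?thesis by (simp add: U'_def ind_def)
    qed
    have "cls' c < 4 ^ Suc r" for c
      using cls[of c] by (auto simp: cls'_def)
    moreover have "\<bar>U' a b\<bar> \<le> real (Suc r) * \<epsilon>" for a b
    proof -
      have "\<bar>U' a b\<bar> \<le> \<bar>U (a div 4) (b div 4)\<bar> + \<bar>\<epsilon> * s * of_bool (a mod 4 \<ge> 2 \<and> odd b)\<bar>"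
        unfolding U'_def by (rule abs_triangle_ineq)
      also have "\<bar>\<epsilon> * s * of_bool (a mod 4 \<ge> 2 \<and> odd b)\<bar> \<le> \<epsilon>"
        using s \<epsilon> by (auto simp: abs_mult mult_left_le)
      finally show ?thesis using U[of "a div 4" "b div 4"] by (simp add: algebra_simps)
    qed
    moreover have "(\<Sum>c\<in>\<Omega>. \<Sum>d\<in>\<Omega>. (w c d - U' (cls' c) (cls' d))\<^sup>2)
        \<le> (real (card \<Omega>))\<^sup>2 * (1 - real (Suc r) * \<epsilon>\<^sup>2)"
    proof -
      have ind_sum: "(\<Sum>c\<in>\<Omega>. \<Sum>d\<in>\<Omega>. ind c d * f c d) = (\<Sum>c\<in>S. \<Sum>d\<in>T. f c d)" for f :: "'a \<Rightarrow> 'a \<Rightarrow> real"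
      proof -
        have "(\<Sum>c\<in>\<Omega>. \<Sum>d\<in>\<Omega>. ind c d * f c d) = (\<Sum>c\<in>S. \<Sum>d\<in>\<Omega>. of_bool (d \<in> T) * f c d)"
          by (intro sum.mono_neutral_cong_right) (use ST fin in \<open>auto simp: ind_def\<close>)
        also have "\<dots> = (\<Sum>c\<in>S. \<Sum>d\<in>T. f c d)"
          by (intro sum.cong refl sum.mono_neutral_cong_right) (use ST fin in auto)
        finally show ?thesis .
      qed
      have sq: "(w c d - U' (cls' c) (cls' d))\<^sup>2
          = (D c d)\<^sup>2 - 2 * \<epsilon> * s * (ind c d * D c d) + \<epsilon>\<^sup>2 * (s * s) * ind c d" for c d
        by (simp add: U'_cls D_def ind_def power2_eq_square algebra_simps)
      have "(\<Sum>c\<in>\<Omega>. \<Sum>d\<in>\<Omega>. (w c d - U' (cls' c) (cls' d))\<^sup>2)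
          = (\<Sum>c\<in>\<Omega>. \<Sum>d\<in>\<Omega>. (D c d)\<^sup>2) - 2 * \<epsilon> * s * (\<Sum>c\<in>S. \<Sum>d\<in>T. D c d)
            + \<epsilon>\<^sup>2 * (s * s) * (\<Sum>c\<in>\<Omega>. \<Sum>d\<in>\<Omega>. ind c d)"
        unfolding sq by (simp add: sum.distrib sum_subtractf ind_sum flip: sum_distrib_left)
      also have "s * (\<Sum>c\<in>S. \<Sum>d\<in>T. D c d) = \<bar>\<Sum>c\<in>S. \<Sum>d\<in>T. D c d\<bar>"
        by (simp add: s_def abs_sgn)
      then have "2 * \<epsilon> * s * (\<Sum>c\<in>S. \<Sum>d\<in>T. D c d) \<ge> 2 * \<epsilon> * (\<epsilon> * (real (card \<Omega>))\<^sup>2)"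
        using big \<epsilon> by (simp add: mult.assoc)
      moreover have "\<epsilon>\<^sup>2 * (s * s) * (\<Sum>c\<in>\<Omega>. \<Sum>d\<in>\<Omega>. ind c d) \<le> \<epsilon>\<^sup>2 * 1 * (\<Sum>c\<in>\<Omega>. \<Sum>d\<in>\<Omega>. 1)"
        using s by (intro mult_mono sum_mono sum_nonneg) (auto simp: ind_def)
      moreover have "(\<Sum>c\<in>\<Omega>. \<Sum>d\<in>\<Omega>. (D c d)\<^sup>2) \<le> (real (card \<Omega>))\<^sup>2 * (1 - real r * \<epsilon>\<^sup>2)"
        using or False by (auto simp: D_def)
      ultimately show ?thesis by (simp add: algebra_simps power2_eq_square)
    qed
    ultimately show ?thesis by blast
  qed
qed

text \<open>After more than \<open>1 / \<epsilon>\<^sup>2\<close> steps the energy would be negative, so the cut norm alternative must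
hold by then (Frieze and Kannan).\<close>
lemma weak_regularity:
  fixes w :: "'a \<Rightarrow> 'a \<Rightarrow> real"
  assumes fin: "finite \<Omega>" and w: "\<And>c d. c \<in> \<Omega> \<Longrightarrow> d \<in> \<Omega> \<Longrightarrow> \<bar>w c d\<bar> \<le> 1" and \<epsilon>: "\<epsilon> > 0"
    and r: "real r * \<epsilon>\<^sup>2 > 1"
  obtains cls :: "'a \<Rightarrow> nat" and U where "\<And>c. cls c < 4 ^ r" "\<And>a b. \<bar>U a b\<bar> \<le> real r * \<epsilon>"
    "\<And>S T. S \<subseteq> \<Omega> \<Longrightarrow> T \<subseteq> \<Omega> \<Longrightarrow>
      \<bar>\<Sum>c\<in>S. \<Sum>d\<in>T. w c d - U (cls c) (cls d)\<bar> \<le> \<epsilon> * (real (card \<Omega>))\<^sup>2"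
proof -
  obtain cls :: "'a \<Rightarrow> nat" and U where *:
    "\<And>c. cls c < 4 ^ r" "\<And>a b. \<bar>U a b\<bar> \<le> real r * \<epsilon>" and
    or: "(\<forall>S\<subseteq>\<Omega>. \<forall>T\<subseteq>\<Omega>. \<bar>\<Sum>c\<in>S. \<Sum>d\<in>T. w c d - U (cls c) (cls d)\<bar> \<le> \<epsilon> * (real (card \<Omega>))\<^sup>2) \<or>
      (\<Sum>c\<in>\<Omega>. \<Sum>d\<in>\<Omega>. (w c d - U (cls c) (cls d))\<^sup>2) \<le> (real (card \<Omega>))\<^sup>2 * (1 - real r * \<epsilon>\<^sup>2)"
    using weak_regularity_step[where w=w and r=r, OF fin w \<epsilon>] by blast
  have "\<forall>S\<subseteq>\<Omega>. \<forall>T\<subseteq>\<Omega>. \<bar>\<Sum>c\<in>S. \<Sum>d\<in>T. w c d - U (cls c) (cls d)\<bar> \<le> \<epsilon> * (real (card \<Omega>))\<^sup>2"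
  proof (cases "\<Omega> = {}")
    case False
    then have "card \<Omega> > 0" using fin by (simp add: card_gt_0_iff)
    then have "(real (card \<Omega>))\<^sup>2 * (1 - real r * \<epsilon>\<^sup>2) < 0"
      using r by (simp add: mult_pos_neg)
    moreover have "0 \<le> (\<Sum>c\<in>\<Omega>. \<Sum>d\<in>\<Omega>. (w c d - U (cls c) (cls d))\<^sup>2)"
      by (intro sum_nonneg) auto
    ultimately show ?thesis using or by (meson le_less_trans not_le)
  qed auto
  with * show ?thesis by (intro that[of cls U]) auto
qed

text \<open>A second moment bound for random sampling, made deterministic: when \<open>a\<close> is added to the list, the
cross terms average to zero over \<open>a\<close> by the zero mean, so that some choice of \<open>a\<close> increases the sum of squares by at most
\<open>card I * D\<^sup>2\<close>.\<close>
lemma greedy_small_sums: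
  fixes \<xi> :: "'i \<Rightarrow> 'j \<Rightarrow> real"
  assumes fin: "finite I" "finite J" "J \<noteq> {}"
    and mean: "\<And>i. i \<in> I \<Longrightarrow> (\<Sum>a\<in>J. \<xi> i a) = 0"
    and bd: "\<And>i a. i \<in> I \<Longrightarrow> a \<in> J \<Longrightarrow> \<bar>\<xi> i a\<bar> \<le> D"
  shows "\<exists>L. length L = q \<and> set L \<subseteq> J \<and> (\<Sum>i\<in>I. (\<Sum>l\<leftarrow>L. \<xi> i l)\<^sup>2) \<le> real q * real (card I) * D\<^sup>2"
proof (induction q)
  case (Suc q)
  then obtain L where L: "length L = q" "set L \<subseteq> J"
    "(\<Sum>i\<in>I. (\<Sum>l\<leftarrow>L. \<xi> i l)\<^sup>2) \<le> real q * real (card I) * D\<^sup>2" by blast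
  define s where "s i = (\<Sum>l\<leftarrow>L. \<xi> i l)" for i
  have "\<exists>a\<in>J. (\<Sum>i\<in>I. (\<xi> i a + s i)\<^sup>2) \<le> (\<Sum>i\<in>I. (s i)\<^sup>2) + real (card I) * D\<^sup>2"
  proof (rule ccontr)
    assume "\<not> ?thesis"
    then have "(\<Sum>a\<in>J. \<Sum>i\<in>I. (\<xi> i a + s i)\<^sup>2) > (\<Sum>a\<in>J. (\<Sum>i\<in>I. (s i)\<^sup>2) + real (card I) * D\<^sup>2)"
      by (intro sum_strict_mono) (use fin in auto)
    moreover have "(\<Sum>a\<in>J. \<Sum>i\<in>I. (\<xi> i a + s i)\<^sup>2)
        = (\<Sum>a\<in>J. \<Sum>i\<in>I. (\<xi> i a)\<^sup>2) + (\<Sum>a\<in>J. \<Sum>i\<in>I. (s i)\<^sup>2) + (\<Sum>a\<in>J. \<Sum>i\<in>I. 2 * s i * \<xi> i a)"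
      by (simp add: power2_sum sum.distrib mult_ac)
    moreover have "(\<Sum>a\<in>J. \<Sum>i\<in>I. 2 * s i * \<xi> i a) = (\<Sum>i\<in>I. 2 * s i * (\<Sum>a\<in>J. \<xi> i a))"
      by (subst sum.swap) (simp add: sum_distrib_left)
    moreover have "\<dots> = 0" using mean by simp
    moreover have "(\<Sum>a\<in>J. \<Sum>i\<in>I. (\<xi> i a)\<^sup>2) \<le> (\<Sum>a\<in>J. \<Sum>i\<in>I. D\<^sup>2)"
      by (intro sum_mono) (metis bd abs_ge_zero power2_abs power_mono)
    ultimately show False by (simp add: sum.distrib algebra_simps)
  qed
  then obtain a where a: "a \<in> J" "(\<Sum>i\<in>I. (\<xi> i a + s i)\<^sup>2) \<le> (\<Sum>i\<in>I. (s i)\<^sup>2) + real (card I) * D\<^sup>2"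
    by blast
  show ?case
    by (rule exI[of _ "a # L"]) (use L a in \<open>auto simp: s_def algebra_simps\<close>)
qed simp

text \<open>To maximise the sum over \<open>S \<times> T\<close> for a given \<open>T\<close>, take the rows with positive sum over \<open>T\<close>. The list
\<open>L\<close> is a sample of columns that estimates all these row sums, and a row whose estimate has the wrong sign
costs at most the error of its estimate. The gain is that the new set of rows depends on \<open>T\<close> only through
a list of length at most \<open>q\<close>, so that few sets of rows have to be considered.\<close>
lemma sampled_rows:
  fixes A :: "'i \<Rightarrow> 'j \<Rightarrow> real"
  assumes fin: "finite I" "finite J"
    and bd: "\<And>i a. i \<in> I \<Longrightarrow> a \<in> J \<Longrightarrow> \<bar>A i a\<bar> \<le> B"
    and ST: "S \<subseteq> I" "T \<subseteq> J" and q: "q > 0"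
  shows "\<exists>L. length L \<le> q \<and> set L \<subseteq> T \<and>
     (\<Sum>i\<in>S. \<Sum>j\<in>T. A i j) \<le> (\<Sum>i | i \<in> I \<and> (\<Sum>l\<leftarrow>L. A i l) > 0. \<Sum>j\<in>T. A i j)
       + 2 * B * real (card I) * real (card J) / sqrt (real q)"
proof (cases "J = {} \<or> I = {}")
  case True
  then show ?thesis using ST by (intro exI[of _ "[]"]) auto
next
  case False
  define m where "m = real (card J)"
  have m: "m > 0" using False fin by (auto simp: m_def card_gt_0_iff)
  obtain i0 a0 where "i0 \<in> I" "a0 \<in> J" using False by auto
  then have B: "B \<ge> 0" using bd[of i0 a0] by linarith
  define rr where "rr i = (\<Sum>j\<in>T. A i j)" for i
  \<comment> \<open>centred so that the average over the columns vanishes\<close>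
  define \<xi> where "\<xi> i a = (if a \<in> T then A i a else 0) - rr i / m" for i a
  have mean: "(\<Sum>a\<in>J. \<xi> i a) = 0" for i
  proof -
    have "(\<Sum>a\<in>J. if a \<in> T then A i a else 0) = rr i"
      unfolding rr_def by (intro sum.mono_neutral_cong_right) (use fin ST in auto)
    then show ?thesis using m by (simp add: \<xi>_def sum_subtractf m_def)
  qed
  have \<xi>_bd: "\<bar>\<xi> i a\<bar> \<le> 2 * B" if "i \<in> I" "a \<in> J" for i a
  proof -
    have "\<bar>rr i\<bar> \<le> (\<Sum>j\<in>T. \<bar>A i j\<bar>)" unfolding rr_def by (rule sum_abs)
    also have "\<dots> \<le> (\<Sum>j\<in>T. B)"
      by (rule sum_mono) (use bd that ST in auto)
    also have "\<dots> \<le> (\<Sum>j\<in>J. B)"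
      by (rule sum_mono2) (use ST fin B in auto)
    finally have "\<bar>rr i\<bar> \<le> B * m" by (simp add: m_def mult.commute)
    then have "\<bar>rr i\<bar> / m \<le> B" using m by (simp only: pos_divide_le_eq)
    then have "\<bar>rr i / m\<bar> \<le> B" using m by (simp add: abs_divide)
    moreover have "\<bar>if a \<in> T then A i a else 0\<bar> \<le> B" using bd that B by auto
    ultimately show ?thesis unfolding \<xi>_def by linarith
  qed
  obtain L0 where L0: "length L0 = q" "set L0 \<subseteq> J"
    "(\<Sum>i\<in>I. (\<Sum>l\<leftarrow>L0. \<xi> i l)\<^sup>2) \<le> real q * real (card I) * (2 * B)\<^sup>2"
    using greedy_small_sums[of I J \<xi> "2 * B" q] fin False mean \<xi>_bd by blast
  define s where "s i = (\<Sum>l\<leftarrow>L0. \<xi> i l)" for i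
  define L where "L = filter (\<lambda>l. l \<in> T) L0"
  have sumL: "(\<Sum>l\<leftarrow>L. A i l) = s i + real q * rr i / m" for i
  proof -
    have "(\<Sum>l\<leftarrow>filter (\<lambda>l. l \<in> T) xs. A i l) = (\<Sum>l\<leftarrow>xs. \<xi> i l) + real (length xs) * rr i / m" for xs
      by (induction xs) (auto simp: \<xi>_def algebra_simps add_divide_distrib)
    then show ?thesis by (simp add: L_def s_def L0)
  qed
  define I' where "I' = {i \<in> I. (\<Sum>l\<leftarrow>L. A i l) > 0}"
  have err: "(\<Sum>i\<in>I. \<bar>s i\<bar>) \<le> 2 * B * real (card I) * sqrt (real q)"
  proof (rule power2_le_imp_le)
    have "(\<Sum>i\<in>I. \<bar>s i\<bar>)\<^sup>2 \<le> real (card I) * (\<Sum>i\<in>I. (\<bar>s i\<bar>)\<^sup>2)"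
      using sum_squared_le_sum_of_squares[of "\<lambda>i. \<bar>s i\<bar>" I] fin by (simp add: mult.commute)
    also have "\<dots> \<le> real (card I) * (real q * real (card I) * (2 * B)\<^sup>2)"
      using L0 by (intro mult_left_mono) (auto simp: s_def)
    also have "\<dots> = (2 * B * real (card I) * sqrt (real q))\<^sup>2"
      by (simp add: power2_eq_square)
    finally show "(\<Sum>i\<in>I. \<bar>s i\<bar>)\<^sup>2 \<le> (2 * B * real (card I) * sqrt (real q))\<^sup>2" .
  qed (use B in simp)
  \<comment> \<open>\<open>\<kappa>\<close> times the sum over the list estimates the row sum \<open>rr i\<close>, with error \<open>\<kappa> * \<bar>s i\<bar>\<close>\<close>
  define \<kappa> where "\<kappa> = m / real q"
  have \<kappa>: "\<kappa> > 0" using m q by (simp add: \<kappa>_def)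
  have "(\<Sum>i\<in>S. rr i) \<le> (\<Sum>i\<in>I. (if i \<in> I' then rr i else 0) + \<kappa> * \<bar>s i\<bar>)"
  proof -
    have "(\<Sum>i\<in>S. rr i) = (\<Sum>i\<in>I. if i \<in> S then rr i else 0)"
      by (intro sum.mono_neutral_cong_left) (use fin ST in auto)
    also have "\<dots> \<le> (\<Sum>i\<in>I. (if i \<in> I' then rr i else 0) + \<kappa> * \<bar>s i\<bar>)"
    proof (rule sum_mono)
      fix i assume i: "i \<in> I"
      have eq: "\<kappa> * (\<Sum>l\<leftarrow>L. A i l) = \<kappa> * s i + rr i"
        using m q by (simp add: sumL field_simps \<kappa>_def)
      have c: "\<kappa> * s i \<le> \<kappa> * \<bar>s i\<bar>" "- (\<kappa> * s i) \<le> \<kappa> * \<bar>s i\<bar>"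
        using \<kappa> mult_left_mono[of "s i" "\<bar>s i\<bar>" \<kappa>] mult_left_mono[of "- s i" "\<bar>s i\<bar>" \<kappa>] by auto
      show "(if i \<in> S then rr i else 0) \<le> (if i \<in> I' then rr i else 0) + \<kappa> * \<bar>s i\<bar>"
      proof (cases "i \<in> I'")
        case True
        then have "\<kappa> * (\<Sum>l\<leftarrow>L. A i l) > 0" unfolding I'_def using \<kappa> by (intro mult_pos_pos) auto
        then show ?thesis using c True unfolding eq by (cases "i \<in> S") auto
      next
        case False
        then have "\<kappa> * (\<Sum>l\<leftarrow>L. A i l) \<le> 0"
          unfolding I'_def using \<kappa> i by (intro mult_nonneg_nonpos) auto
        then show ?thesis using c False unfolding eq by (cases "i \<in> S") auto
      qed
    qed
    finally show ?thesis .
  qed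
  also have "\<dots> = (\<Sum>i\<in>I'. rr i) + \<kappa> * (\<Sum>i\<in>I. \<bar>s i\<bar>)"
    using fin by (simp add: sum.distrib sum_distrib_left I'_def sum.inter_filter cong: if_cong)
  also have "\<kappa> * (\<Sum>i\<in>I. \<bar>s i\<bar>) \<le> \<kappa> * (2 * B * real (card I) * sqrt (real q))"
    using err \<kappa> by (intro mult_left_mono) auto
  also have "\<dots> = 2 * B * real (card I) * m / sqrt (real q)"
    using q by (simp add: \<kappa>_def field_simps flip: power2_eq_square)
  finally show ?thesis
    by (intro exI[of _ L]) (auto simp: rr_def I'_def m_def L_def L0(1)[symmetric] length_filter_le)
qed

section \<open>Matching labels inside blocks\<close>

lemma card_filter_remove:
  assumes "finite A" "a \<in> A"
  shows "card {c\<in>A - {a}. P c} = card {c\<in>A. P c} - of_bool (P a)"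
proof -
  have "{c\<in>A - {a}. P c} = {c\<in>A. P c} - (if P a then {a} else {})" by auto
  then show ?thesis using assms by auto
qed

text \<open>Pairs with equal strip and equal label are matched as long as there are any. When none is
left, no label occurs on both sides of a strip, and matching two arbitrary elements of a strip creates one
disagreement while it lowers the right-hand side by exactly one. The subtraction is truncated: only the
surplus of a label in \<open>A\<close> counts.\<close>
lemma matching_within_strips:
  fixes f :: "'a \<Rightarrow> 't" and g :: "'b \<Rightarrow> 't" and sa :: "'a \<Rightarrow> 's" and sb :: "'b \<Rightarrow> 's"
  assumes "finite A" "finite B" "finite T"
    and "\<And>j. card {c\<in>A. sa c = j} = card {c\<in>B. sb c = j}"
    and "\<And>c. c \<in> A \<Longrightarrow> (sa c, f c) \<in> T"
  shows "\<exists>\<pi>. bij_betw \<pi> A B \<and> (\<forall>c\<in>A. sb (\<pi> c) = sa c) \<and>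
    card {c\<in>A. f c \<noteq> g (\<pi> c)} \<le>
      (\<Sum>(j, t)\<in>T. card {c\<in>A. sa c = j \<and> f c = t} - card {c\<in>B. sb c = j \<and> g c = t})"
  using assms
proof (induction "card A" arbitrary: A B)
  case 0
  then have "A = {}" by auto
  moreover have "B = {}"
  proof (rule ccontr)
    assume "B \<noteq> {}"
    then obtain b where "b \<in> B" by auto
    then have "card {c\<in>B. sb c = sb b} > 0" using 0 by (auto simp: card_gt_0_iff)
    then show False using "0.prems"(4)[of "sb b"] \<open>A = {}\<close> by simp
  qed
  ultimately show ?case by (auto simp: bij_betw_def)
next
  case (Suc n)
  define F where "F A B = (\<Sum>(j, t)\<in>T. card {c\<in>A. sa c = j \<and> f c = t} - card {c\<in>B. sb c = j \<and> g c = t})" for A B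
  have extend: "\<exists>\<pi>. bij_betw \<pi> A B \<and> (\<forall>c\<in>A. sb (\<pi> c) = sa c) \<and>
      card {c\<in>A. f c \<noteq> g (\<pi> c)} \<le> F (A - {a}) (B - {b}) + of_bool (f a \<noteq> g b)"
    if ab: "a \<in> A" "b \<in> B" "sb b = sa a" for a b
  proof -
    have strips: "card {c\<in>A - {a}. sa c = j} = card {c\<in>B - {b}. sb c = j}" for j
      unfolding card_filter_remove[OF Suc.prems(1) ab(1)] card_filter_remove[OF Suc.prems(2) ab(2)]
      using Suc.prems(4) ab(3) by simp
    have n: "n = card (A - {a})" using Suc.hyps(2) Suc.prems(1) ab by simp
    obtain \<pi> where \<pi>: "bij_betw \<pi> (A - {a}) (B - {b})" "\<forall>c\<in>A - {a}. sb (\<pi> c) = sa c"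
      "card {c\<in>A - {a}. f c \<noteq> g (\<pi> c)} \<le> F (A - {a}) (B - {b})"
      using Suc.hyps(1)[OF n _ _ Suc.prems(3) strips] Suc.prems(1,2,5) unfolding F_def by blast
    define \<pi>' where "\<pi>' = \<pi>(a := b)"
    have "bij_betw \<pi>' (A - {a}) (B - {b})"
      using \<pi>(1) by (subst bij_betw_cong[of _ _ \<pi>]) (auto simp: \<pi>'_def)
    then have "bij_betw \<pi>' (insert a (A - {a})) (insert (\<pi>' a) (B - {b}))"
      by (intro notIn_Un_bij_betw[of a _ _ "B - {b}", unfolded Un_insert_right Un_empty_right])
         (auto simp: \<pi>'_def)
    then have "bij_betw \<pi>' A B" using ab by (simp add: insert_absorb \<pi>'_def)
    moreover have "\<forall>c\<in>A. sb (\<pi>' c) = sa c" using \<pi>(2) ab by (auto simp: \<pi>'_def)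
    moreover have "card {c\<in>A. f c \<noteq> g (\<pi>' c)} \<le> F (A - {a}) (B - {b}) + of_bool (f a \<noteq> g b)"
    proof -
      have "{c\<in>A. f c \<noteq> g (\<pi>' c)} = {c\<in>A - {a}. f c \<noteq> g (\<pi> c)} \<union> (if f a \<noteq> g b then {a} else {})"
        using ab by (auto simp: \<pi>'_def)
      then have "card {c\<in>A. f c \<noteq> g (\<pi>' c)} \<le> card {c\<in>A - {a}. f c \<noteq> g (\<pi> c)} + card (if f a \<noteq> g b then {a} else {})"
        by (simp only: card_Un_le)
      then show ?thesis using \<pi>(3) by (cases "f a = g b") auto
    qed
    ultimately show ?thesis by blast
  qed
  have "\<exists>\<pi>. bij_betw \<pi> A B \<and> (\<forall>c\<in>A. sb (\<pi> c) = sa c) \<and> card {c\<in>A. f c \<noteq> g (\<pi> c)} \<le> F A B"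
  proof (cases "\<exists>a\<in>A. \<exists>b\<in>B. sb b = sa a \<and> f a = g b")
    case True
    then obtain a b where ab: "a \<in> A" "b \<in> B" "sb b = sa a" "f a = g b" by blast
    have "F (A - {a}) (B - {b}) \<le> F A B"
      unfolding F_def card_filter_remove[OF Suc.prems(1) ab(1)] card_filter_remove[OF Suc.prems(2) ab(2)]
      using ab by (intro sum_mono) auto
    then show ?thesis using extend[OF ab(1-3)] ab(4) by (auto intro: order_trans)
  next
    case False
    have "A \<noteq> {}" using Suc.hyps(2) by auto
    then obtain a where a: "a \<in> A" by blast
    have "card {c\<in>A. sa c = sa a} > 0" using a Suc.prems(1) by (auto simp: card_gt_0_iff)
    then have "{c\<in>B. sb c = sa a} \<noteq> {}" using Suc.prems(4)[of "sa a"] by (metis card.empty less_irrefl)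
    then obtain b where b: "b \<in> B" "sb b = sa a" by blast
    have "F (A - {a}) (B - {b}) < F A B"
      unfolding F_def
    proof (rule sum_strict_mono_ex1)
      have empty: "card {c\<in>B. sb c = sa a' \<and> g c = f a'} = 0" if "a' \<in> A" for a'
      proof -
        have "{c\<in>B. sb c = sa a' \<and> g c = f a'} = {}" using False that by force
        then show ?thesis by (simp only: card.empty)
      qed
      show "\<forall>x\<in>T. (case x of (j, t) \<Rightarrow> card {c\<in>A - {a}. sa c = j \<and> f c = t} - card {c\<in>B - {b}. sb c = j \<and> g c = t})
         \<le> (case x of (j, t) \<Rightarrow> card {c\<in>A. sa c = j \<and> f c = t} - card {c\<in>B. sb c = j \<and> g c = t})"
      proof (clarsimp)
        fix j t assume "(j, t) \<in> T"
        show "card {c\<in>A. c \<noteq> a \<and> sa c = j \<and> f c = t} - card {c\<in>B. c \<noteq> b \<and> sb c = j \<and> g c = t}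
           \<le> card {c\<in>A. sa c = j \<and> f c = t} - card {c\<in>B. sb c = j \<and> g c = t}"
        proof (cases "\<exists>a'\<in>A. sa a' = j \<and> f a' = t")
          case True
          then have "card {c\<in>B. sb c = j \<and> g c = t} = 0" using empty by auto
          moreover have "card {c\<in>A. c \<noteq> a \<and> sa c = j \<and> f c = t} \<le> card {c\<in>A. sa c = j \<and> f c = t}"
            by (rule card_mono) (use Suc.prems in auto)
          ultimately show ?thesis by simp
        next
          case False
          then have "{c\<in>A. c \<noteq> a \<and> sa c = j \<and> f c = t} = {}" by auto
          then show ?thesis by (metis card.empty diff_0_eq_0 le0)
        qed
      qed
      show "\<exists>x\<in>T. (case x of (j, t) \<Rightarrow> card {c\<in>A - {a}. sa c = j \<and> f c = t} - card {c\<in>B - {b}. sb c = j \<and> g c = t})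
         < (case x of (j, t) \<Rightarrow> card {c\<in>A. sa c = j \<and> f c = t} - card {c\<in>B. sb c = j \<and> g c = t})"
      proof (rule bexI[of _ "(sa a, f a)"])
        show "(sa a, f a) \<in> T" using Suc.prems a by auto
        have "card {c\<in>A - {a}. sa c = sa a \<and> f c = f a} = card {c\<in>A. sa c = sa a \<and> f c = f a} - 1"
          unfolding card_filter_remove[OF Suc.prems(1) a] by simp
        moreover have "card {c\<in>A. sa c = sa a \<and> f c = f a} > 0"
          using Suc.prems(1) a by (auto simp: card_gt_0_iff)
        ultimately show "(case (sa a, f a) of (j, t) \<Rightarrow> card {c\<in>A - {a}. sa c = j \<and> f c = t} - card {c\<in>B - {b}. sb c = j \<and> g c = t})
         < (case (sa a, f a) of (j, t) \<Rightarrow> card {c\<in>A. sa c = j \<and> f c = t} - card {c\<in>B. sb c = j \<and> g c = t})"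
          using empty[OF a] by simp
      qed
    qed (use Suc.prems in auto)
    then have "F (A - {a}) (B - {b}) + of_bool (f a \<noteq> g b) \<le> F A B" by auto
    then show ?thesis using extend[OF a b] by (meson order_trans)
  qed
  then show ?case unfolding F_def .
qed

text \<open>The superlevel sets of two monotone functions are final segments of \<open>I\<close>, hence nested, so that their
symmetric difference is no larger than the difference of their sizes. If \<open>f i \<noteq> g i\<close>, then exactly one of the two
superlevel sets at the larger value contains \<open>i\<close>.\<close>
lemma monotone_disagreement:
  fixes f g :: "nat \<Rightarrow> nat"
  assumes fin: "finite I" and mono: "mono_on I f" "mono_on I g"
    and bd: "\<And>i. i \<in> I \<Longrightarrow> f i < m \<and> g i < m"
    and close: "\<And>j. j < m \<Longrightarrow> \<bar>real (card {i\<in>I. f i \<ge> j}) - real (card {i\<in>I. g i \<ge> j})\<bar> \<le> \<delta>"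
  shows "real (card {i\<in>I. f i \<noteq> g i}) \<le> real m * \<delta>"
proof -
  have nested: "real (card {i\<in>I. (f i \<ge> j) \<noteq> (g i \<ge> j)}) \<le> \<delta>" if "j < m" for j
  proof -
    let ?F = "{i\<in>I. f i \<ge> j}" and ?G = "{i\<in>I. g i \<ge> j}"
    have "?F \<subseteq> ?G \<or> ?G \<subseteq> ?F"
    proof (rule ccontr)
      assume "\<not> ?thesis"
      then obtain a b where ab: "a \<in> ?F" "a \<notin> ?G" "b \<in> ?G" "b \<notin> ?F" by blast
      then have "a \<in> I" "b \<in> I" "f b < f a" "g a < g b" by auto
      then show False using mono_onD[OF mono(1), of a b] mono_onD[OF mono(2), of b a] by (cases a b rule: linorder_cases) auto
    qed
    moreover have "{i\<in>I. (f i \<ge> j) \<noteq> (g i \<ge> j)} = (?F - ?G) \<union> (?G - ?F)" by auto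
    moreover have "card (?F - ?G) = card ?F - card ?G" if "?G \<subseteq> ?F"
      using that fin by (intro card_Diff_subset) (auto intro: finite_subset)
    moreover have "card (?G - ?F) = card ?G - card ?F" if "?F \<subseteq> ?G"
      using that fin by (intro card_Diff_subset) (auto intro: finite_subset)
    moreover have "?F \<subseteq> ?G \<Longrightarrow> card ?F \<le> card ?G" "?G \<subseteq> ?F \<Longrightarrow> card ?G \<le> card ?F"
      using fin by (auto intro!: card_mono)
    ultimately have "real (card {i\<in>I. (f i \<ge> j) \<noteq> (g i \<ge> j)}) = \<bar>real (card ?F) - real (card ?G)\<bar>"
      by (elim disjE) (simp_all add: of_nat_diff Diff_eq_empty_iff[THEN iffD2])
    then show ?thesis using close[OF that] by simp
  qed
  have "{i\<in>I. f i \<noteq> g i} \<subseteq> (\<Union>j<m. {i\<in>I. (f i \<ge> j) \<noteq> (g i \<ge> j)})"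
  proof
    fix i assume "i \<in> {i\<in>I. f i \<noteq> g i}"
    then show "i \<in> (\<Union>j<m. {i\<in>I. (f i \<ge> j) \<noteq> (g i \<ge> j)})"
      using bd[of i] by (intro UN_I[of "max (f i) (g i)"]) auto
  qed
  then have "card {i\<in>I. f i \<noteq> g i} \<le> card (\<Union>j<m. {i\<in>I. (f i \<ge> j) \<noteq> (g i \<ge> j)})"
    using fin by (intro card_mono) auto
  also have "\<dots> \<le> (\<Sum>j<m. card {i\<in>I. (f i \<ge> j) \<noteq> (g i \<ge> j)})"
    by (rule card_UN_le) auto
  finally have "real (card {i\<in>I. f i \<noteq> g i}) \<le> (\<Sum>j<m. real (card {i\<in>I. (f i \<ge> j) \<noteq> (g i \<ge> j)}))"
    by (simp flip: of_nat_sum)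
  also have "\<dots> \<le> (\<Sum>j<m. \<delta>)" by (rule sum_mono) (use nested in auto)
  finally show ?thesis by simp
qed

section \<open>Concentration of bounded sums\<close>

text \<open>The bound \<open>n\<close> on the number of summands is a parameter of its own, so that the estimate can be
stated uniformly over index sets of varying size.\<close>
lemma hoeffding_Pi_pmf:
  fixes p :: "'i \<Rightarrow> 'c pmf" and \<psi> :: "'i \<Rightarrow> 'c \<Rightarrow> real"
  assumes fin: "finite A" and bd: "\<And>i y. \<bar>\<psi> i y\<bar> \<le> B" and B: "B > 0"
    and n: "real (card A) \<le> n" "n > 0" and s: "s \<ge> 0"
  shows "measure_pmf.prob (Pi_pmf A d p)
      {x. s \<le> \<bar>(\<Sum>i\<in>A. \<psi> i (x i)) - (\<Sum>i\<in>A. measure_pmf.expectation (p i) (\<psi> i))\<bar>}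
    \<le> 2 * exp (- (s\<^sup>2 / (2 * B\<^sup>2 * n)))"
proof (cases "A = {}")
  case True
  show ?thesis
  proof (cases "s = 0")
    case True
    then show ?thesis by (simp add: order_trans[OF measure_pmf.prob_le_1])
  qed (use True s in auto)
next
  case False
  interpret Hoeffding_ineq "measure_pmf (Pi_pmf A d p)" A "\<lambda>i x. \<psi> i (x i)" "\<lambda>_. - B" "\<lambda>_. B"
    "\<Sum>i\<in>A. measure_pmf.expectation (p i) (\<psi> i)"
  proof unfold_locales
    show "prob_space.indep_vars (measure_pmf (Pi_pmf A d p)) (\<lambda>_. borel) (\<lambda>i x. \<psi> i (x i)) A"
      by (rule prob_space.indep_vars_compose2[OF _ indep_vars_Pi_pmf])
         (auto simp: measure_pmf.prob_space_axioms fin)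
    show "AE x in measure_pmf (Pi_pmf A d p). \<psi> i (x i) \<in> {- B..B}" for i
      using bd by (intro AE_pmfI) (auto simp: abs_le_iff minus_le_iff)
    have "measure_pmf.expectation (p i) (\<psi> i) = measure_pmf.expectation (Pi_pmf A d p) (\<lambda>x. \<psi> i (x i))"
      if "i \<in> A" for i
    proof -
      have "measure_pmf.expectation (map_pmf (\<lambda>x. x i) (Pi_pmf A d p)) (\<psi> i)
          = measure_pmf.expectation (Pi_pmf A d p) (\<lambda>x. \<psi> i (x i))"
        by (rule integral_map_pmf)
      then show ?thesis using that fin by (simp add: Pi_pmf_component)
    qed
    then show "(\<Sum>i\<in>A. measure_pmf.expectation (p i) (\<psi> i)) \<equiv>
        (\<Sum>i\<in>A. measure_pmf.expectation (Pi_pmf A d p) (\<lambda>x. \<psi> i (x i)))"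
      by (intro eq_reflection sum.cong) auto
  qed (auto simp: fin)
  have card: "real (card A) > 0" using fin False by (simp add: card_gt_0_iff)
  have "measure_pmf.prob (Pi_pmf A d p)
      {x. s \<le> \<bar>(\<Sum>i\<in>A. \<psi> i (x i)) - (\<Sum>i\<in>A. measure_pmf.expectation (p i) (\<psi> i))\<bar>}
    \<le> 2 * exp (- 2 * s\<^sup>2 / (\<Sum>i\<in>A. (B - - B)\<^sup>2))"
    using Hoeffding_ineq_abs_ge[OF s] B card by simp
  also have "- 2 * s\<^sup>2 / (\<Sum>i\<in>A. (B - - B)\<^sup>2) = - (s\<^sup>2 / (2 * B\<^sup>2 * real (card A)))"
    using card B by (simp add: field_simps power2_eq_square)
  also have "2 * exp \<dots> \<le> 2 * exp (- (s\<^sup>2 / (2 * B\<^sup>2 * n)))"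
    using card B n by (auto intro!: divide_left_mono mult_left_mono mult_pos_pos)
  finally show ?thesis .
qed

text \<open>A bound that holds for every choice of the coordinates in \<open>J\<close> holds on average over them.\<close>
lemma prob_Pi_pmf_condition:
  assumes "finite I" "J \<subseteq> I"
    and le: "\<And>x. measure_pmf.prob (Pi_pmf (I - J) d p) {y. P (\<lambda>i. if i \<in> J then x i else y i)} \<le> c"
  shows "measure_pmf.prob (Pi_pmf I d p) {x. P x} \<le> c"
proof -
  have c: "0 \<le> c" using le measure_nonneg order_trans by blast
  have fin: "finite J" "finite (I - J)" using assms finite_subset by auto
  have "Pi_pmf I d p = map_pmf (\<lambda>(f,g) x. if x \<in> J then f x else g x)
      (pair_pmf (Pi_pmf J d p) (Pi_pmf (I - J) d p))"
    using Pi_pmf_union[of J "I - J" d p] fin \<open>J \<subseteq> I\<close> by (simp add: Un_absorb1)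
  then have "emeasure (measure_pmf (Pi_pmf I d p)) {x. P x}
      = (\<integral>\<^sup>+z. indicator {z. P (\<lambda>i. if i \<in> J then fst z i else snd z i)} z
          \<partial>measure_pmf (pair_pmf (Pi_pmf J d p) (Pi_pmf (I - J) d p)))"
    by (simp add: case_prod_unfold)
  also have "\<dots> = (\<integral>\<^sup>+x. \<integral>\<^sup>+y. indicator {y. P (\<lambda>i. if i \<in> J then x i else y i)} y
        \<partial>measure_pmf (Pi_pmf (I - J) d p) \<partial>measure_pmf (Pi_pmf J d p))"
    by (simp add: nn_integral_pair_pmf' indicator_def cong: if_cong)
  also have "\<dots> = (\<integral>\<^sup>+x. emeasure (measure_pmf (Pi_pmf (I - J) d p)) {y. P (\<lambda>i. if i \<in> J then x i else y i)}
        \<partial>measure_pmf (Pi_pmf J d p))"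
    by simp
  also have "\<dots> \<le> (\<integral>\<^sup>+x. ennreal c \<partial>measure_pmf (Pi_pmf J d p))"
    by (intro nn_integral_mono) (use le in \<open>auto simp: measure_pmf.emeasure_eq_measure intro!: ennreal_leI\<close>)
  also have "\<dots> = ennreal c" by simp
  finally show ?thesis using c by (simp add: measure_pmf.emeasure_eq_measure)
qed

text \<open>Hoeffding's inequality for a summand that is itself determined by the sample points with index in \<open>J\<close>.
Once these points are fixed, the others are independent of the summand; the at most \<open>card J\<close> terms with index in \<open>J\<close>, and
the corresponding part of the mean, are absorbed by \<open>2 * B * card J\<close>.\<close>
lemma conditional_hoeffding:
  fixes D :: "'c pmf" and \<phi> :: "('i \<Rightarrow> 'c) \<Rightarrow> 'c \<Rightarrow> real"
  assumes fin: "finite I" and J: "J \<subseteq> I" and bd: "\<And>x y. \<bar>\<phi> x y\<bar> \<le> B" and B: "B > 0"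
    and local: "\<And>x x'. (\<And>i. i \<in> J \<Longrightarrow> x i = x' i) \<Longrightarrow> \<phi> x = \<phi> x'"
    and k: "k = real (card I)" "k > 0" and t: "t \<ge> 0"
  shows "measure_pmf.prob (Pi_pmf I d (\<lambda>_. D))
      {x. k * t + 2 * B * real (card J) \<le> \<bar>(\<Sum>i\<in>I. \<phi> x (x i)) - k * measure_pmf.expectation D (\<phi> x)\<bar>}
    \<le> 2 * exp (- (k * t\<^sup>2 / (2 * B\<^sup>2)))"
proof (rule prob_Pi_pmf_condition[OF fin J])
  fix x :: "'i \<Rightarrow> 'c"
  define z where "z y = (\<lambda>i. if i \<in> J then x i else y i)" for y
  have z: "\<phi> (z y) = \<phi> x" for y by (rule local) (simp add: z_def)
  let ?E = "measure_pmf.expectation D (\<phi> x)"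
  have finJ: "finite J" using fin J finite_subset by auto
  have E: "\<bar>?E\<bar> \<le> B"
  proof -
    have "\<bar>?E\<bar> \<le> measure_pmf.expectation D (\<lambda>y. \<bar>\<phi> x y\<bar>)" by (rule integral_abs_bound)
    also have "\<dots> \<le> B"
      by (rule measure_pmf.integral_le_const)
         (use bd in \<open>auto intro!: measure_pmf.integrable_const_bound[where B=B] AE_pmfI\<close>)
    finally show ?thesis .
  qed
  have "{y. k * t + 2 * B * real (card J) \<le> \<bar>(\<Sum>i\<in>I. \<phi> (z y) (z y i)) - k * measure_pmf.expectation D (\<phi> (z y))\<bar>}
     \<subseteq> {y. k * t \<le> \<bar>(\<Sum>i\<in>I - J. \<phi> x (y i)) - (\<Sum>i\<in>I - J. ?E)\<bar>}"
  proof (rule subsetI, drule CollectD, rule CollectI)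
    fix y assume y: "k * t + 2 * B * real (card J) \<le> \<bar>(\<Sum>i\<in>I. \<phi> (z y) (z y i)) - k * measure_pmf.expectation D (\<phi> (z y))\<bar>"
    have split: "(\<Sum>i\<in>I. \<phi> x (z y i)) = (\<Sum>i\<in>I - J. \<phi> x (y i)) + (\<Sum>i\<in>J. \<phi> x (x i))"
      by (subst sum.subset_diff[OF J fin]) (auto simp: z_def intro!: sum.cong)
    have "k * ?E = (\<Sum>i\<in>I - J. ?E) + real (card J) * ?E"
      using k(1) card_mono[OF fin J] by (simp add: card_Diff_subset[OF finJ J] of_nat_diff algebra_simps)
    moreover have "\<bar>\<Sum>i\<in>J. \<phi> x (x i)\<bar> \<le> real (card J) * B"
      using order_trans[OF sum_abs sum_bounded_above[of J "\<lambda>i. \<bar>\<phi> x (x i)\<bar>" B]] bd by auto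
    moreover have "\<bar>real (card J) * ?E\<bar> \<le> real (card J) * B"
      using E by (simp add: abs_mult mult_left_mono)
    ultimately show "k * t \<le> \<bar>(\<Sum>i\<in>I - J. \<phi> x (y i)) - (\<Sum>i\<in>I - J. ?E)\<bar>"
      using y unfolding z split by (simp add: mult_ac)
  qed
  then have "measure_pmf.prob (Pi_pmf (I - J) d (\<lambda>_. D))
     {y. k * t + 2 * B * real (card J) \<le> \<bar>(\<Sum>i\<in>I. \<phi> (z y) (z y i)) - k * measure_pmf.expectation D (\<phi> (z y))\<bar>}
     \<le> measure_pmf.prob (Pi_pmf (I - J) d (\<lambda>_. D)) {y. k * t \<le> \<bar>(\<Sum>i\<in>I - J. \<phi> x (y i)) - (\<Sum>i\<in>I - J. ?E)\<bar>}"
    by (intro measure_pmf.finite_measure_mono) auto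
  also have "\<dots> \<le> 2 * exp (- ((k * t)\<^sup>2 / (2 * B\<^sup>2 * k)))"
    by (rule hoeffding_Pi_pmf[where \<psi>="\<lambda>_. \<phi> x"])
       (use fin bd B k t card_mono[OF fin Diff_subset] in auto)
  also have "(k * t)\<^sup>2 / (2 * B\<^sup>2 * k) = k * t\<^sup>2 / (2 * B\<^sup>2)"
    using k by (simp add: power2_eq_square)
  finally show "measure_pmf.prob (Pi_pmf (I - J) d (\<lambda>_. D))
     {y. k * t + 2 * B * real (card J) \<le> \<bar>(\<Sum>i\<in>I. \<phi> (\<lambda>i. if i \<in> J then x i else y i) (if i \<in> J then x i else y i))
        - k * measure_pmf.expectation D (\<phi> (\<lambda>i. if i \<in> J then x i else y i))\<bar>}
     \<le> 2 * exp (- (k * t\<^sup>2 / (2 * B\<^sup>2)))"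
    unfolding z_def .
qed

lemma measure_pmf_UN_le:
  assumes "finite K" "\<And>i. i \<in> K \<Longrightarrow> measure_pmf.prob M (F i) \<le> c"
  shows "measure_pmf.prob M (\<Union>i\<in>K. F i) \<le> real (card K) * c"
proof -
  have "measure_pmf.prob M (\<Union>i\<in>K. F i) \<le> (\<Sum>i\<in>K. measure_pmf.prob M (F i))"
    by (rule measure_pmf.finite_measure_subadditive_finite) (use assms in auto)
  also have "\<dots> \<le> real (card K) * c" by (rule sum_bounded_above) (use assms in auto)
  finally show ?thesis .
qed

section \<open>Sampling preserves a small cut norm\<close>

lemma card_lists_length_le_power:
  assumes "finite I"
  shows "card {L. set L \<subseteq> I \<and> length L \<le> q} \<le> (card I + 1) ^ q"
proof -
  have "(\<Sum>i\<le>q. k ^ i) \<le> (k + 1) ^ q" for k :: nat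
  proof (induction q)
    case (Suc q)
    have "k ^ Suc q \<le> k * (k + 1) ^ q" by (auto intro: mult_left_mono power_mono)
    with Suc have "(\<Sum>i\<le>q. k ^ i) + k ^ Suc q \<le> (k + 1) ^ q + k * (k + 1) ^ q" by (rule add_mono)
    then show ?case by simp
  qed simp
  then show ?thesis using assms by (simp add: card_lists_length_le)
qed

text \<open>The one-sided sampling lemma for cut norms. Two applications of \<open>sampled_rows\<close>, to rows and
then to columns, replace \<open>S\<close> and \<open>T\<close> by the sets of sample points that lie in \<open>Y x L\<close> and \<open>Z x L'\<close>, which
are determined by short lists \<open>L\<close>, \<open>L'\<close> of sample points. For given lists, conditional Hoeffding bounds replace first
the sum over the columns in \<open>Z x L'\<close> by an integral, for every row, and then the sum over the rows in \<open>Y x L\<close>; the resulting double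
integral is at most \<open>\<epsilon>\<close>. The factor \<open>(k + 1) ^ (2 * q)\<close> pays for the union over the lists.\<close>
lemma sampled_cut_le:
  fixes D :: "'c pmf" and V :: "'c \<Rightarrow> 'c \<Rightarrow> real"
  assumes fin: "finite I" and bd: "\<And>x y. \<bar>V x y\<bar> \<le> B" and B: "B > 0"
    and cut: "\<And>S T. measure_pmf.expectation D (\<lambda>x. indicator S x *
        measure_pmf.expectation D (\<lambda>y. indicator T y * V x y)) \<le> \<epsilon>"
    and k: "k = real (card I)" "k > 0" and t: "t \<ge> 0" and q: "q > 0"
  shows "measure_pmf.prob (Pi_pmf I d (\<lambda>_. D))
      {x. \<exists>S\<subseteq>I. \<exists>T\<subseteq>I. k\<^sup>2 * (\<epsilon> + 2 * t + 4 * B / sqrt (real q)) + 8 * B * real q * k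
            < (\<Sum>i\<in>S. \<Sum>j\<in>T. V (x i) (x j))}
    \<le> 4 * (k + 1) ^ (2 * q) * exp (- (k * t\<^sup>2 / (2 * B\<^sup>2)))"
proof -
  define LS where "LS = {L. set L \<subseteq> I \<and> length L \<le> q}"
  \<comment> \<open>at most \<open>2 * q\<close> sample points are fixed at a time, hence the error \<open>2 * B * (2 * q)\<close>\<close>
  define \<tau> where "\<tau> = k * t + 4 * B * real q"
  define Y where "Y x L = {y. (\<Sum>l\<leftarrow>L. V y (x l)) > 0}" for x :: "'a \<Rightarrow> 'c" and L
  define Z where "Z x L = {y. (\<Sum>l\<leftarrow>L. V (x l) y) > 0}" for x :: "'a \<Rightarrow> 'c" and L
  define E where "E x L y = measure_pmf.expectation D (\<lambda>z. indicator (Z x L) z * V y z)" for x L y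
  \<comment> \<open>\<open>\<phi>1\<close> sums a row over the columns in \<open>Z\<close>; \<open>\<phi>2\<close> sums the integrated rows over the rows in \<open>Y\<close>\<close>
  define \<phi>1 where "\<phi>1 = (\<lambda>(i, L) x y. indicator (Z x L) y * V (x i) y)"
  define \<phi>2 where "\<phi>2 = (\<lambda>(L, L') x y. indicator (Y x L) y * E x L' y)"
  define bad where "bad \<phi> = {x. \<tau> \<le> \<bar>(\<Sum>i\<in>I. \<phi> x (x i)) - k * measure_pmf.expectation D (\<phi> x)\<bar>}"
    for \<phi> :: "('a \<Rightarrow> 'c) \<Rightarrow> 'c \<Rightarrow> real"
  define e where "e = 2 * exp (- (k * t\<^sup>2 / (2 * B\<^sup>2)))"
  let ?P = "measure_pmf.prob (Pi_pmf I d (\<lambda>_. D))"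
  have finLS: "finite LS" unfolding LS_def conj_commute[of "set _ \<subseteq> _"]
    using finite_lists_length_le[OF fin] by (simp add: conj_commute)
  have cardLS: "real (card LS) \<le> (k + 1) ^ q"
  proof -
    have "real (card LS) \<le> real ((card I + 1) ^ q)"
      unfolding LS_def of_nat_le_iff by (rule card_lists_length_le_power[OF fin])
    then show ?thesis using k by (simp add: add.commute)
  qed
  have bad_le: "?P (bad \<phi>) \<le> e"
    if "\<And>x y. \<bar>\<phi> x y\<bar> \<le> B" "J \<subseteq> I" "card J \<le> 2 * q" "\<And>x x'. (\<And>i. i \<in> J \<Longrightarrow> x i = x' i) \<Longrightarrow> \<phi> x = \<phi> x'"
    for \<phi> J
  proof -
    have "2 * B * real (card J) \<le> 2 * B * real (2 * q)"
      using that(3) B by (intro mult_left_mono) (auto simp del: of_nat_mult)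
    then have "bad \<phi> \<subseteq> {x. k * t + 2 * B * real (card J) \<le> \<bar>(\<Sum>i\<in>I. \<phi> x (x i)) - k * measure_pmf.expectation D (\<phi> x)\<bar>}"
      unfolding bad_def \<tau>_def by auto
    then have "?P (bad \<phi>) \<le> ?P {x. k * t + 2 * B * real (card J) \<le> \<bar>(\<Sum>i\<in>I. \<phi> x (x i)) - k * measure_pmf.expectation D (\<phi> x)\<bar>}"
      by (intro measure_pmf.finite_measure_mono) auto
    also have "\<dots> \<le> e"
      unfolding e_def by (rule conditional_hoeffding[OF fin that(2) that(1) B that(4) k t])
    finally show ?thesis .
  qed
  have Y_cong: "Y x L = Y x' L" if "\<And>i. i \<in> set L \<Longrightarrow> x i = x' i" for L x x'
  proof -
    have "map (\<lambda>l. V y (x l)) L = map (\<lambda>l. V y (x' l)) L" for y using that by auto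
    then show ?thesis unfolding Y_def by (simp only:)
  qed
  have Z_cong: "Z x L = Z x' L" if "\<And>i. i \<in> set L \<Longrightarrow> x i = x' i" for L x x'
  proof -
    have "map (\<lambda>l. V (x l) y) L = map (\<lambda>l. V (x' l) y) L" for y using that by auto
    then show ?thesis unfolding Z_def by (simp only:)
  qed
  have bad1: "?P (bad (\<phi>1 iL)) \<le> e" if "iL \<in> I \<times> LS" for iL
  proof -
    obtain i L where iL: "iL = (i, L)" "i \<in> I" "set L \<subseteq> I" "length L \<le> q" using \<open>iL \<in> I \<times> LS\<close> by (auto simp: LS_def)
    show ?thesis
    proof (rule bad_le[where J="insert i (set L)"])
      show "card (insert i (set L)) \<le> 2 * q"
        using card_insert_le_m1[of "2 * q" "set L" i] card_length[of L] iL q by simp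
      show "\<bar>\<phi>1 iL x y\<bar> \<le> B" for x y using bd B by (auto simp: \<phi>1_def iL indicator_def)
      show "\<phi>1 iL x = \<phi>1 iL x'" if "\<And>j. j \<in> insert i (set L) \<Longrightarrow> x j = x' j" for x x'
        using that Z_cong[of L x x'] by (auto simp: \<phi>1_def iL)
    qed (use iL in auto)
  qed
  have E_bd: "\<bar>E x L y\<bar> \<le> B" for x L y
  proof -
    have "\<bar>E x L y\<bar> \<le> measure_pmf.expectation D (\<lambda>z. \<bar>indicator (Z x L) z * V y z\<bar>)"
      unfolding E_def by (rule integral_abs_bound)
    also have "\<dots> \<le> B"
      by (rule measure_pmf.integral_le_const)
         (use bd B in \<open>auto intro!: measure_pmf.integrable_const_bound[where B=B] AE_pmfI simp: indicator_def\<close>)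
    finally show ?thesis .
  qed
  have bad2: "?P (bad (\<phi>2 LL)) \<le> e" if "LL \<in> LS \<times> LS" for LL
  proof -
    obtain L L' where LL: "LL = (L, L')" "set L \<subseteq> I" "length L \<le> q" "set L' \<subseteq> I" "length L' \<le> q"
      using \<open>LL \<in> LS \<times> LS\<close> by (auto simp: LS_def)
    show ?thesis
    proof (rule bad_le[where J="set L \<union> set L'"])
      show "card (set L \<union> set L') \<le> 2 * q"
        using card_Un_le[of "set L" "set L'"] card_length[of L] card_length[of L'] LL by simp
      show "\<bar>\<phi>2 LL x y\<bar> \<le> B" for x y using E_bd B by (auto simp: \<phi>2_def LL indicator_def)
      show "\<phi>2 LL x = \<phi>2 LL x'" if "\<And>j. j \<in> set L \<union> set L' \<Longrightarrow> x j = x' j" for x x'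
        using that Y_cong[of L x x'] Z_cong[of L' x x'] by (auto simp: \<phi>2_def LL E_def)
    qed (use LL in auto)
  qed
  have "{x. \<exists>S\<subseteq>I. \<exists>T\<subseteq>I. k\<^sup>2 * (\<epsilon> + 2 * t + 4 * B / sqrt (real q)) + 8 * B * real q * k
            < (\<Sum>i\<in>S. \<Sum>j\<in>T. V (x i) (x j))}
     \<subseteq> (\<Union>iL\<in>I \<times> LS. bad (\<phi>1 iL)) \<union> (\<Union>LL\<in>LS \<times> LS. bad (\<phi>2 LL))"
  proof (rule subsetI, rule ccontr)
    fix x
    assume "x \<in> {x. \<exists>S\<subseteq>I. \<exists>T\<subseteq>I. k\<^sup>2 * (\<epsilon> + 2 * t + 4 * B / sqrt (real q)) + 8 * B * real q * k
            < (\<Sum>i\<in>S. \<Sum>j\<in>T. V (x i) (x j))}"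
    then obtain S T where ST: "S \<subseteq> I" "T \<subseteq> I"
      and large: "k\<^sup>2 * (\<epsilon> + 2 * t + 4 * B / sqrt (real q)) + 8 * B * real q * k < (\<Sum>i\<in>S. \<Sum>j\<in>T. V (x i) (x j))"
      by blast
    assume "x \<notin> (\<Union>iL\<in>I \<times> LS. bad (\<phi>1 iL)) \<union> (\<Union>LL\<in>LS \<times> LS. bad (\<phi>2 LL))"
    then have good1: "(\<Sum>j\<in>I. \<phi>1 (i, L) x (x j)) \<le> k * measure_pmf.expectation D (\<phi>1 (i, L) x) + \<tau>"
      if "i \<in> I" "L \<in> LS" for i L
      using that by (fastforce simp: bad_def)
    from \<open>x \<notin> _\<close> have good2: "(\<Sum>j\<in>I. \<phi>2 (L, L') x (x j)) \<le> k * measure_pmf.expectation D (\<phi>2 (L, L') x) + \<tau>"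
      if "L \<in> LS" "L' \<in> LS" for L L'
      using that by (fastforce simp: bad_def)
    obtain L where L: "length L \<le> q" "set L \<subseteq> T"
      and S': "(\<Sum>i\<in>S. \<Sum>j\<in>T. V (x i) (x j)) \<le> (\<Sum>i | i \<in> I \<and> (\<Sum>l\<leftarrow>L. V (x i) (x l)) > 0. \<Sum>j\<in>T. V (x i) (x j))
        + 2 * B * k * k / sqrt (real q)"
      using sampled_rows[OF fin fin, of "\<lambda>i j. V (x i) (x j)" B S T q] bd ST q k(1) by blast
    define I1 where "I1 = {i\<in>I. x i \<in> Y x L}"
    have I1: "I1 \<subseteq> I" by (auto simp: I1_def)
    obtain L' where L': "length L' \<le> q" "set L' \<subseteq> I1"
      and T': "(\<Sum>j\<in>T. \<Sum>i\<in>I1. V (x i) (x j)) \<le> (\<Sum>j | j \<in> I \<and> (\<Sum>l\<leftarrow>L'. V (x l) (x j)) > 0. \<Sum>i\<in>I1. V (x i) (x j))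
        + 2 * B * k * k / sqrt (real q)"
      using sampled_rows[OF fin fin, of "\<lambda>j i. V (x i) (x j)" B T I1 q] bd ST I1 q k(1) by blast
    have LS: "L \<in> LS" "L' \<in> LS" using L L' ST I1 by (auto simp: LS_def)
    define I2 where "I2 = {j\<in>I. x j \<in> Z x L'}"
    have "(\<Sum>i\<in>S. \<Sum>j\<in>T. V (x i) (x j)) \<le> (\<Sum>i\<in>I1. \<Sum>j\<in>T. V (x i) (x j)) + 2 * B * k * k / sqrt (real q)"
      using S' by (simp add: I1_def Y_def)
    also have "(\<Sum>i\<in>I1. \<Sum>j\<in>T. V (x i) (x j)) = (\<Sum>j\<in>T. \<Sum>i\<in>I1. V (x i) (x j))" by (rule sum.swap)
    also have "\<dots> \<le> (\<Sum>j\<in>I2. \<Sum>i\<in>I1. V (x i) (x j)) + 2 * B * k * k / sqrt (real q)"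
      using T' by (simp add: I2_def Z_def)
    also have "(\<Sum>j\<in>I2. \<Sum>i\<in>I1. V (x i) (x j)) = (\<Sum>i\<in>I1. \<Sum>j\<in>I2. V (x i) (x j))" by (rule sum.swap)
    also have "\<dots> = (\<Sum>i\<in>I1. \<Sum>j\<in>I. \<phi>1 (i, L') x (x j))"
      unfolding I2_def \<phi>1_def prod.case
      by (intro sum.cong refl sum.mono_neutral_cong_left) (use fin in auto)
    also have "\<dots> \<le> (\<Sum>i\<in>I1. k * E x L' (x i) + \<tau>)"
      using good1[OF _ LS(2)] I1 by (intro sum_mono) (auto simp: \<phi>1_def E_def)
    also have "\<dots> = k * (\<Sum>i\<in>I1. E x L' (x i)) + real (card I1) * \<tau>"
      by (simp add: sum.distrib sum_distrib_left)
    also have "(\<Sum>i\<in>I1. E x L' (x i)) = (\<Sum>i\<in>I. \<phi>2 (L, L') x (x i))"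
      unfolding I1_def \<phi>2_def prod.case by (rule sum.mono_neutral_cong_left) (use fin in auto)
    also have "\<dots> \<le> k * measure_pmf.expectation D (\<phi>2 (L, L') x) + \<tau>"
      by (rule good2[OF LS])
    also have "measure_pmf.expectation D (\<phi>2 (L, L') x) \<le> \<epsilon>"
      using cut[of "Y x L" "Z x L'"] by (simp add: \<phi>2_def E_def)
    also have "real (card I1) * \<tau> \<le> k * \<tau>"
      using card_mono[OF fin I1] k t B by (intro mult_right_mono) (auto simp: \<tau>_def)
    finally have "(\<Sum>i\<in>S. \<Sum>j\<in>T. V (x i) (x j)) \<le> k * (k * \<epsilon> + \<tau>) + k * \<tau>
        + 2 * B * k * k / sqrt (real q) + 2 * B * k * k / sqrt (real q)"
      using k t B by (auto simp: \<tau>_def)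
    also have "\<dots> = k\<^sup>2 * (\<epsilon> + 2 * t + 4 * B / sqrt (real q)) + 8 * B * real q * k"
      by (simp add: \<tau>_def power2_eq_square algebra_simps)
    finally show False using large by simp
  qed
  then have "?P {x. \<exists>S\<subseteq>I. \<exists>T\<subseteq>I. k\<^sup>2 * (\<epsilon> + 2 * t + 4 * B / sqrt (real q)) + 8 * B * real q * k
            < (\<Sum>i\<in>S. \<Sum>j\<in>T. V (x i) (x j))}
     \<le> ?P ((\<Union>iL\<in>I \<times> LS. bad (\<phi>1 iL)) \<union> (\<Union>LL\<in>LS \<times> LS. bad (\<phi>2 LL)))"
    by (intro measure_pmf.finite_measure_mono) auto
  also have "\<dots> \<le> ?P (\<Union>iL\<in>I \<times> LS. bad (\<phi>1 iL)) + ?P (\<Union>LL\<in>LS \<times> LS. bad (\<phi>2 LL))"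
    by (rule measure_Un_le) auto
  also have "\<dots> \<le> real (card (I \<times> LS)) * e + real (card (LS \<times> LS)) * e"
    by (intro add_mono measure_pmf_UN_le bad1 bad2) (use fin finLS in auto)
  also have "\<dots> = (k * real (card LS) + real (card LS) * real (card LS)) * e"
    using k by (simp add: card_cartesian_product algebra_simps)
  also have "\<dots> \<le> ((k + 1) ^ q * (k + 1) ^ q + (k + 1) ^ q * (k + 1) ^ q) * e"
  proof (intro mult_right_mono add_mono mult_mono cardLS)
    have "k + 1 \<le> (k + 1) ^ q" using k q by (intro self_le_power) auto
    then show "k \<le> (k + 1) ^ q" by simp
  qed (use k in \<open>auto simp: e_def\<close>)
  also have "\<dots> = 4 * (k + 1) ^ (2 * q) * exp (- (k * t\<^sup>2 / (2 * B\<^sup>2)))"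
    unfolding e_def mult_2[of q] power_add by algebra
  finally show ?thesis .
qed

lemma sampled_cut_abs_le:
  fixes D :: "'c pmf" and V :: "'c \<Rightarrow> 'c \<Rightarrow> real"
  assumes fin: "finite I" and bd: "\<And>x y. \<bar>V x y\<bar> \<le> B" and B: "B > 0"
    and cut: "\<And>S T. \<bar>measure_pmf.expectation D (\<lambda>x. indicator S x *
        measure_pmf.expectation D (\<lambda>y. indicator T y * V x y))\<bar> \<le> \<epsilon>"
    and k: "k = real (card I)" "k > 0" and t: "t \<ge> 0" and q: "q > 0"
  shows "measure_pmf.prob (Pi_pmf I d (\<lambda>_. D))
      {x. \<exists>S\<subseteq>I. \<exists>T\<subseteq>I. k\<^sup>2 * (\<epsilon> + 2 * t + 4 * B / sqrt (real q)) + 8 * B * real q * k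
            < \<bar>\<Sum>i\<in>S. \<Sum>j\<in>T. V (x i) (x j)\<bar>}
    \<le> 8 * (k + 1) ^ (2 * q) * exp (- (k * t\<^sup>2 / (2 * B\<^sup>2)))"
proof -
  let ?P = "measure_pmf.prob (Pi_pmf I d (\<lambda>_. D))"
  let ?c = "k\<^sup>2 * (\<epsilon> + 2 * t + 4 * B / sqrt (real q)) + 8 * B * real q * k"
  let ?F = "\<lambda>V :: 'c \<Rightarrow> 'c \<Rightarrow> real. {x. \<exists>S\<subseteq>I. \<exists>T\<subseteq>I. ?c < (\<Sum>i\<in>S. \<Sum>j\<in>T. V (x i) (x j))}"
  have "{x. \<exists>S\<subseteq>I. \<exists>T\<subseteq>I. ?c < \<bar>\<Sum>i\<in>S. \<Sum>j\<in>T. V (x i) (x j)\<bar>} \<subseteq> ?F V \<union> ?F (\<lambda>x y. - V x y)"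
  proof (rule subsetI)
    fix x assume "x \<in> {x. \<exists>S\<subseteq>I. \<exists>T\<subseteq>I. ?c < \<bar>\<Sum>i\<in>S. \<Sum>j\<in>T. V (x i) (x j)\<bar>}"
    then obtain S T where ST: "S \<subseteq> I" "T \<subseteq> I" "?c < \<bar>\<Sum>i\<in>S. \<Sum>j\<in>T. V (x i) (x j)\<bar>" by blast
    from ST(3) have "?c < (\<Sum>i\<in>S. \<Sum>j\<in>T. V (x i) (x j)) \<or> ?c < (\<Sum>i\<in>S. \<Sum>j\<in>T. - V (x i) (x j))"
      unfolding sum_negf by linarith
    then show "x \<in> ?F V \<union> ?F (\<lambda>x y. - V x y)" using ST(1,2) by blast
  qed
  then have "?P {x. \<exists>S\<subseteq>I. \<exists>T\<subseteq>I. ?c < \<bar>\<Sum>i\<in>S. \<Sum>j\<in>T. V (x i) (x j)\<bar>} \<le> ?P (?F V \<union> ?F (\<lambda>x y. - V x y))"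
    by (intro measure_pmf.finite_measure_mono) auto
  also have "\<dots> \<le> ?P (?F V) + ?P (?F (\<lambda>x y. - V x y))"
    by (rule measure_Un_le) auto
  also have "\<dots> \<le> 4 * (k + 1) ^ (2 * q) * exp (- (k * t\<^sup>2 / (2 * B\<^sup>2))) + 4 * (k + 1) ^ (2 * q) * exp (- (k * t\<^sup>2 / (2 * B\<^sup>2)))"
  proof (rule add_mono)
    show "?P (?F V) \<le> 4 * (k + 1) ^ (2 * q) * exp (- (k * t\<^sup>2 / (2 * B\<^sup>2)))"
      by (rule sampled_cut_le[OF fin bd B abs_le_D1[OF cut] k t q])
    show "?P (?F (\<lambda>x y. - V x y)) \<le> 4 * (k + 1) ^ (2 * q) * exp (- (k * t\<^sup>2 / (2 * B\<^sup>2)))"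
    proof (rule sampled_cut_le[OF fin _ B _ k t q])
      fix S T
      show "measure_pmf.expectation D (\<lambda>x. indicator S x * measure_pmf.expectation D (\<lambda>y. indicator T y * - V x y)) \<le> \<epsilon>"
        using abs_le_D2[OF cut[of S T]] by simp
    qed (use bd in auto)
  qed
  finally show ?thesis by simp
qed

lemma sampled_type_counts:
  fixes D :: "'c pmf" and \<tau> :: "'c \<Rightarrow> 't"
  assumes fin: "finite I" "finite Ty" and k: "k = real (card I)" "k > 0" and t: "t \<ge> 0"
  shows "measure_pmf.prob (Pi_pmf I d (\<lambda>_. D))
      {x. \<exists>y\<in>Ty. k * t \<le> \<bar>real (card {i\<in>I. \<tau> (x i) = y}) - k * measure_pmf.prob D {c. \<tau> c = y}\<bar>}
    \<le> 2 * real (card Ty) * exp (- (k * t\<^sup>2 / 2))"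
proof -
  have "measure_pmf.prob (Pi_pmf I d (\<lambda>_. D))
      {x. k * t \<le> \<bar>real (card {i\<in>I. \<tau> (x i) = y}) - k * measure_pmf.prob D {c. \<tau> c = y}\<bar>} \<le> 2 * exp (- (k * t\<^sup>2 / 2))" for y
  proof -
    have "real (card {i\<in>I. \<tau> (x i) = y}) = (\<Sum>i\<in>I. indicator {c. \<tau> c = y} (x i))" for x
      using fin by (simp add: indicator_def sum.If_cases Int_def)
    moreover have "measure_pmf.expectation D (indicator {c. \<tau> c = y}) = measure_pmf.prob D {c. \<tau> c = y}"
      by simp
    ultimately have "measure_pmf.prob (Pi_pmf I d (\<lambda>_. D))
      {x. k * t \<le> \<bar>real (card {i\<in>I. \<tau> (x i) = y}) - k * measure_pmf.prob D {c. \<tau> c = y}\<bar>}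
       \<le> 2 * exp (- ((k * t)\<^sup>2 / (2 * 1\<^sup>2 * k)))"
      using hoeffding_Pi_pmf[of I "\<lambda>_. indicator {c. \<tau> c = y}" 1 k "k * t" d "\<lambda>_. D"] fin k t by simp
    also have "(k * t)\<^sup>2 / (2 * 1\<^sup>2 * k) = k * t\<^sup>2 / 2" using k(2) by (simp add: power2_eq_square)
    finally show ?thesis .
  qed
  then have "measure_pmf.prob (Pi_pmf I d (\<lambda>_. D))
      (\<Union>y\<in>Ty. {x. k * t \<le> \<bar>real (card {i\<in>I. \<tau> (x i) = y}) - k * measure_pmf.prob D {c. \<tau> c = y}\<bar>})
     \<le> real (card Ty) * (2 * exp (- (k * t\<^sup>2 / 2)))"
    by (intro measure_pmf_UN_le fin)
  also have "(\<Union>y\<in>Ty. {x. k * t \<le> \<bar>real (card {i\<in>I. \<tau> (x i) = y}) - k * measure_pmf.prob D {c. \<tau> c = y}\<bar>})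
     = {x. \<exists>y\<in>Ty. k * t \<le> \<bar>real (card {i\<in>I. \<tau> (x i) = y}) - k * measure_pmf.prob D {c. \<tau> c = y}\<bar>}" by auto
  finally show ?thesis by simp
qed

section \<open>The random edges\<close>

text \<open>The index set of the potential edges in the definition of the random graph.\<close>
definition pairs_upto :: "nat \<Rightarrow> (nat \<times> nat) set" where
  "pairs_upto k = {(i, j). 1 \<le> i \<and> i < j \<and> j \<le> k}"

lemma finite_pairs_upto [simp]: "finite (pairs_upto k)"
  by (rule finite_subset[of _ "{1..k} \<times> {1..k}"]) (auto simp: pairs_upto_def)

lemma card_pairs_upto_le: "card (pairs_upto k) \<le> k * k"
proof -
  have "card (pairs_upto k) \<le> card ({1..k} \<times> {1..k})"
    by (rule card_mono) (auto simp: pairs_upto_def)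
  then show ?thesis by simp
qed

lemma sum_square_split_diagonal:
  fixes g :: "nat \<Rightarrow> nat \<Rightarrow> real"
  shows "(\<Sum>i\<in>{1..k}. \<Sum>j\<in>{1..k}. g i j) = (\<Sum>(i, j)\<in>pairs_upto k. g i j + g j i) + (\<Sum>i\<in>{1..k}. g i i)"
proof -
  let ?E = "pairs_upto k" and ?D = "(\<lambda>i. (i, i)) ` {1..k}"
  have "(\<Sum>i\<in>{1..k}. \<Sum>j\<in>{1..k}. g i j) = (\<Sum>(i, j)\<in>{1..k} \<times> {1..k}. g i j)"
    by (rule sum.cartesian_product)
  also have "{1..k} \<times> {1..k} = (?E \<union> prod.swap ` ?E) \<union> ?D"
    by (force simp: pairs_upto_def image_iff)
  also have "(\<Sum>(i, j)\<in>(?E \<union> prod.swap ` ?E) \<union> ?D. g i j)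
      = (\<Sum>(i, j)\<in>?E \<union> prod.swap ` ?E. g i j) + (\<Sum>(i, j)\<in>?D. g i j)"
    by (rule sum.union_disjoint)
      (intro finite_imageI finite_UnI finite_pairs_upto finite_atLeastAtMost | auto simp: pairs_upto_def)+
  also have "(\<Sum>(i, j)\<in>?E \<union> prod.swap ` ?E. g i j) = (\<Sum>(i, j)\<in>?E. g i j) + (\<Sum>(i, j)\<in>prod.swap ` ?E. g i j)"
    by (rule sum.union_disjoint)
      (intro finite_imageI finite_UnI finite_pairs_upto finite_atLeastAtMost | auto simp: pairs_upto_def)+
  also have "(\<Sum>(i, j)\<in>prod.swap ` ?E. g i j) = (\<Sum>(i, j)\<in>?E. g j i)"
    by (subst sum.reindex) (auto simp: case_prod_unfold)
  also have "(\<Sum>(i, j)\<in>?D. g i j) = (\<Sum>i\<in>{1..k}. g i i)"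
    by (subst sum.reindex) (auto simp: inj_on_def)
  finally show ?thesis by (simp add: sum.distrib case_prod_unfold)
qed

text \<open>Each unordered pair enters a sum over \<open>S \<times> T\<close> with weight at most \<open>2\<close>, and distinct pairs are
independent. The term \<open>real k\<close> covers the diagonal, where \<open>G\<close> has no edge while \<open>W\<close> may be positive.\<close>
lemma random_edges_cut_le:
  assumes h: "\<And>i j. i \<in> {1..k} \<Longrightarrow> j \<in> {1..k} \<Longrightarrow> 0 \<le> W (q i, q j) \<and> W (q i, q j) \<le> 1 \<and> W (q i, q j) = W (q j, q i)"
    and k: "k > 0" and s: "s \<ge> 0"
  shows "measure_pmf.prob (random_edges k W q)
     {G. \<exists>S\<subseteq>{1..k}. \<exists>T\<subseteq>{1..k}. (real k)\<^sup>2 * s + real k \<le> \<bar>\<Sum>i\<in>S. \<Sum>j\<in>T. of_bool (G i j) - W (q i, q j)\<bar>}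
     \<le> 2 * 4 ^ k * exp (- ((real k)\<^sup>2 * s\<^sup>2 / 8))"
proof -
  let ?E = "pairs_upto k"
  define p where "p = (\<lambda>(i, j). bernoulli_pmf (W (q i, q j)))"
  define M where "M = Pi_pmf ?E False p"
  define n where "n S T = (\<lambda>(i, j). of_bool (i \<in> S \<and> j \<in> T) + of_bool (j \<in> S \<and> i \<in> T) :: real)" for S T :: "nat set"
  define bad where "bad S T = {e. (real k)\<^sup>2 * s \<le>
      \<bar>(\<Sum>ij\<in>?E. n S T ij * of_bool (e ij)) - (\<Sum>ij\<in>?E. measure_pmf.expectation (p ij) (\<lambda>b. n S T ij * of_bool b))\<bar>}" for S T
  have bad: "measure_pmf.prob M (bad S T) \<le> 2 * exp (- ((real k)\<^sup>2 * s\<^sup>2 / 8))" for S T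
  proof -
    have "measure_pmf.prob M (bad S T) \<le> 2 * exp (- (((real k)\<^sup>2 * s)\<^sup>2 / (2 * 2\<^sup>2 * (real k)\<^sup>2)))"
      unfolding M_def bad_def
    proof (rule hoeffding_Pi_pmf[where \<psi>="\<lambda>ij b. n S T ij * of_bool b"])
      show "real (card ?E) \<le> (real k)\<^sup>2"
        using card_pairs_upto_le[of k] by (metis of_nat_le_iff of_nat_mult power2_eq_square)
    qed (use k s in \<open>auto simp: n_def\<close>)
    also have "((real k)\<^sup>2 * s)\<^sup>2 / (2 * 2\<^sup>2 * (real k)\<^sup>2) = (real k)\<^sup>2 * s\<^sup>2 / 8"
      using k by (simp add: power2_eq_square)
    finally show ?thesis .
  qed
  have E: "measure_pmf.expectation (p (i, j)) (\<lambda>b. n S T (i, j) * of_bool b) = n S T (i, j) * W (q i, q j)"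
    if "(i, j) \<in> ?E" for i j S T
    using h[of i j] that by (auto simp: p_def pairs_upto_def)
  have main: "e \<in> bad S T" if ST: "S \<subseteq> {1..k}" "T \<subseteq> {1..k}"
    and large: "(real k)\<^sup>2 * s + real k \<le> \<bar>\<Sum>i\<in>S. \<Sum>j\<in>T. of_bool (graph_of_pairs e i j) - W (q i, q j)\<bar>" for e S T
  proof -
    define g where "g i j = (if i \<in> S \<and> j \<in> T then of_bool (graph_of_pairs e i j) - W (q i, q j) else 0)" for i j
    have "(\<Sum>i\<in>S. \<Sum>j\<in>T. of_bool (graph_of_pairs e i j) - W (q i, q j)) = (\<Sum>i\<in>{1..k}. \<Sum>j\<in>{1..k}. g i j)"
    proof -
      have "(\<Sum>i\<in>S. \<Sum>j\<in>T. of_bool (graph_of_pairs e i j) - W (q i, q j)) = (\<Sum>i\<in>S. \<Sum>j\<in>{1..k}. g i j)"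
        by (intro sum.cong refl sum.mono_neutral_cong_left) (use ST in \<open>auto simp: g_def\<close>)
      also have "\<dots> = (\<Sum>i\<in>{1..k}. \<Sum>j\<in>{1..k}. g i j)"
        by (intro sum.mono_neutral_cong_left) (use ST in \<open>auto simp: g_def\<close>)
      finally show ?thesis .
    qed
    also have "\<dots> = (\<Sum>(i, j)\<in>?E. g i j + g j i) + (\<Sum>i\<in>{1..k}. g i i)"
      by (rule sum_square_split_diagonal)
    also have "(\<Sum>(i, j)\<in>?E. g i j + g j i) = (\<Sum>ij\<in>?E. n S T ij * of_bool (e ij)) - (\<Sum>ij\<in>?E. measure_pmf.expectation (p ij) (\<lambda>b. n S T ij * of_bool b))"
      unfolding sum_subtractf[symmetric]
    proof (rule sum.cong[OF refl], clarify)
      fix i j assume ij: "(i, j) \<in> ?E"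
      then have *: "i < j" "W (q j, q i) = W (q i, q j)" using h[of i j] by (auto simp: pairs_upto_def)
      show "g i j + g j i = n S T (i, j) * of_bool (e (i, j)) - measure_pmf.expectation (p (i, j)) (\<lambda>b. n S T (i, j) * of_bool b)"
        unfolding E[OF ij] using * by (auto simp: g_def n_def graph_of_pairs_def)
    qed
    finally have eq: "(\<Sum>i\<in>S. \<Sum>j\<in>T. of_bool (graph_of_pairs e i j) - W (q i, q j)) =
      (\<Sum>ij\<in>?E. n S T ij * of_bool (e ij)) - (\<Sum>ij\<in>?E. measure_pmf.expectation (p ij) (\<lambda>b. n S T ij * of_bool b)) + (\<Sum>i\<in>{1..k}. g i i)" .
    have "\<bar>\<Sum>i\<in>{1..k}. g i i\<bar> \<le> (\<Sum>i\<in>{1..k}. \<bar>g i i\<bar>)" by (rule sum_abs)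
    also have "\<dots> \<le> (\<Sum>i\<in>{1..k}. 1)"
      by (rule sum_mono) (use h in \<open>auto simp: g_def graph_of_pairs_def\<close>)
    finally have "\<bar>\<Sum>i\<in>{1..k}. g i i\<bar> \<le> real k" by simp
    then show ?thesis using large unfolding eq bad_def mem_Collect_eq by linarith
  qed
  let ?ST = "Pow {1..k} \<times> Pow {1..k}"
  have "measure_pmf.prob (random_edges k W q)
     {G. \<exists>S\<subseteq>{1..k}. \<exists>T\<subseteq>{1..k}. (real k)\<^sup>2 * s + real k \<le> \<bar>\<Sum>i\<in>S. \<Sum>j\<in>T. of_bool (G i j) - W (q i, q j)\<bar>}
     = measure_pmf.prob M
     {e. \<exists>S\<subseteq>{1..k}. \<exists>T\<subseteq>{1..k}. (real k)\<^sup>2 * s + real k \<le> \<bar>\<Sum>i\<in>S. \<Sum>j\<in>T. of_bool (graph_of_pairs e i j) - W (q i, q j)\<bar>}"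
    by (simp add: random_edges_def M_def p_def pairs_upto_def vimage_def)
  also have "\<dots> \<le> measure_pmf.prob M (\<Union>ST\<in>?ST. bad (fst ST) (snd ST))"
  proof (intro measure_pmf.finite_measure_mono subsetI)
    fix e
    assume "e \<in> {e. \<exists>S\<subseteq>{1..k}. \<exists>T\<subseteq>{1..k}. (real k)\<^sup>2 * s + real k \<le> \<bar>\<Sum>i\<in>S. \<Sum>j\<in>T. of_bool (graph_of_pairs e i j) - W (q i, q j)\<bar>}"
    then obtain S T where ST: "S \<subseteq> {1..k}" "T \<subseteq> {1..k}"
      "(real k)\<^sup>2 * s + real k \<le> \<bar>\<Sum>i\<in>S. \<Sum>j\<in>T. of_bool (graph_of_pairs e i j) - W (q i, q j)\<bar>" by blast
    show "e \<in> (\<Union>ST\<in>?ST. bad (fst ST) (snd ST))"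
      by (rule UN_I[of "(S, T)"]) (use ST main[OF ST] in auto)
  qed auto
  also have "\<dots> \<le> real (card ?ST) * (2 * exp (- ((real k)\<^sup>2 * s\<^sup>2 / 8)))"
    by (rule measure_pmf_UN_le) (auto intro: bad)
  also have "real (card ?ST) = 4 ^ k"
    by (simp add: card_cartesian_product card_Pow power_mult_distrib[symmetric])
  finally show ?thesis by simp
qed

section \<open>Cells of a grid on the unit square\<close>

definition grid_cells :: "nat \<Rightarrow> (nat \<times> nat) set" where
  "grid_cells M = {1..M} \<times> {1..M}"

text \<open>Since \<open>Q M\<close> sends \<open>0\<close> to the first interval, every point of the closed square has a cell, and the cells are
compatible with the strips in the orderon of a graph.\<close>
definition cell_of :: "nat \<Rightarrow> point \<Rightarrow> nat \<times> nat" where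
  "cell_of M u = (Q M (fst u), Q M (snd u))"

text \<open>The points with positive coordinates in a cell. The half-open form makes the regions translates of each other; the
two sides of the square through the origin belong to no region.\<close>
definition cell_region :: "nat \<Rightarrow> nat \<times> nat \<Rightarrow> point set" where
  "cell_region M c = {(real (fst c) - 1) / real M<..real (fst c) / real M} \<times>
     {(real (snd c) - 1) / real M<..real (snd c) / real M}"

lemma Q_eq_iff:
  assumes "M > 0" "x > 0" "a \<ge> 1"
  shows "Q M x = a \<longleftrightarrow> (real a - 1) / real M < x \<and> x \<le> real a / real M"
proof -
  have pos: "\<lceil>real M * x\<rceil> \<ge> 0" using assms mult_pos_pos[of "real M" x] by (simp add: less_le_trans[of "-1" 0])
  have "Q M x = a \<longleftrightarrow> \<lceil>real M * x\<rceil> = int a" using assms pos by (auto simp: Q_def)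
  also have "\<dots> \<longleftrightarrow> real a - 1 < real M * x \<and> real M * x \<le> real a"
    by (simp add: ceiling_eq_iff)
  also have "\<dots> \<longleftrightarrow> (real a - 1) / real M < x \<and> x \<le> real a / real M"
    using assms by (simp add: field_simps)
  finally show ?thesis .
qed

lemma Q_pos: "M > 0 \<Longrightarrow> 0 \<le> x \<Longrightarrow> 1 \<le> Q M x"
proof -
  assume "M > 0" "0 \<le> x"
  moreover have "1 \<le> nat \<lceil>real M * x\<rceil>" if "x > 0"
  proof -
    have "\<lceil>real M * x\<rceil> \<ge> 1" using \<open>M > 0\<close> that by simp
    then show ?thesis by linarith
  qed
  ultimately show ?thesis by (cases "x = 0") (auto simp: Q_def simp del: One_nat_def)
qed

lemma Q_le: "M > 0 \<Longrightarrow> 0 \<le> x \<Longrightarrow> x \<le> 1 \<Longrightarrow> Q M x \<le> M"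
proof -
  assume "M > 0" "0 \<le> x" "x \<le> 1"
  then have "\<lceil>real M * x\<rceil> \<le> int M" by (simp add: ceiling_le_iff mult_left_le)
  then have "nat \<lceil>real M * x\<rceil> \<le> M" by (simp only: nat_le_iff)
  then show ?thesis using \<open>M > 0\<close> by (simp add: Q_def)
qed

lemma Q_approx:
  assumes "M > 0" "0 \<le> x"
  shows "\<bar>x - real (Q M x) / real M\<bar> \<le> 1 / real M"
proof (cases "x = 0")
  case False
  then have "(real (Q M x) - 1) / real M < x \<and> x \<le> real (Q M x) / real M"
    using Q_eq_iff[of M x "Q M x"] Q_pos[of M x] assms by simp
  then show ?thesis by (simp add: diff_divide_distrib abs_le_iff)
qed (use assms in \<open>simp add: Q_def\<close>)

lemma mono_Q: "0 \<le> x \<Longrightarrow> x \<le> y \<Longrightarrow> M > 0 \<Longrightarrow> Q M x \<le> Q M y"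
proof (cases "x = 0")
  case True
  assume "0 \<le> x" "x \<le> y" "M > 0"
  then show ?thesis using Q_pos[of M y] True by (simp add: Q_def[of _ 0])
next
  case False
  assume "0 \<le> x" "x \<le> y" "M > 0"
  then have "nat \<lceil>real M * x\<rceil> \<le> nat \<lceil>real M * y\<rceil>" by (intro nat_mono ceiling_mono mult_left_mono) auto
  then show ?thesis using False \<open>0 \<le> x\<close> \<open>x \<le> y\<close> by (simp add: Q_def)
qed

lemma cell_of_in_grid: "M > 0 \<Longrightarrow> u \<in> unit_square \<Longrightarrow> cell_of M u \<in> grid_cells M"
  using Q_pos Q_le by (auto simp: unit_square_def grid_cells_def cell_of_def simp del: One_nat_def)

text \<open>Rounding up to a multiple of \<open>1 / (k * l)\<close> and then to a multiple of \<open>1 / k\<close> is the same as rounding up once.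
Hence each vertex strip of a graph orderon is a union of columns of cells.\<close>
lemma Q_coarsen:
  assumes "k > 0" "l > 0" "x \<ge> 0"
  shows "Q k x = (Q (k * l) x - 1) div l + 1"
proof (cases "x = 0")
  case False
  define a where "a = Q (k * l) x"
  have a: "a \<ge> 1" unfolding a_def by (rule Q_pos) (use assms in auto)
  have ax: "(real a - 1) / real (k * l) < x" "x \<le> real a / real (k * l)"
    using Q_eq_iff[of "k * l" x a] assms False a by (auto simp: a_def)
  define b where "b = (a - 1) div l"
  have "b * l \<le> a - 1" "a - 1 < (b + 1) * l"
    using assms dividend_less_div_times[of l "a - 1"] by (auto simp: b_def algebra_simps)
  then have "real b * real l \<le> real a - 1" "real a \<le> (real b + 1) * real l"
  proof -
    have "real (b * l) \<le> real (a - 1)" "real (a - 1) + 1 \<le> real ((b + 1) * l)"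
      using \<open>b * l \<le> a - 1\<close> \<open>a - 1 < (b + 1) * l\<close> nat_less_real_le by (simp_all only: of_nat_le_iff)
    then show "real b * real l \<le> real a - 1" "real a \<le> (real b + 1) * real l"
      using a by (simp_all add: of_nat_diff algebra_simps)
  qed
  then have "real b / real k \<le> (real a - 1) / real (k * l)" "real a / real (k * l) \<le> (real b + 1) / real k"
    using assms by (auto simp: field_simps)
  then have "real b / real k < x" "x \<le> (real b + 1) / real k"
    using ax by (auto simp only: intro: le_less_trans order_trans)
  then have "Q k x = b + 1" using Q_eq_iff[of k x "b + 1"] assms False by (simp add: add.commute)
  then show ?thesis by (simp add: b_def a_def)
qed (use assms in \<open>simp add: Q_def\<close>)

lemma finite_grid_cells [simp]: "finite (grid_cells M)" by (simp add: grid_cells_def)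

lemma card_grid_cells: "card (grid_cells M) = M * M" by (simp add: grid_cells_def card_cartesian_product)

lemma mem_cell_region_iff:
  assumes "M > 0" "c \<in> grid_cells M"
  shows "u \<in> cell_region M c \<longleftrightarrow> 0 < fst u \<and> 0 < snd u \<and> cell_of M u = c"
proof -
  have c: "fst c \<ge> 1" "snd c \<ge> 1" using assms by (auto simp: grid_cells_def)
  have nn: "(real (fst c) - 1) / real M \<ge> 0" "(real (snd c) - 1) / real M \<ge> 0" using c assms by auto
  have iff: "0 < fst u \<and> 0 < snd u \<Longrightarrow> u \<in> cell_region M c \<longleftrightarrow> cell_of M u = c"
    using Q_eq_iff[OF assms(1) _ c(1), of "fst u"] Q_eq_iff[OF assms(1) _ c(2), of "snd u"]
    by (auto simp: cell_region_def cell_of_def prod_eq_iff mem_Times_iff)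
  have "u \<in> cell_region M c \<Longrightarrow> 0 < fst u \<and> 0 < snd u"
    using nn by (auto simp: cell_region_def mem_Times_iff intro: le_less_trans)
  with iff show ?thesis by blast
qed

lemma cell_region_subset: "M > 0 \<Longrightarrow> c \<in> grid_cells M \<Longrightarrow> cell_region M c \<subseteq> unit_square"
proof
  fix u assume *: "M > 0" "c \<in> grid_cells M" "u \<in> cell_region M c"
  then have "0 < fst u" "0 < snd u" by (auto simp: mem_cell_region_iff)
  moreover have "fst u \<le> 1" "snd u \<le> 1"
    using * by (auto simp: cell_region_def mem_Times_iff grid_cells_def elim!: order_trans simp: divide_le_eq)
  ultimately show "u \<in> unit_square" by (auto simp: unit_square_def mem_Times_iff)
qed

lemma cell_region_borel [measurable]: "cell_region M c \<in> sets borel"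
  unfolding cell_region_def by (intro borel_Times) auto

lemma measure_lborel_cell_region: "M > 0 \<Longrightarrow> emeasure lborel (cell_region M c) = ennreal (1 / (real M)\<^sup>2)"
proof -
  assume M: "M > 0"
  have "emeasure lborel (cell_region M c) = emeasure (lborel \<Otimes>\<^sub>M lborel) (cell_region M c)"
    by (simp add: lborel_prod)
  also have "\<dots> = emeasure lborel {(real (fst c) - 1) / real M<..real (fst c) / real M} *
     emeasure lborel {(real (snd c) - 1) / real M<..real (snd c) / real M}"
    unfolding cell_region_def by (rule lborel.emeasure_pair_measure_Times) auto
  also have "\<dots> = ennreal (1 / real M) * ennreal (1 / real M)"
  proof -
    have "a / real M - (a - 1) / real M = 1 / real M" for a using M by (simp add: diff_divide_distrib)
    moreover have "(a - 1) / real M \<le> a / real M" for a using M by (simp add: divide_right_mono)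
    ultimately show ?thesis by (simp add: emeasure_lborel_Ioc)
  qed
  finally show ?thesis using M by (simp add: power2_eq_square flip: ennreal_mult)
qed

lemma emeasure_lebesgue_Un_null:
  assumes "A \<in> sets lborel" "N' \<in> null_sets lborel" "N \<subseteq> N'"
  shows "emeasure lebesgue (A \<union> N) = emeasure lborel A"
proof -
  have "emeasure lebesgue (A \<union> N) = emeasure lebesgue A"
  proof (rule emeasure_eq_AE)
    have "AE z in lebesgue. z \<notin> N'" using assms by (intro AE_not_in null_sets_completionI)
    then show "AE z in lebesgue. z \<in> A \<union> N \<longleftrightarrow> z \<in> A"
      by eventually_elim (use assms in auto)
    show "A \<union> N \<in> sets lebesgue" by (rule sets_completionI[OF refl assms(3,2,1)])
  qed (use assms in auto)
  then show ?thesis using assms by simp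
qed

lemma null_sets_cylinders:
  fixes N :: "'a::euclidean_space set" and K :: "'b::euclidean_space set"
  assumes "N \<in> null_sets lborel" "K \<in> null_sets lborel"
  shows "N \<times> UNIV \<union> UNIV \<times> K \<in> null_sets (lborel :: ('a \<times> 'b) measure)"
proof (rule null_sets.Un)
  show "N \<times> UNIV \<in> null_sets (lborel :: ('a \<times> 'b) measure)" "UNIV \<times> K \<in> null_sets (lborel :: ('a \<times> 'b) measure)"
    using assms by (auto simp: null_sets_def lborel_prod[symmetric] lborel.emeasure_pair_measure_Times simp del: UNIV_Times_UNIV)
qed

text \<open>Up to null sets, Lebesgue sets are Borel sets, for which the product formula is that of \<open>lborel\<close>.\<close>
lemma measure_lebesgue_Times:
  fixes S :: "'a::euclidean_space set" and T :: "'b::euclidean_space set"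
  assumes S: "S \<in> sets lebesgue" and T: "T \<in> sets lebesgue"
  shows "S \<times> T \<in> sets lebesgue" "emeasure lebesgue (S \<times> T) = emeasure lebesgue S * emeasure lebesgue T"
proof -
  obtain S0 N N' where S0: "S = S0 \<union> N" "N \<subseteq> N'" "N' \<in> null_sets lborel" "S0 \<in> sets lborel"
    using S by (rule sets_completionE)
  obtain T0 K K' where T0: "T = T0 \<union> K" "K \<subseteq> K'" "K' \<in> null_sets lborel" "T0 \<in> sets lborel"
    using T by (rule sets_completionE)
  have null: "N' \<times> UNIV \<union> UNIV \<times> K' \<in> null_sets (lborel :: ('a \<times> 'b) measure)"
    by (rule null_sets_cylinders) (use S0 T0 in auto)
  have borel: "S0 \<times> T0 \<in> sets lborel" using S0 T0 by (auto intro: borel_Times)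
  have sub: "S \<times> T - S0 \<times> T0 \<subseteq> N' \<times> UNIV \<union> UNIV \<times> K'" using S0 T0 by auto
  show meas: "S \<times> T \<in> sets lebesgue"
    by (rule sets_completionI[OF _ sub null borel]) (use S0 T0 in auto)
  have "S \<times> T = S0 \<times> T0 \<union> (S \<times> T - S0 \<times> T0)" using S0 T0 by auto
  then have "emeasure lebesgue (S \<times> T) = emeasure lborel (S0 \<times> T0)"
    using emeasure_lebesgue_Un_null[OF borel null sub] by simp
  also have "\<dots> = emeasure lborel S0 * emeasure lborel T0"
    using S0 T0 borel by (simp add: lborel_prod[symmetric] lborel.emeasure_pair_measure_Times)
  also have "emeasure lborel S0 = emeasure lebesgue S"
    using emeasure_lebesgue_Un_null[OF S0(4,3,2)] S0(1) by simp
  also have "emeasure lborel T0 = emeasure lebesgue T"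
    using emeasure_lebesgue_Un_null[OF T0(4,3,2)] T0(1) by simp
  finally show "emeasure lebesgue (S \<times> T) = emeasure lebesgue S * emeasure lebesgue T" .
qed

section \<open>Permuting the cells\<close>

definition cell_shift :: "nat \<Rightarrow> (nat \<times> nat \<Rightarrow> nat \<times> nat) \<Rightarrow> nat \<times> nat \<Rightarrow> point" where
  "cell_shift M \<pi> c = ((real (fst (\<pi> c)) - real (fst c)) / real M, (real (snd (\<pi> c)) - real (snd c)) / real M)"

text \<open>The identity on the two sides through the origin keeps the map bijective on the closed square.\<close>
definition permute_cells :: "nat \<Rightarrow> (nat \<times> nat \<Rightarrow> nat \<times> nat) \<Rightarrow> point \<Rightarrow> point" where
  "permute_cells M \<pi> u = (if 0 < fst u \<and> 0 < snd u then cell_shift M \<pi> (cell_of M u) + u else u)"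

lemma cell_shift_region_iff:
  "cell_shift M \<pi> c + u \<in> cell_region M (\<pi> c) \<longleftrightarrow> u \<in> cell_region M c"
proof -
  have *: "(p - c) / m + x \<in> {(p - 1) / m<..p / m} \<longleftrightarrow> x \<in> {(c - 1) / m<..c / m}" for p c m x :: real
    by (auto simp: diff_divide_distrib)
  show ?thesis
    unfolding cell_region_def cell_shift_def mem_Times_iff fst_add snd_add fst_conv snd_conv * ..
qed

lemma permute_cells_region:
  assumes "M > 0" "c \<in> grid_cells M" "u \<in> cell_region M c"
  shows "permute_cells M \<pi> u = cell_shift M \<pi> c + u" "permute_cells M \<pi> u \<in> cell_region M (\<pi> c)"
proof -
  show "permute_cells M \<pi> u = cell_shift M \<pi> c + u"
    using assms mem_cell_region_iff[OF assms(1,2)] by (simp add: permute_cells_def)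
  then show "permute_cells M \<pi> u \<in> cell_region M (\<pi> c)" using cell_shift_region_iff assms(3) by simp
qed

lemma in_cell_region:
  assumes "M > 0" "u \<in> unit_square" "0 < fst u" "0 < snd u"
  shows "u \<in> cell_region M (cell_of M u)" "cell_of M u \<in> grid_cells M"
  using assms cell_of_in_grid mem_cell_region_iff by auto

lemma permute_cells_inverse:
  assumes M: "M > 0" and \<pi>: "\<And>c. c \<in> grid_cells M \<Longrightarrow> \<pi> c \<in> grid_cells M \<and> \<rho> (\<pi> c) = c" and u: "u \<in> unit_square"
  shows "permute_cells M \<pi> u \<in> unit_square" "permute_cells M \<rho> (permute_cells M \<pi> u) = u"
proof -
  let ?c = "cell_of M u"
  have "permute_cells M \<pi> u \<in> unit_square \<and> permute_cells M \<rho> (permute_cells M \<pi> u) = u"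
  proof (cases "0 < fst u \<and> 0 < snd u")
    case True
    then have c: "u \<in> cell_region M ?c" "?c \<in> grid_cells M" using in_cell_region M u by auto
    have "permute_cells M \<rho> (permute_cells M \<pi> u) = cell_shift M \<rho> (\<pi> ?c) + (cell_shift M \<pi> ?c + u)"
      using permute_cells_region[OF M c(2,1), of \<pi>] permute_cells_region(1)[OF M, of "\<pi> ?c" _ \<rho>] \<pi>[OF c(2)] by simp
    also have "\<dots> = u"
      using \<pi>[OF c(2)] by (cases u) (auto simp: cell_shift_def add_divide_distrib[symmetric] diff_divide_distrib)
    finally show ?thesis
      using permute_cells_region(2)[OF M c(2,1), of \<pi>] subsetD[OF cell_region_subset[OF M]] \<pi>[OF c(2)] by blast
  next
    case False
    then have "permute_cells M \<sigma> u = u" for \<sigma> unfolding permute_cells_def by (simp only: if_False)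
    then show ?thesis using u by simp
  qed
  then show "permute_cells M \<pi> u \<in> unit_square" "permute_cells M \<rho> (permute_cells M \<pi> u) = u" by auto
qed

lemma unit_square_borel: "unit_square \<in> sets borel"
  unfolding unit_square_def by (intro borel_Times) auto

text \<open>The preimage of \<open>A\<close> is a disjoint union of translates of the pieces of \<open>A\<close> in the regions, together with the piece of
\<open>A\<close> on the two sides that are left fixed.\<close>
lemma permute_cells_vimage:
  assumes M: "M > 0" and bij: "bij_betw \<pi> (grid_cells M) (grid_cells M)"
    and A: "A \<in> sets lebesgue" "A \<subseteq> unit_square"
  shows "permute_cells M \<pi> -` A \<inter> unit_square \<in> sets lebesgue"
    "emeasure lebesgue (permute_cells M \<pi> -` A \<inter> unit_square) = emeasure lebesgue A"
proof -
  let ?G = "grid_cells M"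
  define Z where "Z = {u \<in> unit_square. fst u = 0 \<or> snd u = 0}"
  define P where "P c = (+) (- cell_shift M \<pi> c) ` (A \<inter> cell_region M (\<pi> c))" for c
  have \<pi>: "c \<in> ?G \<Longrightarrow> \<pi> c \<in> ?G" for c using bij bij_betwE by blast
  have P_eq: "P c = permute_cells M \<pi> -` A \<inter> cell_region M c" if "c \<in> ?G" for c
  proof (intro set_eqI)
    fix u
    have "u \<in> P c \<longleftrightarrow> cell_shift M \<pi> c + u \<in> A \<inter> cell_region M (\<pi> c)"
      unfolding P_def by (auto intro: image_eqI[of _ _ "cell_shift M \<pi> c + u"])
    then show "u \<in> P c \<longleftrightarrow> u \<in> permute_cells M \<pi> -` A \<inter> cell_region M c"
      using permute_cells_region(1)[OF M that, of u \<pi>] by (auto simp: cell_shift_region_iff)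
  qed
  have cover: "u \<in> (\<Union>c\<in>?G. cell_region M c) \<union> Z" if "u \<in> unit_square" for u
  proof (cases "u \<in> Z")
    case False
    then have "0 < fst u" "0 < snd u" using that by (auto simp: Z_def unit_square_def less_le)
    then show ?thesis using in_cell_region[OF M that] by blast
  qed blast
  have Zdisj: "u \<notin> cell_region M c" if "u \<in> Z" "c \<in> ?G" for u c
    using mem_cell_region_iff[OF M that(2)] that(1) by (auto simp: Z_def)
  have disj: "disjoint_family_on (cell_region M) ?G"
    using mem_cell_region_iff[OF M] by (auto simp: disjoint_family_on_def)
  have vimage_eq: "permute_cells M \<pi> -` A \<inter> unit_square = (\<Union>c\<in>?G. P c) \<union> (A \<inter> Z)"
  proof -
    have "u \<in> Z \<Longrightarrow> permute_cells M \<pi> u = u" for u by (auto simp: Z_def permute_cells_def)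
    then have "permute_cells M \<pi> -` A \<inter> Z = A \<inter> Z" by auto
    moreover have "permute_cells M \<pi> -` A \<inter> unit_square =
        (\<Union>c\<in>?G. permute_cells M \<pi> -` A \<inter> cell_region M c) \<union> (permute_cells M \<pi> -` A \<inter> Z)"
    proof (intro equalityI subsetI)
      fix u assume "u \<in> permute_cells M \<pi> -` A \<inter> unit_square"
      then show "u \<in> (\<Union>c\<in>?G. permute_cells M \<pi> -` A \<inter> cell_region M c) \<union> (permute_cells M \<pi> -` A \<inter> Z)"
        using cover by blast
    next
      fix u assume "u \<in> (\<Union>c\<in>?G. permute_cells M \<pi> -` A \<inter> cell_region M c) \<union> (permute_cells M \<pi> -` A \<inter> Z)"
      moreover have "Z \<subseteq> unit_square" by (auto simp: Z_def)
      ultimately show "u \<in> permute_cells M \<pi> -` A \<inter> unit_square"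
        using cell_region_subset[OF M] by blast
    qed
    ultimately show ?thesis using P_eq by simp
  qed
  have A_eq: "A = (\<Union>c\<in>?G. A \<inter> cell_region M c) \<union> (A \<inter> Z)"
    using cover A(2) by blast
  have Zm: "A \<inter> Z \<in> sets lebesgue"
  proof -
    have "Z = {0} \<times> {0..1} \<union> {0..1} \<times> {0}" by (auto simp: Z_def unit_square_def)
    then have "Z \<in> sets borel" by (auto intro!: borel_Times)
    then have "Z \<in> sets lebesgue" by auto
    then show ?thesis using A by auto
  qed
  have Am: "A \<inter> cell_region M c \<in> sets lebesgue" for c using A(1) by (intro sets.Int) auto
  have Pm: "P c \<in> sets lebesgue" for c unfolding P_def by (rule lebesgue_sets_translation[OF Am])
  have Pe: "emeasure lebesgue (P c) = emeasure lebesgue (A \<inter> cell_region M (\<pi> c))" for c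
    using emeasure_lebesgue_affine[of 1 "- cell_shift M \<pi> c" "A \<inter> cell_region M (\<pi> c)"]
    by (simp add: P_def add.commute[of _ "- cell_shift M \<pi> c"] cong: image_cong_simp)
  show "permute_cells M \<pi> -` A \<inter> unit_square \<in> sets lebesgue"
    unfolding vimage_eq using Pm Zm by (intro sets.Un sets.finite_UN) auto
  have "emeasure lebesgue ((\<Union>c\<in>?G. P c) \<union> (A \<inter> Z)) = emeasure lebesgue (\<Union>c\<in>?G. P c) + emeasure lebesgue (A \<inter> Z)"
  proof (rule plus_emeasure[symmetric])
    show "(\<Union>c\<in>?G. P c) \<inter> (A \<inter> Z) = {}" using P_eq Zdisj by blast
    show "(\<Union>c\<in>?G. P c) \<in> sets lebesgue" using Pm by (intro sets.finite_UN) auto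
  qed (rule Zm)
  also have "emeasure lebesgue (\<Union>c\<in>?G. P c) = (\<Sum>c\<in>?G. emeasure lebesgue (P c))"
  proof (rule sum_emeasure[symmetric])
    show "disjoint_family_on P ?G"
      using disj P_eq unfolding disjoint_family_on_def by blast
  qed (use Pm in auto)
  also have "\<dots> = (\<Sum>c\<in>?G. emeasure lebesgue (A \<inter> cell_region M c))"
    unfolding Pe by (rule sum.reindex_bij_betw[OF bij])
  also have "\<dots> = emeasure lebesgue (\<Union>c\<in>?G. A \<inter> cell_region M c)"
  proof (rule sum_emeasure)
    show "disjoint_family_on (\<lambda>c. A \<inter> cell_region M c) ?G"
      using disj unfolding disjoint_family_on_def by blast
  qed (use Am in auto)
  also have "\<dots> + emeasure lebesgue (A \<inter> Z) = emeasure lebesgue ((\<Union>c\<in>?G. A \<inter> cell_region M c) \<union> (A \<inter> Z))"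
  proof (rule plus_emeasure)
    show "(\<Union>c\<in>?G. A \<inter> cell_region M c) \<inter> (A \<inter> Z) = {}" using Zdisj by blast
    show "(\<Union>c\<in>?G. A \<inter> cell_region M c) \<in> sets lebesgue" using Am by (intro sets.finite_UN) auto
  qed (rule Zm)
  finally show "emeasure lebesgue (permute_cells M \<pi> -` A \<inter> unit_square) = emeasure lebesgue A"
    unfolding vimage_eq A_eq[symmetric] .
qed

lemma permute_cells_measure_preserving:
  assumes M: "M > 0" and bij: "bij_betw \<pi> (grid_cells M) (grid_cells M)"
  shows "measure_preserving_map (lebesgue_on unit_square) (lebesgue_on unit_square) (permute_cells M \<pi>)"
proof -
  have sq: "unit_square \<in> sets lebesgue" using unit_square_borel by auto
  have sets: "A \<in> sets (lebesgue_on unit_square) \<longleftrightarrow> A \<in> sets lebesgue \<and> A \<subseteq> unit_square" for A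
    using sets_restrict_space_iff[of unit_square lebesgue A] sq by auto
  have inv: "c \<in> grid_cells M \<Longrightarrow> \<pi> c \<in> grid_cells M \<and> inv_into (grid_cells M) \<pi> (\<pi> c) = c" for c
    using bij by (auto simp: bij_betw_def)
  have meas: "permute_cells M \<pi> \<in> measurable (lebesgue_on unit_square) (lebesgue_on unit_square)"
  proof (rule measurableI)
    show "permute_cells M \<pi> u \<in> space (lebesgue_on unit_square)" if "u \<in> space (lebesgue_on unit_square)" for u
      using permute_cells_inverse(1)[OF M inv] that by simp
    show "permute_cells M \<pi> -` A \<inter> space (lebesgue_on unit_square) \<in> sets (lebesgue_on unit_square)"
      if "A \<in> sets (lebesgue_on unit_square)" for A
      using permute_cells_vimage(1)[OF M bij, of A] that unfolding sets by simp
  qed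
  moreover have "distr (lebesgue_on unit_square) (lebesgue_on unit_square) (permute_cells M \<pi>) = lebesgue_on unit_square"
  proof (rule measure_eqI)
    fix A assume "A \<in> sets (distr (lebesgue_on unit_square) (lebesgue_on unit_square) (permute_cells M \<pi>))"
    then have A: "A \<in> sets (lebesgue_on unit_square)" by simp
    then have "emeasure (distr (lebesgue_on unit_square) (lebesgue_on unit_square) (permute_cells M \<pi>)) A
       = emeasure (lebesgue_on unit_square) (permute_cells M \<pi> -` A \<inter> unit_square)"
      using meas by (simp add: emeasure_distr)
    also have "\<dots> = emeasure lebesgue (permute_cells M \<pi> -` A \<inter> unit_square)"
      by (rule emeasure_restrict_space) (use sq in auto)
    also have "\<dots> = emeasure lebesgue A" using permute_cells_vimage(2)[OF M bij, of A] A sets by auto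
    also have "\<dots> = emeasure (lebesgue_on unit_square) A"
      by (rule emeasure_restrict_space[symmetric]) (use sq A sets in auto)
    finally show "emeasure (distr (lebesgue_on unit_square) (lebesgue_on unit_square) (permute_cells M \<pi>)) A
       = emeasure (lebesgue_on unit_square) A" .
  qed simp
  ultimately show ?thesis by (simp add: measure_preserving_map_def)
qed

text \<open>On the square, the inverse of \<open>permute_cells M \<pi>\<close> permutes the cells by the inverse of \<open>\<pi>\<close>.\<close>
lemma permute_cells_mp_bijection:
  assumes M: "M > 0" and bij: "bij_betw \<pi> (grid_cells M) (grid_cells M)"
  shows "permute_cells M \<pi> \<in> mp_bijections"
proof -
  define \<rho> where "\<rho> = inv_into (grid_cells M) \<pi>"
  have bij': "bij_betw \<rho> (grid_cells M) (grid_cells M)" unfolding \<rho>_def by (rule bij_betw_inv_into[OF bij])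
  have *: "\<pi> c \<in> grid_cells M \<and> \<rho> (\<pi> c) = c" "\<rho> c \<in> grid_cells M \<and> \<pi> (\<rho> c) = c" if "c \<in> grid_cells M" for c
    using that bij bij_betwE[OF bij] bij_betwE[OF bij'] bij_betw_inv_into_left[OF bij] bij_betw_inv_into_right[OF bij] by (auto simp: \<rho>_def)
  have bb: "bij_betw (permute_cells M \<pi>) unit_square unit_square"
    by (rule bij_betw_byWitness[where f'="permute_cells M \<rho>"])
       (use permute_cells_inverse[OF M *(1)] permute_cells_inverse[OF M *(2)] in auto)
  have inv: "inv_into unit_square (permute_cells M \<pi>) u = permute_cells M \<rho> u" if "u \<in> unit_square" for u
    using permute_cells_inverse[OF M *(2) that] bb by (intro inv_into_f_eq) (auto simp: bij_betw_def)
  have "measure_preserving_map (lebesgue_on unit_square) (lebesgue_on unit_square) (inv_into unit_square (permute_cells M \<pi>))"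
  proof -
    have "inv_into unit_square (permute_cells M \<pi>) \<in> measurable (lebesgue_on unit_square) (lebesgue_on unit_square)
      \<longleftrightarrow> permute_cells M \<rho> \<in> measurable (lebesgue_on unit_square) (lebesgue_on unit_square)"
      by (rule measurable_cong) (use inv in auto)
    moreover have "distr (lebesgue_on unit_square) (lebesgue_on unit_square) (inv_into unit_square (permute_cells M \<pi>))
       = distr (lebesgue_on unit_square) (lebesgue_on unit_square) (permute_cells M \<rho>)"
      by (rule distr_cong) (use inv in auto)
    ultimately show ?thesis
      using permute_cells_measure_preserving[OF M bij'] by (simp add: measure_preserving_map_def)
  qed
  then show ?thesis
    using bb permute_cells_measure_preserving[OF M bij] by (simp add: mp_bijections_def)
qed

section \<open>Bounding the cut-shift distance\<close>

text \<open>If \<open>V\<close> is not integrable, for instance because it is not measurable, then its integral is zero by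
convention and the bound holds as well.\<close>
lemma abs_set_integral_le:
  fixes V :: "'a \<Rightarrow> real"
  assumes bd: "\<And>z. z \<in> A \<Longrightarrow> \<bar>V z\<bar> \<le> g z" and g: "set_integrable M A g"
  shows "\<bar>LINT z:A|M. V z\<bar> \<le> (LINT z:A|M. g z)"
proof (cases "set_integrable M A V")
  case True
  have "\<bar>LINT z:A|M. V z\<bar> \<le> (LINT z:A|M. \<bar>V z\<bar>)"
    using set_integral_norm_bound[OF True] by simp
  also have "\<dots> \<le> (LINT z:A|M. g z)"
    by (rule set_integral_mono) (use True g bd in \<open>auto intro: set_integrable_abs\<close>)
  finally show ?thesis .
next
  case False
  then have "(LINT z:A|M. V z) = 0"
    unfolding set_integrable_def set_lebesgue_integral_def by (rule not_integrable_integral_eq)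
  moreover have "0 \<le> (LINT z:A|M. g z)"
    unfolding set_lebesgue_integral_def
    by (intro integral_nonneg_AE AE_I2) (use bd in \<open>auto simp: indicator_def intro: order_trans[OF abs_ge_zero]\<close>)
  ultimately show ?thesis by simp
qed

lemma emeasure_unit_square: "emeasure lebesgue unit_square = 1"
proof -
  have eq: "unit_square = cbox (0, 0) (1, 1)" by (auto simp: unit_square_def cbox_Pair_eq)
  have "emeasure lebesgue unit_square = emeasure lborel unit_square" using unit_square_borel by simp
  also have "\<dots> = emeasure lborel (cbox (0, 0) (1::real, 1::real))" by (simp only: eq)
  also have "\<dots> = 1" by (subst emeasure_lborel_cbox_eq) (auto simp: Basis_prod_def prod.union_disjoint)
  finally show ?thesis .
qed

lemma lmeasurable_Times_unit_square:
  assumes "S \<in> sets lebesgue" "T \<in> sets lebesgue" "S \<subseteq> unit_square" "T \<subseteq> unit_square"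
  shows "S \<times> T \<in> lmeasurable" "measure lebesgue (S \<times> T) = measure lebesgue S * measure lebesgue T"
    "measure lebesgue S \<le> 1"
proof -
  have sq: "unit_square \<in> sets lebesgue" using unit_square_borel by auto
  have le: "emeasure lebesgue A \<le> 1" if "A \<in> sets lebesgue" "A \<subseteq> unit_square" for A
    using emeasure_mono[OF that(2) sq] by (simp add: emeasure_unit_square)
  have fin: "emeasure lebesgue S < \<infinity>" "emeasure lebesgue T < \<infinity>"
    using le[of S] le[of T] assms by (auto intro: le_less_trans)
  have eq: "emeasure lebesgue (S \<times> T) = emeasure lebesgue S * emeasure lebesgue T"
    by (rule measure_lebesgue_Times) (use assms in auto)
  show "S \<times> T \<in> lmeasurable"
    using measure_lebesgue_Times(1)[OF assms(1,2)] fin by (simp add: fmeasurable_def eq ennreal_mult_less_top)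
  show "measure lebesgue (S \<times> T) = measure lebesgue S * measure lebesgue T"
    unfolding measure_def eq by (rule enn2real_mult)
  show "measure lebesgue S \<le> 1"
    using le[of S] assms by (simp add: measure_def enn2real_leI)
qed

lemma cut_norm_le:
  assumes "\<And>S T. S \<in> sets lebesgue \<Longrightarrow> T \<in> sets lebesgue \<Longrightarrow> S \<subseteq> unit_square \<Longrightarrow> T \<subseteq> unit_square \<Longrightarrow>
    \<bar>LINT z:S \<times> T|lebesgue. V z\<bar> \<le> c"
  shows "cut_norm V \<le> c"
  unfolding cut_norm_def by (rule cSUP_least) (use assms in \<open>auto intro!: exI[of _ "{}"]\<close>)

lemma cut_norm_nonneg:
  assumes "\<And>z. z \<in> unit_square \<times> unit_square \<Longrightarrow> \<bar>V z\<bar> \<le> 1"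
  shows "0 \<le> cut_norm V"
proof -
  have "\<bar>LINT z:S \<times> T|lebesgue. V z\<bar> \<le> 1"
    if "S \<in> sets lebesgue" "T \<in> sets lebesgue" "S \<subseteq> unit_square" "T \<subseteq> unit_square" for S T
  proof -
    note m = lmeasurable_Times_unit_square[OF that]
    have "\<bar>LINT z:S \<times> T|lebesgue. V z\<bar> \<le> (LINT z:S \<times> T|lebesgue. 1)"
    proof (rule abs_set_integral_le)
      show "\<bar>V z\<bar> \<le> 1" if "z \<in> S \<times> T" for z
        using assms[of z] \<open>z \<in> S \<times> T\<close> \<open>S \<subseteq> unit_square\<close> \<open>T \<subseteq> unit_square\<close> by auto
    qed (use m in \<open>auto simp: set_integrable_def fmeasurable_def\<close>)
    also have "\<dots> = measure lebesgue S * measure lebesgue T" using m by (simp add: set_lebesgue_integral_def m(2)[symmetric] fmeasurableD)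
    also have "\<dots> \<le> 1 * 1"
      using m(3) lmeasurable_Times_unit_square(3)[OF that(2,2,4,4)] by (intro mult_mono) auto
    finally show ?thesis by simp
  qed
  then have "bdd_above ((\<lambda>(S, T). \<bar>LINT z:S \<times> T|lebesgue. V z\<bar>) ` {(S, T). S \<in> sets lebesgue \<and> T \<in> sets lebesgue \<and>
                            S \<subseteq> unit_square \<and> T \<subseteq> unit_square})"
    by (intro bdd_aboveI[of _ 1]) auto
  then have "(\<lambda>(S, T). \<bar>LINT z:S \<times> T|lebesgue. V z\<bar>) ({}, {}) \<le> cut_norm V"
    unfolding cut_norm_def by (intro cSUP_upper) auto
  then show ?thesis by simp
qed

lemma shift_nonneg:
  assumes "f \<in> mp_bijections"
  shows "0 \<le> shift f"
proof -
  have "f u \<in> unit_square" if "u \<in> unit_square" for u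
    using assms that by (auto simp: mp_bijections_def bij_betw_def)
  then have "\<bar>fst u - fst (f u)\<bar> \<le> 1" if "u \<in> unit_square" for u
    using that by (fastforce simp: unit_square_def mem_Times_iff abs_le_iff)
  then have "bdd_above ((\<lambda>u. \<bar>fst u - fst (f u)\<bar>) ` unit_square)"
    by (intro bdd_aboveI[of _ 1]) auto
  moreover have "(0, 0) \<in> unit_square" by (simp add: unit_square_def)
  ultimately have "\<bar>fst (0, 0) - fst (f (0, 0))\<bar> \<le> shift f"
    unfolding shift_def using cSUP_upper[of "(0, 0)" unit_square "\<lambda>u. \<bar>fst u - fst (f u)\<bar>"] by simp
  then show ?thesis by (rule order_trans[OF abs_ge_zero])
qed

text \<open>The infimum that defines the distance is over a set that is bounded below, because for bounded
orderons each candidate value is a sum of two suprema of bounded sets of nonnegative numbers.\<close>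
lemma cut_shift_dist_le:
  assumes W: "\<And>u v. u \<in> unit_square \<Longrightarrow> v \<in> unit_square \<Longrightarrow> 0 \<le> W (u, v) \<and> W (u, v) \<le> 1"
    and U: "\<And>u v. u \<in> unit_square \<Longrightarrow> v \<in> unit_square \<Longrightarrow> 0 \<le> U (u, v) \<and> U (u, v) \<le> 1"
    and f: "f \<in> mp_bijections"
  shows "cut_shift_dist W U \<le> shift f + cut_norm (\<lambda>z. W z - pullback U f z)"
  unfolding cut_shift_dist_def
proof (rule cINF_lower[OF _ f], rule bdd_belowI2)
  fix g assume g: "g \<in> mp_bijections"
  have "0 \<le> cut_norm (\<lambda>z. W z - pullback U g z)"
  proof (rule cut_norm_nonneg, clarify)
    fix u v assume uv: "u \<in> unit_square" "v \<in> unit_square"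
    then have "g u \<in> unit_square" "g v \<in> unit_square"
      using g by (auto simp: mp_bijections_def bij_betw_def)
    then show "\<bar>W (u, v) - pullback U g (u, v)\<bar> \<le> 1"
      using W[OF uv] U[of "g u" "g v"] by (auto simp: pullback_def abs_le_iff)
  qed
  then show "0 \<le> shift g + cut_norm (\<lambda>z. W z - pullback U g z)" using shift_nonneg[OF g] by simp
qed

text \<open>If \<open>V\<close> is nearly constant on products of cells, then its integral over \<open>S \<times> T\<close> is nearly a
bilinear form in the measures with which \<open>S\<close> and \<open>T\<close> meet the cells. These measures are at most \<open>1 / M\<^sup>2\<close>, so the form is controlled
by its values at sets of cells.\<close>
lemma abs_integral_cells_le:
  assumes M: "M > 0" and S: "S \<in> sets lebesgue" "S \<subseteq> unit_square" and T: "T \<in> sets lebesgue" "T \<subseteq> unit_square"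
    and D: "\<And>A B. A \<subseteq> grid_cells M \<Longrightarrow> B \<subseteq> grid_cells M \<Longrightarrow> \<bar>\<Sum>c\<in>A. \<Sum>d\<in>B. D c d\<bar> \<le> \<kappa> * (real (card (grid_cells M)))\<^sup>2"
    and N: "N \<in> sets borel" "emeasure lborel N \<le> ennreal \<eta>" and \<epsilon>: "\<epsilon> \<ge> 0" "\<eta> \<ge> 0"
    and V: "\<And>c d u v. c \<in> grid_cells M \<Longrightarrow> d \<in> grid_cells M \<Longrightarrow> u \<in> cell_region M c \<Longrightarrow> v \<in> cell_region M d \<Longrightarrow>
       \<bar>V (u, v) - D c d\<bar> \<le> \<epsilon> + indicator N (u, v)"
  shows "\<bar>LINT z:S \<times> T|lebesgue. V z\<bar> \<le> \<kappa> + \<epsilon> + \<eta>"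
proof -
  let ?G = "grid_cells M"
  define P where "P = {0<..1::real} \<times> {0<..1::real}"
  have P: "P \<subseteq> unit_square" "P \<in> sets borel" by (auto simp: P_def unit_square_def intro!: borel_Times)
  have P_cell: "u \<in> cell_region M (cell_of M u)" "cell_of M u \<in> ?G" if "u \<in> P" for u
    using in_cell_region[OF M subsetD[OF P(1) that]] that by (auto simp: P_def)
  have cell_P: "cell_region M c \<subseteq> P" if "c \<in> ?G" for c
    using mem_cell_region_iff[OF M that] cell_region_subset[OF M that] by (fastforce simp: P_def unit_square_def)
  define S' T' where "S' = S \<inter> P" and "T' = T \<inter> P"
  have S': "S' \<in> sets lebesgue" "S' \<subseteq> unit_square" and T': "T' \<in> sets lebesgue" "T' \<subseteq> unit_square"
    using S T P by (auto simp: S'_def T'_def)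
  have null: "unit_square - P \<in> null_sets lborel"
  proof -
    have "emeasure lborel P = emeasure (lborel \<Otimes>\<^sub>M lborel) P" by (simp add: lborel_prod)
    also have "\<dots> = emeasure lborel {0<..1::real} * emeasure lborel {0<..1::real}"
      unfolding P_def by (rule lborel.emeasure_pair_measure_Times) auto
    finally have "emeasure lborel P = 1" by simp
    moreover have "emeasure lborel unit_square = 1" using emeasure_unit_square unit_square_borel by simp
    ultimately have "emeasure lborel (unit_square - P) = 0"
      using P unit_square_borel by (subst emeasure_Diff) auto
    then show ?thesis using P unit_square_borel by auto
  qed
  have \<kappa>: "0 \<le> \<kappa>"
  proof -
    have "0 < (real (card ?G))\<^sup>2" using M by (simp add: card_grid_cells)
    moreover have "0 \<le> \<kappa> * (real (card ?G))\<^sup>2" using D[of "{}" "{}"] by simp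
    ultimately show ?thesis by (simp add: zero_le_mult_iff)
  qed
  show ?thesis
  proof (cases "set_integrable lebesgue (S \<times> T) V")
    case False
    then have "(LINT z:S \<times> T|lebesgue. V z) = 0"
      unfolding set_integrable_def set_lebesgue_integral_def by (rule not_integrable_integral_eq)
    then show ?thesis using \<kappa> \<epsilon> by simp
  next
    case True
    have ST': "S' \<times> T' \<in> lmeasurable" "measure lebesgue (S' \<times> T') \<le> 1"
    proof -
      note m = lmeasurable_Times_unit_square[OF S'(1) T'(1) S'(2) T'(2)]
      show "S' \<times> T' \<in> lmeasurable" by (rule m(1))
      have "measure lebesgue S' * measure lebesgue T' \<le> 1 * 1"
        using m(3) lmeasurable_Times_unit_square(3)[OF T'(1,1,2,2)] by (intro mult_mono) auto
      then show "measure lebesgue (S' \<times> T') \<le> 1" using m(2) by simp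
    qed
    define F where "F z = indicat_real (S' \<times> T') z * V z" for z
    have F: "integrable lebesgue F"
    proof -
      have "set_integrable lebesgue (S' \<times> T') V"
        by (rule set_integrable_subset[OF True]) (use ST' in \<open>auto simp: fmeasurable_def S'_def T'_def\<close>)
      then show ?thesis by (simp add: F_def[abs_def] set_integrable_def)
    qed
    have eq: "(LINT z:S \<times> T|lebesgue. V z) = (LINT z|lebesgue. F z)"
      unfolding set_lebesgue_integral_def
    proof (rule integral_cong_AE)
      let ?N = "(unit_square - P) \<times> UNIV \<union> UNIV \<times> (unit_square - P)"
      have "?N \<in> null_sets (lborel :: (point \<times> point) measure)"
        by (rule null_sets_cylinders[OF null null])
      then have "AE z in lebesgue. z \<notin> ?N" by (intro AE_not_in null_sets_completionI)
      then show "AE z in lebesgue. indicat_real (S \<times> T) z *\<^sub>R V z = F z"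
        by eventually_elim (use S T in \<open>auto simp: S'_def T'_def indicator_def F_def\<close>)
      show "(\<lambda>z. indicat_real (S \<times> T) z *\<^sub>R V z) \<in> borel_measurable lebesgue"
        using True unfolding set_integrable_def by (rule borel_measurable_integrable)
    qed (use F in auto)
    define R where "R c = S \<inter> cell_region M c" for c
    define R' where "R' d = T \<inter> cell_region M d" for d
    have RR: "R c \<times> R' d \<in> lmeasurable" "measure lebesgue (R c \<times> R' d) = measure lebesgue (R c) * measure lebesgue (R' d)" for c d
      using S T by (auto simp: R_def R'_def intro!: lmeasurable_Times_unit_square)
    define h where "h z = (\<Sum>c\<in>?G. \<Sum>d\<in>?G. D c d * indicat_real (R c \<times> R' d) z)" for z
    have h: "integrable lebesgue h"
      unfolding h_def[abs_def] using RR(1)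
      by (intro Bochner_Integration.integrable_sum integrable_mult_right) (simp add: lmeasurable_iff_integrable)
    have int_h: "(LINT z|lebesgue. h z) = (\<Sum>c\<in>?G. \<Sum>d\<in>?G. measure lebesgue (R c) * measure lebesgue (R' d) * D c d)"
    proof -
      have int: "integrable lebesgue (\<lambda>z. D c d * indicat_real (R c \<times> R' d) z)" for c d
        using RR(1) by (intro integrable_mult_right) (simp add: lmeasurable_iff_integrable)
      have one: "(LINT z|lebesgue. D c d * indicat_real (R c \<times> R' d) z) = measure lebesgue (R c) * measure lebesgue (R' d) * D c d" for c d
        unfolding RR(2)[symmetric] using fmeasurableD[OF RR(1)[of c d]] by (subst integral_mult_right_zero) simp
      have "(LINT z|lebesgue. h z) = (\<Sum>c\<in>?G. LINT z|lebesgue. (\<Sum>d\<in>?G. D c d * indicat_real (R c \<times> R' d) z))"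
        unfolding h_def by (intro Bochner_Integration.integral_sum Bochner_Integration.integrable_sum int)
      also have "\<dots> = (\<Sum>c\<in>?G. \<Sum>d\<in>?G. LINT z|lebesgue. D c d * indicat_real (R c \<times> R' d) z)"
        by (intro sum.cong refl Bochner_Integration.integral_sum int)
      finally show ?thesis unfolding one .
    qed
    have meas_cell: "0 \<le> measure lebesgue (A \<inter> cell_region M c) \<and> measure lebesgue (A \<inter> cell_region M c) \<le> 1 / (real M)\<^sup>2"
      if "A \<in> sets lebesgue" for A c
    proof -
      have "emeasure lebesgue (A \<inter> cell_region M c) \<le> emeasure lebesgue (cell_region M c)"
        by (rule emeasure_mono) auto
      also have "\<dots> = ennreal (1 / (real M)\<^sup>2)" using M by (simp add: measure_lborel_cell_region)
      finally show ?thesis by (auto simp: measure_def intro!: enn2real_leI)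
    qed
    have sum_le: "\<bar>\<Sum>c\<in>?G. \<Sum>d\<in>?G. measure lebesgue (R c) * measure lebesgue (R' d) * D c d\<bar> \<le> \<kappa>"
    proof -
      have "\<bar>\<Sum>c\<in>?G. \<Sum>d\<in>?G. measure lebesgue (R c) * measure lebesgue (R' d) * D c d\<bar>
         \<le> 1 / (real M)\<^sup>2 * (1 / (real M)\<^sup>2) * (\<kappa> * (real (card ?G))\<^sup>2)"
        by (rule abs_bilinear_le_of_subsets) (use D meas_cell S T M in \<open>auto simp: R_def R'_def\<close>)
      also have "\<dots> = \<kappa>" using M by (simp add: card_grid_cells power2_eq_square)
      finally show ?thesis .
    qed
    have h_cell: "h (u, v) = D (cell_of M u) (cell_of M v)" if "u \<in> S'" "v \<in> T'" for u v
    proof -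
      have "indicat_real (R c \<times> R' d) (u, v) = (if c = cell_of M u then 1 else 0) * (if d = cell_of M v then 1 else 0)"
        if "c \<in> ?G" "d \<in> ?G" for c d
        using mem_cell_region_iff[OF M \<open>c \<in> ?G\<close>, of u] mem_cell_region_iff[OF M \<open>d \<in> ?G\<close>, of v] \<open>u \<in> S'\<close> \<open>v \<in> T'\<close>
        by (auto simp: R_def R'_def S'_def T'_def P_def indicator_def)
      then have "h (u, v) = (\<Sum>c\<in>?G. \<Sum>d\<in>?G. D c d * ((if c = cell_of M u then 1 else 0) * (if d = cell_of M v then 1 else 0)))"
        unfolding h_def by (intro sum.cong) auto
      also have "\<dots> = (\<Sum>c\<in>?G. if c = cell_of M u then D c (cell_of M v) else 0)"
        using P_cell(2)[of v] that by (intro sum.cong refl) (auto simp: T'_def if_distrib[of "\<lambda>x. _ * x"] cong: if_cong)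
      also have "\<dots> = D (cell_of M u) (cell_of M v)"
        using P_cell(2)[of u] that by (auto simp: S'_def)
      finally show ?thesis .
    qed
    have h_0: "h z = 0" if "z \<notin> S' \<times> T'" for z
    proof -
      have "z \<notin> R c \<times> R' d" if "c \<in> ?G" "d \<in> ?G" for c d
        using \<open>z \<notin> S' \<times> T'\<close> cell_P[OF \<open>c \<in> ?G\<close>] cell_P[OF \<open>d \<in> ?G\<close>] by (auto simp: R_def R'_def S'_def T'_def)
      then show ?thesis unfolding h_def by (intro sum.neutral ballI) auto
    qed
    have Nfin: "emeasure lebesgue N < \<infinity>" "measure lebesgue N \<le> \<eta>" "N \<in> sets lebesgue"
      using N \<epsilon> by (auto simp: measure_def intro: le_less_trans enn2real_leI)
    then have Nl: "N \<in> lmeasurable" by (simp add: fmeasurable_def)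
    have "\<bar>(LINT z|lebesgue. F z) - (LINT z|lebesgue. h z)\<bar> = \<bar>LINT z|lebesgue. F z - h z\<bar>"
      using F h by simp
    also have "\<dots> \<le> (LINT z|lebesgue. \<bar>F z - h z\<bar>)" by (rule integral_abs_bound)
    also have "\<dots> \<le> (LINT z|lebesgue. \<epsilon> * indicat_real (S' \<times> T') z + indicat_real N z)"
    proof (rule integral_mono)
      show "integrable lebesgue (\<lambda>z. \<bar>F z - h z\<bar>)" using F h by simp
      show "integrable lebesgue (\<lambda>z. \<epsilon> * indicat_real (S' \<times> T') z + indicat_real N z)"
        using ST'(1) Nl by (intro Bochner_Integration.integrable_add integrable_mult_right) (auto simp: lmeasurable_iff_integrable)
      fix z
      show "\<bar>F z - h z\<bar> \<le> \<epsilon> * indicat_real (S' \<times> T') z + indicat_real N z"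
      proof (cases "z \<in> S' \<times> T'")
        case True
        then obtain u v where z: "z = (u, v)" "u \<in> S'" "v \<in> T'" by auto
        then have "u \<in> P" "v \<in> P" by (auto simp: S'_def T'_def)
        then have "\<bar>V z - D (cell_of M u) (cell_of M v)\<bar> \<le> \<epsilon> + indicator N z"
          unfolding z by (intro V P_cell)
        then show ?thesis using z by (simp add: F_def h_cell)
      qed (simp add: F_def h_0)
    qed
    also have "\<dots> = \<epsilon> * measure lebesgue (S' \<times> T') + measure lebesgue N"
    proof -
      have "integrable lebesgue (\<lambda>z. \<epsilon> * indicat_real (S' \<times> T') z)" "integrable lebesgue (indicat_real N)"
        using ST'(1) Nl by (auto simp: lmeasurable_iff_integrable)
      then show ?thesis
        using fmeasurableD[OF ST'(1)] fmeasurableD[OF Nl] by (subst Bochner_Integration.integral_add) auto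
    qed
    also have "\<dots> \<le> \<epsilon> * 1 + \<eta>"
      using ST'(2) Nfin \<epsilon> by (intro add_mono mult_left_mono) auto
    finally show ?thesis using sum_le unfolding eq int_h by linarith
  qed
qed

section \<open>The space of sample points\<close>

abbreviation square_measure :: "point measure" where
  "square_measure \<equiv> lebesgue_on unit_square"

abbreviation points_measure :: "nat \<Rightarrow> (nat \<Rightarrow> point) measure" where
  "points_measure k \<equiv> PiM {1..k} (\<lambda>_. square_measure)"

lemma unit_square_lebesgue [measurable]: "unit_square \<in> sets lebesgue"
  using unit_square_borel by auto

lemma prob_space_square: "prob_space square_measure"
  by (rule prob_spaceI) (simp add: emeasure_restrict_space unit_square_lebesgue emeasure_unit_square)

lemma prob_space_points: "prob_space (points_measure k)"
  by (intro prob_space_PiM prob_space_square)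

lemma space_points: "p \<in> space (points_measure k) \<Longrightarrow> i \<in> {1..k} \<Longrightarrow> p i \<in> unit_square"
  by (auto simp: space_PiM PiE_def)

lemma measurable_square_ident: "(\<lambda>u. u) \<in> square_measure \<rightarrow>\<^sub>M borel"
proof -
  have "(\<lambda>u. u) \<in> lebesgue \<rightarrow>\<^sub>M (borel :: point measure)" by (simp add: measurable_completion)
  then show ?thesis by (rule measurable_restrict_space1)
qed

lemma measurable_point [measurable]: "(\<lambda>p. p i) \<in> points_measure k \<rightarrow>\<^sub>M borel"
proof (cases "i \<in> {1..k}")
  case True
  then have "(\<lambda>p. p i) \<in> points_measure k \<rightarrow>\<^sub>M square_measure" by (rule measurable_component_singleton)
  then show ?thesis by (rule measurable_compose[OF _ measurable_square_ident])
next
  case False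
  have "(\<lambda>p. p i) \<in> points_measure k \<rightarrow>\<^sub>M borel \<longleftrightarrow> (\<lambda>p. undefined) \<in> points_measure k \<rightarrow>\<^sub>M (borel :: point measure)"
    by (rule measurable_cong) (use False in \<open>auto simp: space_PiM PiE_def extensional_def\<close>)
  then show ?thesis by simp
qed

lemma measurable_point_pair:
  "(\<lambda>p. (p i, p j)) \<in> points_measure k \<rightarrow>\<^sub>M borel \<Otimes>\<^sub>M borel"
  by (rule measurable_Pair[OF measurable_point measurable_point])

text \<open>Two distinct sample points are jointly distributed by the Lebesgue measure on the product of two
squares.\<close>
lemma emeasure_point_pair_le:
  assumes ij: "i \<in> {1..k}" "j \<in> {1..k}" "i \<noteq> j" and N: "N \<in> sets (borel :: (point \<times> point) measure)"
  shows "emeasure (points_measure k) {p \<in> space (points_measure k). (p i, p j) \<in> N} \<le> emeasure lborel N"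
proof -
  interpret sq: prob_space square_measure by (rule prob_space_square)
  interpret P: product_prob_space "\<lambda>_. square_measure" "{1..k}" by (rule product_prob_spaceI) (rule prob_space_square)
  define B where "B = distr square_measure (borel :: point measure) (\<lambda>u. u)"
  interpret B: prob_space B unfolding B_def by (rule sq.prob_space_distr) (rule measurable_square_ident)
  have B_le: "emeasure B A \<le> emeasure lborel A" if "A \<in> sets borel" for A
  proof -
    have "emeasure B A = emeasure square_measure (A \<inter> unit_square)"
      unfolding B_def using that by (subst emeasure_distr) (auto intro: measurable_square_ident)
    also have "\<dots> = emeasure lebesgue (A \<inter> unit_square)"
      by (rule emeasure_restrict_space) (auto intro: unit_square_lebesgue)
    also have "\<dots> \<le> emeasure lebesgue A" using that by (intro emeasure_mono) auto
    finally show ?thesis using that by simp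
  qed
  have sets_B [simp]: "sets B = sets borel" "space B = UNIV" by (auto simp: B_def)
  have eq: "B \<Otimes>\<^sub>M B = distr (points_measure k) (borel \<Otimes>\<^sub>M borel) (\<lambda>p. (p i, p j))"
  proof (rule pair_measure_eqI)
    show "sets (B \<Otimes>\<^sub>M B) = sets (distr (points_measure k) (borel \<Otimes>\<^sub>M borel) (\<lambda>p. (p i, p j)))"
      by (simp cong: sets_pair_measure_cong)
    fix X Y assume XY: "X \<in> sets B" "Y \<in> sets B"
    have "emeasure (distr (points_measure k) (borel \<Otimes>\<^sub>M borel) (\<lambda>p. (p i, p j))) (X \<times> Y)
      = emeasure (points_measure k) {p \<in> space (points_measure k). \<forall>l\<in>{i, j}. p l \<in> (if l = i then X else Y) \<inter> unit_square}"
    proof -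
      have "(\<lambda>p. (p i, p j)) -` (X \<times> Y) \<inter> space (points_measure k)
         = {p \<in> space (points_measure k). \<forall>l\<in>{i, j}. p l \<in> (if l = i then X else Y) \<inter> unit_square}"
        using ij space_points by auto
      then show ?thesis using XY by (subst emeasure_distr[OF measurable_point_pair]) auto
    qed
    also have "\<dots> = (\<Prod>l\<in>{i, j}. emeasure square_measure ((if l = i then X else Y) \<inter> unit_square))"
    proof (rule P.emeasure_PiM_Collect)
      show "(if l = i then X else Y) \<inter> unit_square \<in> sets square_measure" for l
        using XY by (auto simp: sets_restrict_space)
    qed (use ij in auto)
    also have "\<dots> = (\<Prod>l\<in>{i, j}. emeasure B (if l = i then X else Y))"
      unfolding B_def using XY by (intro prod.cong refl, subst emeasure_distr) (auto intro: measurable_square_ident)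
    also have "\<dots> = emeasure B X * emeasure B Y" using ij by simp
    finally show "emeasure B X * emeasure B Y = emeasure (distr (points_measure k) (borel \<Otimes>\<^sub>M borel) (\<lambda>p. (p i, p j))) (X \<times> Y)" ..
  qed unfold_locales
  have N': "N \<in> sets (borel \<Otimes>\<^sub>M borel)" by (subst borel_prod) (rule N)
  have NB: "N \<in> sets (B \<Otimes>\<^sub>M B)" "N \<in> sets (lborel \<Otimes>\<^sub>M lborel)"
    using N' by (simp_all cong: sets_pair_measure_cong)
  have "emeasure (points_measure k) {p \<in> space (points_measure k). (p i, p j) \<in> N} = emeasure (B \<Otimes>\<^sub>M B) N"
    unfolding eq by (subst emeasure_distr[OF measurable_point_pair N']) (simp add: vimage_def Int_def conj_commute)
  also have "\<dots> = (\<integral>\<^sup>+x. emeasure B (Pair x -` N) \<partial>B)"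
    by (rule B.emeasure_pair_measure_alt[OF NB(1)])
  also have "\<dots> \<le> (\<integral>\<^sup>+x. emeasure lborel (Pair x -` N) \<partial>B)"
    using sets_Pair1[OF N'] by (intro nn_integral_mono B_le) auto
  also have "\<dots> = (\<integral>\<^sup>+x. emeasure lborel (Pair x -` N) \<partial>square_measure)"
    unfolding B_def
    by (rule nn_integral_distr[OF measurable_square_ident])
       (use lborel.measurable_emeasure_Pair[OF NB(2)] in simp)
  also have "\<dots> = (\<integral>\<^sup>+x. emeasure lborel (Pair x -` N) * indicator unit_square x \<partial>lebesgue)"
    by (rule nn_integral_restrict_space) (auto intro: unit_square_lebesgue)
  also have "\<dots> \<le> (\<integral>\<^sup>+x. emeasure lborel (Pair x -` N) \<partial>lebesgue)"
    by (intro nn_integral_mono) (auto simp: indicator_def)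
  also have "\<dots> = (\<integral>\<^sup>+x. emeasure lborel (Pair x -` N) \<partial>lborel)"
    by (rule nn_integral_completion)
  also have "\<dots> = emeasure (lborel \<Otimes>\<^sub>M lborel) N"
    by (rule lborel.emeasure_pair_measure_alt[OF NB(2), symmetric])
  finally show ?thesis by (simp only: lborel_prod)
qed

text \<open>\<open>W\<close> agrees with a Borel function outside a null set, and by \<open>emeasure_point_pair_le\<close> a pair of distinct
sample points almost surely avoids that null set. This is where the completion of the product measure enters.\<close>
lemma measurable_orderon_points:
  assumes ij: "i \<in> {1..k}" "j \<in> {1..k}" "i \<noteq> j" and W: "W \<in> orderons"
  shows "(\<lambda>p. W (p i, p j)) \<in> borel_measurable (completion (points_measure k))"
proof -
  let ?S = "unit_square \<times> unit_square" and ?P = "points_measure k"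
  have S: "?S \<in> sets lebesgue" using measure_lebesgue_Times(1)[OF unit_square_lebesgue unit_square_lebesgue] .
  have "W \<in> borel_measurable (lebesgue_on ?S)" using W by (simp add: orderons_def)
  then have "(\<lambda>z. if z \<in> ?S then W z else 0) \<in> borel_measurable lebesgue"
    using S by (simp add: borel_measurable_if)
  then obtain g where g: "g \<in> borel_measurable (lborel :: (point \<times> point) measure)"
    "AE z in lborel. (if z \<in> ?S then W z else 0) = g z"
    using completion_ex_borel_measurable_real by blast
  from g(2) obtain N where N: "{z. (if z \<in> ?S then W z else 0) \<noteq> g z} \<subseteq> N" "emeasure lborel N = 0" "N \<in> sets lborel"
    by (auto elim: AE_E)
  have ae: "AE p in completion ?P. W (p i, p j) = g (p i, p j)"
  proof (rule AE_completion, rule AE_I)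
    show "{p \<in> space ?P. W (p i, p j) \<noteq> g (p i, p j)} \<subseteq> {p \<in> space ?P. (p i, p j) \<in> N}"
      using N(1) space_points ij by fastforce
    show "emeasure ?P {p \<in> space ?P. (p i, p j) \<in> N} = 0"
      using emeasure_point_pair_le[OF ij, of N] N(2,3) by simp
    have N': "N \<in> sets (borel \<Otimes>\<^sub>M borel)" using N(3) by (subst borel_prod) simp
    show "{p \<in> space ?P. (p i, p j) \<in> N} \<in> sets ?P"
      using measurable_sets[OF measurable_point_pair N'] by (simp add: vimage_def Int_def conj_commute)
  qed
  have g': "(\<lambda>p. g (p i, p j)) \<in> borel_measurable (completion ?P)"
  proof (rule measurable_completion, rule measurable_compose[OF measurable_point_pair])
    show "g \<in> borel_measurable (borel \<Otimes>\<^sub>M borel)" using g(1) by (subst borel_prod) simp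
  qed
  show ?thesis
  proof (rule measurableI)
    fix B :: "real set" assume B: "B \<in> sets borel"
    show "(\<lambda>p. W (p i, p j)) -` B \<inter> space (completion ?P) \<in> sets (completion ?P)"
    proof (rule completion.in_sets_AE)
      show "(\<lambda>p. g (p i, p j)) -` B \<inter> space (completion ?P) \<in> sets (completion ?P)"
        by (rule measurable_sets[OF g' B])
      show "AE p in completion ?P. p \<in> (\<lambda>p. g (p i, p j)) -` B \<inter> space (completion ?P) \<longleftrightarrow>
          p \<in> (\<lambda>p. W (p i, p j)) -` B \<inter> space (completion ?P)"
        using ae by eventually_elim auto
    qed auto
  qed simp
qed

text \<open>The sorted sample, as the list of the original indices. There are countably many lists, which makes the
sorting procedure measurable by induction on its recursion.\<close>
definition sort_perm :: "nat \<Rightarrow> (nat \<Rightarrow> point) \<Rightarrow> nat list" where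
  "sort_perm k p = sort_key (\<lambda>i. fst (p i)) [1..<Suc k]"

lemma sort_key_map_comp: "sort_key f (map g xs) = map g (sort_key (\<lambda>x. f (g x)) xs)"
proof -
  have "insort_key f (g x) (map g ys) = map g (insort_key (\<lambda>x. f (g x)) x ys)" for x ys
    by (induction ys) auto
  then show ?thesis by (induction xs) auto
qed

lemma sort_perm_props:
  "distinct (sort_perm k p)" "set (sort_perm k p) = {1..k}" "length (sort_perm k p) = k"
  by (auto simp: sort_perm_def)

lemma ordered_point_eq:
  assumes "i \<in> {1..k}"
  shows "ordered_point k p i = p (sort_perm k p ! (i - 1))"
proof -
  have "ordered_point k p i = map p (sort_perm k p) ! (i - 1)"
    unfolding ordered_point_def sort_perm_def by (simp add: sort_key_map_comp)
  then show ?thesis using assms sort_perm_props(3)[of k p] by auto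
qed

lemma measurable_sort_perm: "sort_perm k \<in> points_measure k \<rightarrow>\<^sub>M count_space UNIV"
proof -
  have fstm: "(\<lambda>p. fst (p i)) \<in> borel_measurable (points_measure k)" for i
  proof -
    have "fst \<in> (borel :: point measure) \<rightarrow>\<^sub>M borel" by (intro borel_measurable_continuous_onI continuous_intros)
    then show ?thesis by (rule measurable_compose[OF measurable_point])
  qed
  have ins: "(\<lambda>p. insort_key (\<lambda>i. fst (p i)) x ys) \<in> points_measure k \<rightarrow>\<^sub>M count_space UNIV" for x ys
  proof (induction ys)
    case (Cons y ys)
    have "(\<lambda>p. y # insort_key (\<lambda>i. fst (p i)) x ys) \<in> points_measure k \<rightarrow>\<^sub>M count_space UNIV"
      by (rule measurable_compose[OF Cons]) simp
    moreover have "Measurable.pred (points_measure k) (\<lambda>p. fst (p x) \<le> fst (p y))"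
      using borel_measurable_le[OF fstm fstm] by (simp add: pred_def)
    ultimately show ?case by simp
  qed simp
  have "(\<lambda>p. sort_key (\<lambda>i. fst (p i)) xs) \<in> points_measure k \<rightarrow>\<^sub>M count_space UNIV" for xs
  proof (induction xs)
    case (Cons x xs)
    show ?case
      using measurable_compose_countable[of "\<lambda>ys p. insort_key (\<lambda>i. fst (p i)) x ys", OF ins Cons] by simp
  qed simp
  then show ?thesis unfolding sort_perm_def[abs_def] .
qed

section \<open>The random graph as a measure\<close>

lemma random_edges_cong:
  assumes "\<And>i. i \<in> {1..k} \<Longrightarrow> q i = q' i"
  shows "random_edges k W q = random_edges k W q'"
  unfolding random_edges_def
  by (rule arg_cong[where f="map_pmf graph_of_pairs"], rule Pi_pmf_cong)
     (use assms in \<open>auto simp flip: pairs_upto_def\<close>)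

text \<open>An explicit polynomial in the edge probabilities, from which measurability in the sample points can be
read off.\<close>
lemma emeasure_random_edges:
  "emeasure (measure_pmf (random_edges k W q)) A =
    (\<Sum>e\<in>PiE_dflt (pairs_upto k) False (\<lambda>_. UNIV). indicator A (graph_of_pairs e) *
      (\<Prod>(i, j)\<in>pairs_upto k. ennreal (pmf (bernoulli_pmf (W (q i, q j))) (e (i, j)))))"
proof -
  let ?p = "\<lambda>(i, j). bernoulli_pmf (W (q i, q j))"
  let ?M = "Pi_pmf (pairs_upto k) False ?p" and ?X = "PiE_dflt (pairs_upto k) False (\<lambda>_. UNIV :: bool set)"
  have fin: "finite ?X" by (rule finite_PiE_dflt) auto
  have sub: "set_pmf ?M \<subseteq> ?X"
    using set_Pi_pmf_subset[of "pairs_upto k" False ?p] by (auto simp: PiE_dflt_def)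
  have "emeasure (measure_pmf (random_edges k W q)) A = emeasure (measure_pmf ?M) (graph_of_pairs -` A)"
    by (simp add: random_edges_def pairs_upto_def)
  also have "\<dots> = emeasure (measure_pmf ?M) (?X \<inter> graph_of_pairs -` A)"
    by (rule emeasure_eq_AE) (use sub in \<open>auto intro!: AE_pmfI\<close>)
  also have "\<dots> = (\<Sum>e\<in>?X \<inter> graph_of_pairs -` A. ennreal (pmf ?M e))"
    using fin by (subst emeasure_measure_pmf_finite) auto
  also have "\<dots> = (\<Sum>e\<in>?X. indicator A (graph_of_pairs e) * ennreal (pmf ?M e))"
    by (rule sum.mono_neutral_cong_left) (use fin in auto)
  also have "\<dots> = (\<Sum>e\<in>?X. indicator A (graph_of_pairs e) *
      (\<Prod>(i, j)\<in>pairs_upto k. ennreal (pmf (bernoulli_pmf (W (q i, q j))) (e (i, j)))))"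
  proof (rule sum.cong[OF refl])
    fix e assume "e \<in> ?X"
    then have "pmf ?M e = (\<Prod>ij\<in>pairs_upto k. pmf (?p ij) (e ij))"
      by (intro pmf_Pi') (auto simp: PiE_dflt_def)
    then have "ennreal (pmf ?M e) = (\<Prod>ij\<in>pairs_upto k. ennreal (pmf (?p ij) (e ij)))"
      by (simp add: prod_ennreal)
    then show "indicator A (graph_of_pairs e) * ennreal (pmf ?M e) = indicator A (graph_of_pairs e) *
      (\<Prod>(i, j)\<in>pairs_upto k. ennreal (pmf (bernoulli_pmf (W (q i, q j))) (e (i, j))))"
      by (simp add: case_prod_unfold)
  qed
  finally show ?thesis .
qed

lemma borel_measurable_pmf_bernoulli: "(\<lambda>x. pmf (bernoulli_pmf x) b) \<in> borel_measurable borel"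
proof -
  have "pmf (bernoulli_pmf x) b = (if b then min 1 (max 0 x) else 1 - min 1 (max 0 x))" for x
    by (simp add: bernoulli_pmf.rep_eq)
  then show ?thesis by simp
qed

text \<open>On the event that the sample is sorted by a fixed list of indices, the probability of a set of graphs
is a polynomial in the values of \<open>W\<close> at pairs of distinct sample points.\<close>
lemma measurable_random_edges:
  assumes W: "W \<in> orderons"
  shows "(\<lambda>p. measure_pmf (random_edges k W (ordered_point k p))) \<in> sample_points k \<rightarrow>\<^sub>M subprob_algebra (count_space UNIV)"
proof (rule measurable_subprob_algebra)
  fix A :: "(nat \<Rightarrow> nat \<Rightarrow> bool) set"
  define G where "G l p = emeasure (measure_pmf (random_edges k W (\<lambda>i. p (l ! (i - 1))))) A" for l :: "nat list" and p :: "nat \<Rightarrow> point"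
  define LS where "LS = {l. set l \<subseteq> {1..k} \<and> length l = k \<and> distinct l}"
  have fin: "finite LS"
    by (rule finite_subset[OF _ finite_lists_length_eq[of "{1..k}" k]]) (auto simp: LS_def)
  have G: "G l \<in> borel_measurable (sample_points k)" if "l \<in> LS" for l
  proof -
    have l: "l ! (i - 1) \<in> {1..k}" "i \<noteq> j \<Longrightarrow> l ! (i - 1) \<noteq> l ! (j - 1)" if "i \<in> {1..k}" "j \<in> {1..k}" for i j
    proof -
      have "i - 1 < length l" "j - 1 < length l" using \<open>l \<in> LS\<close> that by (auto simp: LS_def)
      moreover have "set l \<subseteq> {1..k}" "distinct l" using \<open>l \<in> LS\<close> by (auto simp: LS_def)
      moreover have "i \<noteq> j \<Longrightarrow> i - 1 \<noteq> j - 1" using that by auto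
      ultimately show "l ! (i - 1) \<in> {1..k}" "i \<noteq> j \<Longrightarrow> l ! (i - 1) \<noteq> l ! (j - 1)"
        using subsetD[OF \<open>set l \<subseteq> {1..k}\<close> nth_mem] by (simp_all only: nth_eq_iff_index_eq not_False_eq_True)
    qed
    have "(\<lambda>p. ennreal (pmf (bernoulli_pmf (W (p (l ! (i - 1)), p (l ! (j - 1))))) b)) \<in> borel_measurable (sample_points k)"
      if "(i, j) \<in> pairs_upto k" for i j b
    proof -
      have "(\<lambda>p. W (p (l ! (i - 1)), p (l ! (j - 1)))) \<in> borel_measurable (sample_points k)"
        unfolding sample_points_def
      proof (rule measurable_orderon_points)
        have ij: "i \<in> {1..k}" "j \<in> {1..k}" "i \<noteq> j" using that by (auto simp: pairs_upto_def)
        show "l ! (i - 1) \<in> {1..k}" "l ! (j - 1) \<in> {1..k}" "l ! (i - 1) \<noteq> l ! (j - 1)"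
          using l(1)[OF ij(1,2)] l(1)[OF ij(2,1)] l(2)[OF ij] by auto
      qed (rule W)
      from measurable_compose[OF this borel_measurable_pmf_bernoulli] show ?thesis by (rule measurable_compose) simp
    qed
    then show ?thesis
      unfolding G_def emeasure_random_edges
      by (intro borel_measurable_sum borel_measurable_times borel_measurable_const borel_measurable_prod) auto
  qed
  have sp: "{p \<in> space (sample_points k). sort_perm k p = l} \<in> sets (sample_points k)" for l
  proof -
    have "sort_perm k -` {l} \<inter> space (points_measure k) \<in> sets (points_measure k)"
      by (rule measurable_sets[OF measurable_sort_perm]) simp
    moreover have "sort_perm k -` {l} \<inter> space (points_measure k) = {p \<in> space (points_measure k). sort_perm k p = l}" by auto
    ultimately show ?thesis by (auto simp: sample_points_def)
  qed
  have eq: "emeasure (measure_pmf (random_edges k W (ordered_point k p))) A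
      = (\<Sum>l\<in>LS. indicator {p \<in> space (sample_points k). sort_perm k p = l} p * G l p)"
    if "p \<in> space (sample_points k)" for p
  proof -
    have "random_edges k W (ordered_point k p) = random_edges k W (\<lambda>i. p (sort_perm k p ! (i - 1)))"
      by (rule random_edges_cong) (rule ordered_point_eq)
    then have "emeasure (measure_pmf (random_edges k W (ordered_point k p))) A = G (sort_perm k p) p"
      by (simp add: G_def)
    also have "\<dots> = (\<Sum>l\<in>LS. if l = sort_perm k p then G l p else 0)"
      using fin sort_perm_props[of k p] by (simp add: LS_def)
    also have "\<dots> = (\<Sum>l\<in>LS. indicator {p \<in> space (sample_points k). sort_perm k p = l} p * G l p)"
      by (rule sum.cong) (use that in auto)
    finally show ?thesis .
  qed
  have "(\<lambda>p. \<Sum>l\<in>LS. indicator {p \<in> space (sample_points k). sort_perm k p = l} p * G l p) \<in> borel_measurable (sample_points k)"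
    by (intro borel_measurable_sum borel_measurable_times_ennreal borel_measurable_indicator sp G)
  then show "(\<lambda>p. emeasure (measure_pmf (random_edges k W (ordered_point k p))) A) \<in> borel_measurable (sample_points k)"
    by (simp add: eq cong: measurable_cong)
qed (auto simp: measure_pmf.subprob_space_axioms)

lemma random_graph_prob_space:
  assumes W: "W \<in> orderons"
  shows "prob_space (random_graph k W)" "sets (random_graph k W) = UNIV" "space (random_graph k W) = UNIV"
    "emeasure (random_graph k W) A = (\<integral>\<^sup>+p. emeasure (measure_pmf (random_edges k W (ordered_point k p))) A \<partial>sample_points k)"
proof -
  interpret prob_space "sample_points k"
    unfolding sample_points_def by (rule prob_space.prob_space_completion[OF prob_space_points])
  note m = measurable_random_edges[OF W, of k]
  have "sets (random_graph k W) = sets (count_space UNIV)"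
    unfolding random_graph_def by (rule sets_bind) (use not_empty in auto)
  then show s: "sets (random_graph k W) = UNIV" by simp
  then show "space (random_graph k W) = UNIV" by (metis UNIV_I UNIV_eq_I sets.sets_into_space top.extremum_uniqueI)
  show "prob_space (random_graph k W)"
    unfolding random_graph_def by (rule prob_space_bind[OF _ m]) (simp add: measure_pmf.prob_space_axioms)
  show "emeasure (random_graph k W) A = (\<integral>\<^sup>+p. emeasure (measure_pmf (random_edges k W (ordered_point k p))) A \<partial>sample_points k)"
    unfolding random_graph_def by (rule emeasure_bind[OF not_empty m]) simp
qed

lemma emeasure_cell_of_vimage:
  assumes M: "M > 0" and c: "c \<in> grid_cells M"
  shows "{u \<in> unit_square. cell_of M u = c} \<in> sets square_measure"
    "emeasure square_measure {u \<in> unit_square. cell_of M u = c} = ennreal (1 / (real M)\<^sup>2)"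
proof -
  define Z where "Z = ({0::real} \<times> UNIV \<union> UNIV \<times> {0::real} :: point set)"
  have Z: "Z \<in> null_sets lborel" unfolding Z_def by (rule null_sets_cylinders) auto
  let ?A = "{u \<in> unit_square. cell_of M u = c}"
  have sub: "?A - cell_region M c \<subseteq> Z"
    using mem_cell_region_iff[OF M c] by (force simp: Z_def unit_square_def)
  have eq: "?A = cell_region M c \<union> (?A - cell_region M c)"
    using mem_cell_region_iff[OF M c] cell_region_subset[OF M c] by auto
  have A: "?A \<in> sets lebesgue"
    by (rule sets_completionI[OF eq sub Z]) (simp add: cell_region_borel)
  then show "?A \<in> sets square_measure"
    using sets_restrict_space_iff[of unit_square lebesgue ?A] unit_square_lebesgue by auto
  have "emeasure square_measure ?A = emeasure lebesgue ?A"
    by (rule emeasure_restrict_space) (auto intro: unit_square_lebesgue)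
  also have "\<dots> = emeasure lborel (cell_region M c)"
    using emeasure_lebesgue_Un_null[OF _ Z sub, of "cell_region M c"] eq cell_region_borel by simp
  finally show "emeasure square_measure ?A = ennreal (1 / (real M)\<^sup>2)"
    by (simp add: measure_lborel_cell_region[OF M])
qed

text \<open>The default value outside \<open>{1..k}\<close> is the one used for the product distribution below.\<close>
definition cells_of_points :: "nat \<Rightarrow> nat \<Rightarrow> (nat \<Rightarrow> point) \<Rightarrow> nat \<Rightarrow> nat \<times> nat" where
  "cells_of_points k M p = (\<lambda>i. if i \<in> {1..k} then cell_of M (p i) else (0, 0))"

text \<open>The cells of the sample points are independent and uniform, which transfers all questions about the sample
points to a finite product distribution.\<close>
lemma cells_of_points_distribution:
  assumes M: "M > 0"
  shows "{p \<in> space (points_measure k). cells_of_points k M p \<in> B} \<in> sets (points_measure k)"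
    "emeasure (points_measure k) {p \<in> space (points_measure k). cells_of_points k M p \<in> B}
      = emeasure (measure_pmf (Pi_pmf {1..k} (0, 0) (\<lambda>_. pmf_of_set (grid_cells M)))) B"
proof -
  interpret P: product_prob_space "\<lambda>_. square_measure" "{1..k}" by (rule product_prob_spaceI) (rule prob_space_square)
  let ?G = "grid_cells M" and ?P = "points_measure k"
  let ?X = "PiE_dflt {1..k} (0, 0) (\<lambda>_. ?G)"
  let ?M = "Pi_pmf {1..k} (0, 0) (\<lambda>_. pmf_of_set ?G)"
  have G: "?G \<noteq> {}" "finite ?G" using M by (auto simp: grid_cells_def)
  have finX: "finite ?X" by (rule finite_PiE_dflt) (use G in auto)
  define F where "F x = (\<Pi>\<^sub>E i\<in>{1..k}. {u \<in> unit_square. cell_of M u = x i})" for x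
  have cell_sets: "{u \<in> unit_square. cell_of M u = x i} \<in> sets square_measure" if "x \<in> ?X" "i \<in> {1..k}" for x i
    by (rule emeasure_cell_of_vimage(1)[OF M]) (use that in \<open>auto simp: PiE_dflt_def\<close>)
  have F_sets: "F x \<in> sets ?P" if "x \<in> ?X" for x
    unfolding F_def by (rule sets_PiM_I_finite) (use cell_sets that in auto)
  have F: "emeasure ?P (F x) = ennreal (pmf ?M x)" if "x \<in> ?X" for x
  proof -
    have "emeasure ?P (F x) = (\<Prod>i\<in>{1..k}. emeasure square_measure {u \<in> unit_square. cell_of M u = x i})"
      unfolding F_def by (rule P.emeasure_PiM) (use cell_sets that in auto)
    also have "\<dots> = (\<Prod>i\<in>{1..k}. ennreal (pmf (pmf_of_set ?G) (x i)))"
    proof (rule prod.cong[OF refl])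
      fix i assume "i \<in> {1..k}"
      then have x: "x i \<in> ?G" using that by (auto simp: PiE_dflt_def)
      then show "emeasure square_measure {u \<in> unit_square. cell_of M u = x i} = ennreal (pmf (pmf_of_set ?G) (x i))"
        using G by (simp add: emeasure_cell_of_vimage(2)[OF M x] card_grid_cells power2_eq_square)
    qed
    also have "\<dots> = ennreal (\<Prod>i\<in>{1..k}. pmf (pmf_of_set ?G) (x i))" by (simp add: prod_ennreal)
    also have "(\<Prod>i\<in>{1..k}. pmf (pmf_of_set ?G) (x i)) = pmf ?M x"
      by (rule pmf_Pi'[symmetric]) (use that in \<open>auto simp: PiE_dflt_def\<close>)
    finally show ?thesis .
  qed
  have in_X: "cells_of_points k M p \<in> ?X" if "p \<in> space ?P" for p
    using space_points[OF that] cell_of_in_grid[OF M] by (auto simp: PiE_dflt_def cells_of_points_def)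
  have F_iff: "p \<in> F x \<longleftrightarrow> p \<in> space ?P \<and> cells_of_points k M p = x" if "x \<in> ?X" for x p
    using that by (auto simp: F_def space_PiM PiE_def Pi_def extensional_def PiE_dflt_def cells_of_points_def fun_eq_iff)
  have eq: "{p \<in> space ?P. cells_of_points k M p \<in> B} = (\<Union>x\<in>?X \<inter> B. F x)"
  proof (intro set_eqI iffI)
    fix p assume "p \<in> {p \<in> space ?P. cells_of_points k M p \<in> B}"
    then show "p \<in> (\<Union>x\<in>?X \<inter> B. F x)"
      using in_X[of p] F_iff[of "cells_of_points k M p" p] by (intro UN_I[of "cells_of_points k M p"]) simp_all
  next
    fix p assume "p \<in> (\<Union>x\<in>?X \<inter> B. F x)"
    then obtain x where "x \<in> ?X" "x \<in> B" "p \<in> F x" by blast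
    then show "p \<in> {p \<in> space ?P. cells_of_points k M p \<in> B}" using F_iff[of x p] by simp
  qed
  show "{p \<in> space ?P. cells_of_points k M p \<in> B} \<in> sets ?P"
    unfolding eq using finX F_sets by (intro sets.finite_UN) auto
  have "emeasure ?P {p \<in> space ?P. cells_of_points k M p \<in> B} = (\<Sum>x\<in>?X \<inter> B. emeasure ?P (F x))"
    unfolding eq
  proof (rule sum_emeasure[symmetric])
    show "disjoint_family_on F (?X \<inter> B)" using F_iff by (auto simp: disjoint_family_on_def)
  qed (use finX F_sets in auto)
  also have "\<dots> = (\<Sum>x\<in>?X \<inter> B. ennreal (pmf ?M x))" by (rule sum.cong) (use F in auto)
  also have "\<dots> = emeasure (measure_pmf ?M) (?X \<inter> B)"
    using finX by (subst emeasure_measure_pmf_finite) auto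
  also have "\<dots> = emeasure (measure_pmf ?M) B"
  proof (rule emeasure_eq_AE)
    have "set_pmf ?M \<subseteq> ?X"
      using set_Pi_pmf_subset'[of "{1..k}" "(0, 0)" "\<lambda>_. pmf_of_set ?G"] G by simp
    then show "AE x in measure_pmf ?M. x \<in> ?X \<inter> B \<longleftrightarrow> x \<in> B" by (auto intro!: AE_pmfI)
  qed auto
  finally show "emeasure ?P {p \<in> space ?P. cells_of_points k M p \<in> B} = emeasure (measure_pmf ?M) B" .
qed

section \<open>Approximating an orderon by a grid kernel\<close>

lemma dist_cell_of_le:
  assumes "M > 0" "u \<in> unit_square"
  shows "dist u (real (fst (cell_of M u)) / real M, real (snd (cell_of M u)) / real M) \<le> 2 / real M"
proof -
  have "dist u (a, b) \<le> \<bar>fst u - a\<bar> + \<bar>snd u - b\<bar>" for a b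
    by (cases u) (simp add: dist_Pair_Pair dist_real_def sqrt_sum_squares_le_sum_abs)
  also have "\<bar>fst u - real (fst (cell_of M u)) / real M\<bar> + \<bar>snd u - real (snd (cell_of M u)) / real M\<bar> \<le> 1 / real M + 1 / real M"
    unfolding cell_of_def fst_conv snd_conv by (intro add_mono Q_approx) (use assms in \<open>auto simp: unit_square_def\<close>)
  finally show ?thesis by simp
qed

text \<open>A Lebesgue measurable function is almost everywhere a limit of continuous functions. One of them is within
\<open>\<epsilon> / 2\<close> of \<open>W\<close> outside a set of small measure, which is enlarged to an open set \<open>N\<close>; by uniform continuity, the values of that function at the corners
of the cells then serve as \<open>w\<close> for all sufficiently fine grids. The set \<open>N\<close> is chosen before the grid.\<close>
lemma orderon_grid_approximation:
  assumes W: "W \<in> orderons" and \<epsilon>: "\<epsilon> > 0" and \<eta>: "\<eta> > 0"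
  obtains N M0 where "N \<in> sets borel" "emeasure lborel N \<le> ennreal \<eta>"
    "\<And>M. M \<ge> M0 \<Longrightarrow> M > 0 \<Longrightarrow> \<exists>w. (\<forall>c d. 0 \<le> w c d \<and> w c d \<le> (1::real)) \<and>
       (\<forall>u\<in>unit_square. \<forall>v\<in>unit_square. (u, v) \<notin> N \<longrightarrow> \<bar>W (u, v) - w (cell_of M u) (cell_of M v)\<bar> \<le> \<epsilon>)"
proof -
  let ?S = "unit_square \<times> unit_square"
  have S: "?S \<in> lmeasurable" "?S \<in> sets lebesgue"
    using lmeasurable_Times_unit_square(1)[of unit_square unit_square] unit_square_lebesgue by (auto simp: fmeasurable_def)
  have Wm: "W \<in> borel_measurable (lebesgue_on ?S)"
    and W01: "u \<in> unit_square \<Longrightarrow> v \<in> unit_square \<Longrightarrow> 0 \<le> W (u, v) \<and> W (u, v) \<le> 1" for u v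
    using W by (auto simp: orderons_def)
  have Wm': "(\<lambda>z. if z \<in> ?S then W z else 0) \<in> borel_measurable lebesgue"
    using Wm S by (simp add: borel_measurable_if)
  have "(\<lambda>z. if z \<in> ?S then W z else 0) measurable_on UNIV"
    by (rule lebesgue_measurable_imp_measurable_on_real[OF Wm']) simp
  then obtain K g where K: "negligible K" and g: "\<And>n. continuous_on UNIV (g n)"
    and lim: "\<And>z. z \<notin> K \<Longrightarrow> (\<lambda>n. g n z) \<longlonglongrightarrow> (if z \<in> ?S then W z else 0)"
    unfolding measurable_on_def by (simp only: UNIV_I if_True, blast)
  have gm: "g n \<in> borel_measurable lebesgue" for n
    using borel_measurable_continuous_onI[OF g[of n]] by (simp add: measurable_completion)
  \<comment> \<open>the sets decrease, and their intersection consists of points where the sequence does not converge to \<open>W\<close>\<close>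
  define B where "B n = {z \<in> ?S. \<exists>m\<ge>n. \<epsilon> / 2 < \<bar>g m z - W z\<bar>}" for n
  have B_sets: "B n \<in> sets lebesgue" for n
  proof -
    have C: "{z \<in> space lebesgue. \<epsilon> / 2 < \<bar>g m z - (if z \<in> ?S then W z else 0)\<bar>} \<in> sets lebesgue" for m
      by (intro borel_measurable_less borel_measurable_const borel_measurable_abs borel_measurable_diff gm Wm')
    have "B n = (\<Union>m\<in>{n..}. ?S \<inter> {z \<in> space lebesgue. \<epsilon> / 2 < \<bar>g m z - (if z \<in> ?S then W z else 0)\<bar>})"
      by (auto simp: B_def)
    also have "\<dots> \<in> sets lebesgue"
      by (rule sets.countable_UN', simp, rule image_subsetI, rule sets.Int[OF S(2) C])
    finally show ?thesis .
  qed
  have "(\<lambda>n. emeasure lebesgue (B n)) \<longlonglongrightarrow> emeasure lebesgue (\<Inter>n. B n)"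
  proof (rule Lim_emeasure_decseq)
    show "range B \<subseteq> sets lebesgue" using B_sets by auto
    show "decseq B" unfolding decseq_def B_def by (blast intro: order_trans)
    show "emeasure lebesgue (B n) \<noteq> \<infinity>" for n
    proof -
      have "emeasure lebesgue (B n) \<le> emeasure lebesgue ?S" by (rule emeasure_mono) (use S in \<open>auto simp: B_def\<close>)
      then show ?thesis using S(1) by (auto simp: fmeasurable_def)
    qed
  qed
  moreover have "emeasure lebesgue (\<Inter>n. B n) = 0"
  proof -
    have "(\<Inter>n. B n) \<subseteq> K"
    proof (rule ccontr)
      assume "\<not> ?thesis"
      then obtain z where z: "\<And>n. z \<in> B n" "z \<notin> K" by (meson INT_E UNIV_I subsetI)
      have zS: "z \<in> ?S" using z(1)[of 0] by (simp add: B_def)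
      then have "(\<lambda>n. g n z) \<longlonglongrightarrow> W z" using lim[OF z(2)] by simp
      then obtain n where "\<And>m. m \<ge> n \<Longrightarrow> \<bar>g m z - W z\<bar> < \<epsilon> / 2"
        using \<epsilon> LIMSEQ_D[of "\<lambda>n. g n z" "W z" "\<epsilon> / 2"] by auto
      moreover obtain m where "m \<ge> n" "\<epsilon> / 2 < \<bar>g m z - W z\<bar>" using z(1)[of n] by (auto simp: B_def)
      ultimately show False by (meson not_less_iff_gr_or_eq)
    qed
    then have "negligible (\<Inter>n. B n)" using K negligible_subset by blast
    then show ?thesis by (simp add: negligible_iff_null_sets null_sets_def)
  qed
  ultimately have "(\<lambda>n. emeasure lebesgue (B n)) \<longlonglongrightarrow> 0" by simp
  then have "\<forall>\<^sub>F n in sequentially. emeasure lebesgue (B n) < ennreal (\<eta> / 2)"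
    by (rule order_tendstoD(2)) (use \<eta> in simp)
  then obtain n where n: "emeasure lebesgue (B n) < ennreal (\<eta> / 2)"
    by (auto simp: eventually_sequentially)
  obtain T where T: "open T" "B n \<subseteq> T" "T - B n \<in> lmeasurable" "emeasure lebesgue (T - B n) < ennreal (\<eta> / 2)"
    by (rule sets_lebesgue_outer_open[OF B_sets[of n], of "\<eta> / 2"]) (use \<eta> in simp)
  have Tm: "emeasure lborel T \<le> ennreal \<eta>"
  proof -
    have "emeasure lborel T = emeasure lebesgue T" using T(1) by simp
    also have "\<dots> = emeasure lebesgue (B n \<union> (T - B n))" using T(2) by (simp add: Un_absorb1)
    also have "\<dots> \<le> emeasure lebesgue (B n) + emeasure lebesgue (T - B n)"
      by (rule emeasure_subadditive) (use B_sets T(1) in auto)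
    also have "\<dots> \<le> ennreal (\<eta> / 2) + ennreal (\<eta> / 2)" using n T(4) by (intro add_mono) auto
    also have "\<dots> = ennreal \<eta>" using \<eta> by (simp flip: ennreal_plus)
    finally show ?thesis .
  qed
  have comp: "compact ?S"
  proof -
    have "compact unit_square" unfolding unit_square_def by (intro compact_Times compact_Icc)
    then show ?thesis by (intro compact_Times)
  qed
  have "uniformly_continuous_on ?S (g n)"
    by (rule compact_uniformly_continuous[OF continuous_on_subset[OF g] comp]) auto
  then obtain \<delta> where \<delta>: "\<delta> > 0" "\<And>z z'. z \<in> ?S \<Longrightarrow> z' \<in> ?S \<Longrightarrow> dist z' z < \<delta> \<Longrightarrow> dist (g n z') (g n z) < \<epsilon> / 2"
    unfolding uniformly_continuous_on_def using \<epsilon> half_gt_zero by metis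
  obtain M0 :: nat where M0: "4 / \<delta> < real M0" using reals_Archimedean2 by blast
  show thesis
  proof (rule that[of T M0])
    show "T \<in> sets borel" using T(1) by simp
    show "emeasure lborel T \<le> ennreal \<eta>" by (rule Tm)
    fix M assume M: "M \<ge> M0" "M > 0"
    define ctr where "ctr c = (real (fst c) / real M, real (snd c) / real M)" for c :: "nat \<times> nat"
    define w where "w c d = max 0 (min 1 (g n (ctr c, ctr d)))" for c d
    have "\<bar>W (u, v) - w (cell_of M u) (cell_of M v)\<bar> \<le> \<epsilon>"
      if uv: "u \<in> unit_square" "v \<in> unit_square" "(u, v) \<notin> T" for u v
    proof -
      have near: "dist u (ctr (cell_of M u)) \<le> 2 / real M" "ctr (cell_of M u) \<in> unit_square"
        if "u \<in> unit_square" for u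
        using dist_cell_of_le[OF M(2) that] cell_of_in_grid[OF M(2) that] M(2)
        by (auto simp: ctr_def grid_cells_def unit_square_def mem_Times_iff)
      have "4 / real M < \<delta>"
      proof -
        have "4 / \<delta> < real M" using M0 M(1) by linarith
        then show ?thesis using \<delta>(1) M(2) by (simp add: field_simps)
      qed
      moreover have "dist (u, v) (ctr (cell_of M u), ctr (cell_of M v)) \<le> dist u (ctr (cell_of M u)) + dist v (ctr (cell_of M v))"
        by (simp add: dist_Pair_Pair sqrt_sum_squares_le_sum)
      ultimately have "dist (u, v) (ctr (cell_of M u), ctr (cell_of M v)) < \<delta>"
        using near(1)[OF uv(1)] near(1)[OF uv(2)] by linarith
      then have "dist (g n (u, v)) (g n (ctr (cell_of M u), ctr (cell_of M v))) < \<epsilon> / 2"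
        using \<delta>(2)[of "(ctr (cell_of M u), ctr (cell_of M v))" "(u, v)"] near(2) uv by auto
      moreover have "\<bar>g n (u, v) - W (u, v)\<bar> \<le> \<epsilon> / 2"
        using uv T(2) by (force simp: B_def not_less)
      ultimately have "\<bar>W (u, v) - g n (ctr (cell_of M u), ctr (cell_of M v))\<bar> \<le> \<epsilon>"
        unfolding dist_real_def by linarith
      then show ?thesis using W01[OF uv(1,2)] unfolding w_def by (auto simp: max_def min_def abs_le_iff)
    qed
    moreover have "0 \<le> w c d \<and> w c d \<le> 1" for c d by (simp add: w_def)
    ultimately show "\<exists>w. (\<forall>c d. 0 \<le> w c d \<and> w c d \<le> 1) \<and>
       (\<forall>u\<in>unit_square. \<forall>v\<in>unit_square. (u, v) \<notin> T \<longrightarrow> \<bar>W (u, v) - w (cell_of M u) (cell_of M v)\<bar> \<le> \<epsilon>)"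
      by blast
  qed
qed

section \<open>Aligning the cells with the sample\<close>

text \<open>The vertex whose strip contains the cell, when the grid has \<open>l\<close> columns of cells in each strip.\<close>
definition cell_rank :: "nat \<Rightarrow> nat \<times> nat \<Rightarrow> nat" where
  "cell_rank l c = (fst c - 1) div l + 1"

text \<open>Blocks of \<open>s\<close> consecutive vertices. Their strips form the vertical bands inside which cells are permuted. The band of
a cell depends only on its vertex, because bands begin and end at boundaries of strips.\<close>
definition rank_block :: "nat \<Rightarrow> nat \<Rightarrow> nat" where
  "rank_block s i = (i - 1) div s"

lemma cell_rank_in:
  assumes "l > 0" "c \<in> grid_cells (k * l)"
  shows "cell_rank l c \<in> {1..k}"
proof -
  have "fst c - 1 < k * l" using assms by (auto simp: grid_cells_def)
  then have "(fst c - 1) div l < k" by (simp add: less_mult_imp_div_less)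
  then show ?thesis by (simp add: cell_rank_def)
qed

lemma card_cell_rank_eq:
  assumes "l > 0" "i \<in> {1..k}"
  shows "card {c \<in> grid_cells (k * l). cell_rank l c = i} = l * (k * l)"
proof -
  have rank_iff: "cell_rank l c = i \<longleftrightarrow> (i - 1) * l + 1 \<le> fst c \<and> fst c \<le> i * l" if a: "fst c \<ge> 1" for c
  proof -
    obtain i' where i': "i = Suc i'" using assms by (cases i) auto
    obtain a' where a': "fst c = Suc a'" using a by (cases "fst c") auto
    have "a' div l = i' \<longleftrightarrow> i' * l \<le> a' \<and> a' < Suc i' * l"
      using assms(1) by (metis div_nat_eqI dividend_less_div_times le_add1 less_eq_div_iff_mult_less_eq mult.commute mult_Suc order_refl add.commute)
    then show ?thesis by (auto simp: cell_rank_def i' a')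
  qed
  have il: "i * l \<le> k * l" using assms by (intro mult_le_mono1) auto
  have "c \<in> {c \<in> grid_cells (k * l). cell_rank l c = i} \<longleftrightarrow> c \<in> {(i - 1) * l + 1..i * l} \<times> {1..k * l}" for c
  proof (cases "fst c \<ge> 1")
    case True
    show ?thesis
      unfolding mem_Collect_eq rank_iff[OF True] using True by (auto simp: grid_cells_def mem_Times_iff intro: order_trans[OF _ il])
  qed (auto simp: grid_cells_def mem_Times_iff)
  then have "{c \<in> grid_cells (k * l). cell_rank l c = i} = {(i - 1) * l + 1..i * l} \<times> {1..k * l}" by (rule set_eqI)
  moreover have "card {(i - 1) * l + 1..i * l} = l"
    using assms by (cases i) auto
  ultimately show ?thesis by (simp add: card_cartesian_product)
qed

lemma card_cell_rank_filter:
  assumes "l > 0"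
  shows "card {c \<in> grid_cells (k * l). P (cell_rank l c)} = l * (k * l) * card {i \<in> {1..k}. P i}"
proof -
  have "{c \<in> grid_cells (k * l). P (cell_rank l c)}
     = (\<Union>i\<in>{i \<in> {1..k}. P i}. {c \<in> grid_cells (k * l). cell_rank l c = i})"
    using cell_rank_in[OF assms] by auto
  also have "card \<dots> = (\<Sum>i\<in>{i \<in> {1..k}. P i}. card {c \<in> grid_cells (k * l). cell_rank l c = i})"
    by (rule card_UN_disjoint) auto
  also have "\<dots> = (\<Sum>i\<in>{i \<in> {1..k}. P i}. l * (k * l))"
    by (rule sum.cong[OF refl]) (use card_cell_rank_eq[OF assms] in auto)
  finally show ?thesis by simp
qed

lemma sum_card_fibers:
  assumes "finite A" "finite T"
  shows "(\<Sum>y\<in>T. card {c \<in> A. f c = y}) = card {c \<in> A. f c \<in> T}"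
proof -
  have "(\<Sum>y\<in>T. card {c \<in> A. f c = y}) = card (\<Union>y\<in>T. {c \<in> A. f c = y})"
    by (rule card_UN_disjoint[symmetric]) (use assms in auto)
  also have "(\<Union>y\<in>T. {c \<in> A. f c = y}) = {c \<in> A. f c \<in> T}" by auto
  finally show ?thesis .
qed

text \<open>An index at which \<open>f\<close> and \<open>g\<close> agree contributes equally to both counts, and any other index is counted once for
\<open>f\<close> and once for \<open>g\<close>.\<close>
lemma sum_abs_diff_card_fibers_le:
  assumes "finite I" "finite T"
  shows "(\<Sum>y\<in>T. \<bar>real (card {i \<in> I. f i = y}) - real (card {i \<in> I. g i = y})\<bar>) \<le> 2 * real (card {i \<in> I. f i \<noteq> g i})"
proof -
  let ?D = "{i \<in> I. f i \<noteq> g i}"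
  have one: "\<bar>real (card {i \<in> I. f i = y}) - real (card {i \<in> I. g i = y})\<bar>
      \<le> real (card {i \<in> ?D. f i = y}) + real (card {i \<in> ?D. g i = y})" for y
  proof -
    have split: "card {i \<in> I. h i = y} = card {i \<in> I. f i = g i \<and> h i = y} + card {i \<in> ?D. h i = y}" for h
    proof -
      have "{i \<in> I. h i = y} = {i \<in> I. f i = g i \<and> h i = y} \<union> {i \<in> ?D. h i = y}" by auto
      then show ?thesis using assms by (subst card_Un_disjoint[symmetric]) auto
    qed
    have "{i \<in> I. f i = g i \<and> f i = y} = {i \<in> I. f i = g i \<and> g i = y}" by auto
    then show ?thesis unfolding split[of f] split[of g] by simp
  qed
  have "(\<Sum>y\<in>T. real (card {i \<in> ?D. h i = y})) \<le> real (card ?D)" for h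
  proof -
    have "(\<Sum>y\<in>T. card {i \<in> ?D. h i = y}) \<le> card ?D"
      using assms by (subst sum_card_fibers) (auto intro!: card_mono)
    then show ?thesis by (simp flip: of_nat_sum)
  qed
  from add_mono[OF this[of f] this[of g]] show ?thesis
    using order_trans[OF sum_mono[OF one]] by (fastforce simp: sum.distrib)
qed

text \<open>The label of a cell \<open>c\<close> is its class on the source side and, on the target side, the class of the sample point
whose vertex strip contains \<open>c\<close>. By \<open>matching_within_strips\<close>, the number of misplaced cells is at most the total difference of the label
counts within the blocks. These counts are compared in two steps: the counts of sample points by position are close to the
volumes by assumption, and replacing the block of the position by the block of the rank changes little,
because both are monotone along the sorted sample and their level counts are close (\<open>monotone_disagreement\<close>).\<close>
lemma aligning_permutation:
  fixes Z :: "nat \<Rightarrow> nat \<times> nat" and cls :: "nat \<times> nat \<Rightarrow> nat" and k l s m R :: nat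
  defines "\<Omega> \<equiv> grid_cells (k * l)" and "blk \<equiv> \<lambda>c. rank_block s (cell_rank l c)"
  assumes pos: "k > 0" "l > 0" "s > 0" and Z: "\<And>i. i \<in> {1..k} \<Longrightarrow> Z i \<in> \<Omega>"
    and mono: "\<And>i j. i \<in> {1..k} \<Longrightarrow> j \<in> {1..k} \<Longrightarrow> i \<le> j \<Longrightarrow> fst (Z i) \<le> fst (Z j)"
    and cls: "\<And>c. cls c < R" and m: "(k - 1) div s < m"
    and counts: "\<And>y. y \<in> {..<m} \<times> {..<R} \<Longrightarrow>
      \<bar>real (card {i \<in> {1..k}. (blk (Z i), cls (Z i)) = y}) - real k * (real (card {c \<in> \<Omega>. (blk c, cls c) = y}) / real (card \<Omega>))\<bar> \<le> real k * \<tau>"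
  obtains \<pi> where "bij_betw \<pi> \<Omega> \<Omega>" "\<And>c. c \<in> \<Omega> \<Longrightarrow> blk (\<pi> c) = blk c"
    "real (card {c \<in> \<Omega>. cls c \<noteq> cls (Z (cell_rank l (\<pi> c)))}) \<le> real (card \<Omega>) * (real m * real R * \<tau> * (1 + 2 * real m))"
proof -
  let ?I = "{1..k}" and ?T = "{..<m} \<times> {..<R}"
  define n where "n = real (card \<Omega>)"
  \<comment> \<open>the number of cells in a vertex strip\<close>
  define \<mu> where "\<mu> = real l * real (k * l)"
  have fin: "finite \<Omega>" by (simp add: \<Omega>_def)
  have n: "n > 0" "n = real k * \<mu>" using pos by (auto simp: n_def \<Omega>_def card_grid_cells \<mu>_def)
  have \<mu>: "\<mu> > 0" using pos by (simp add: \<mu>_def)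
  define ty where "ty c = (blk c, cls c)" for c
  define a where "a y = real (card {c \<in> \<Omega>. ty c = y})" for y
  define K where "K y = real (card {i \<in> ?I. ty (Z i) = y})" for y
  define K' where "K' y = real (card {i \<in> ?I. (rank_block s i, cls (Z i)) = y})" for y
  have counts': "\<bar>a y - \<mu> * K y\<bar> \<le> n * \<tau>" "\<bar>K y - a y / \<mu>\<bar> \<le> real k * \<tau>" if "y \<in> ?T" for y
  proof -
    have "real k * (a y / n) = a y / \<mu>" using n pos by simp
    then show *: "\<bar>K y - a y / \<mu>\<bar> \<le> real k * \<tau>"
      using counts[OF that] unfolding K_def a_def ty_def n_def by simp
    have "a y - \<mu> * K y = - (\<mu> * (K y - a y / \<mu>))" using \<mu> by (simp add: field_simps)
    then have "\<bar>a y - \<mu> * K y\<bar> = \<mu> * \<bar>K y - a y / \<mu>\<bar>" using \<mu> by (simp add: abs_mult)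
    also have "\<dots> \<le> \<mu> * (real k * \<tau>)" using * \<mu> by (intro mult_left_mono) auto
    finally show "\<bar>a y - \<mu> * K y\<bar> \<le> n * \<tau>" using n by (simp add: mult_ac)
  qed
  have rank_lt: "rank_block s i < m" if "i \<in> ?I" for i
  proof -
    have "(i - 1) div s \<le> (k - 1) div s" using that by (intro div_le_mono) auto
    then show ?thesis using m by (simp add: rank_block_def)
  qed
  have blk_lt: "blk c < m" if "c \<in> \<Omega>" for c
    using rank_lt[OF cell_rank_in[OF pos(2)]] that by (simp add: blk_def \<Omega>_def)
  have card_T: "real (card ?T) = real m * real R" by simp
  have mismatch: "real (card {i \<in> ?I. blk (Z i) \<noteq> rank_block s i}) \<le> real m * (real m * real R * (real k * \<tau>))"
  proof (rule monotone_disagreement)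
    show "mono_on ?I (\<lambda>i. blk (Z i))"
      using mono by (intro mono_onI) (auto simp: blk_def rank_block_def cell_rank_def intro!: div_le_mono diff_le_mono)
    show "mono_on ?I (rank_block s)"
      by (intro mono_onI) (auto simp: rank_block_def intro!: div_le_mono diff_le_mono)
    show "blk (Z i) < m \<and> rank_block s i < m" if "i \<in> ?I" for i
      using blk_lt[OF Z[OF that]] rank_lt[OF that] by simp
    fix j assume "j < m"
    let ?Tj = "{y \<in> ?T. fst y \<ge> j}"
    have finT: "finite ?Tj" by simp
    have 1: "real (card {i \<in> ?I. blk (Z i) \<ge> j}) = (\<Sum>y\<in>?Tj. K y)"
    proof -
      have "{i \<in> ?I. blk (Z i) \<ge> j} = {i \<in> ?I. ty (Z i) \<in> ?Tj}"
        using blk_lt[OF Z] cls by (auto simp: ty_def simp del: split_paired_All)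
      then show ?thesis unfolding K_def using sum_card_fibers[of ?I ?Tj "\<lambda>i. ty (Z i)"] finT by (simp flip: of_nat_sum)
    qed
    have 2: "real (card {i \<in> ?I. rank_block s i \<ge> j}) = (\<Sum>y\<in>?Tj. a y / \<mu>)"
    proof -
      have "{c \<in> \<Omega>. rank_block s (cell_rank l c) \<ge> j} = {c \<in> \<Omega>. ty c \<in> ?Tj}"
        using blk_lt cls by (auto simp: ty_def blk_def)
      then have "real (card {c \<in> \<Omega>. rank_block s (cell_rank l c) \<ge> j}) = (\<Sum>y\<in>?Tj. a y)"
        unfolding a_def using sum_card_fibers[of \<Omega> ?Tj ty] finT fin by (simp flip: of_nat_sum)
      moreover have "real (card {c \<in> \<Omega>. rank_block s (cell_rank l c) \<ge> j}) = \<mu> * real (card {i \<in> ?I. rank_block s i \<ge> j})"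
        unfolding \<Omega>_def \<mu>_def using card_cell_rank_filter[OF pos(2), of k "\<lambda>i. rank_block s i \<ge> j"] by simp
      ultimately show ?thesis using \<mu> by (simp add: field_simps flip: sum_divide_distrib)
    qed
    have "\<bar>(\<Sum>y\<in>?Tj. K y) - (\<Sum>y\<in>?Tj. a y / \<mu>)\<bar> \<le> (\<Sum>y\<in>?Tj. \<bar>K y - a y / \<mu>\<bar>)"
      unfolding sum_subtractf[symmetric] by (rule sum_abs)
    also have "\<dots> \<le> (\<Sum>y\<in>?T. \<bar>K y - a y / \<mu>\<bar>)" by (rule sum_mono2) auto
    also have "\<dots> \<le> real (card ?T) * (real k * \<tau>)" by (rule sum_bounded_above) (rule counts'(2))
    finally show "\<bar>real (card {i \<in> ?I. blk (Z i) \<ge> j}) - real (card {i \<in> ?I. rank_block s i \<ge> j})\<bar> \<le> real m * real R * (real k * \<tau>)"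
      unfolding 1 2 card_T .
  qed simp
  define g where "g c = cls (Z (cell_rank l c))" for c
  obtain \<pi> where \<pi>: "bij_betw \<pi> \<Omega> \<Omega>" "\<And>c. c \<in> \<Omega> \<Longrightarrow> blk (\<pi> c) = blk c"
    and le: "card {c\<in>\<Omega>. cls c \<noteq> g (\<pi> c)} \<le> (\<Sum>(j, t)\<in>?T. card {c\<in>\<Omega>. blk c = j \<and> cls c = t} - card {c\<in>\<Omega>. blk c = j \<and> g c = t})"
    using matching_within_strips[of \<Omega> \<Omega> ?T blk blk cls g] fin blk_lt cls by auto
  have term_le: "real (card {c\<in>\<Omega>. blk c = j \<and> cls c = t} - card {c\<in>\<Omega>. blk c = j \<and> g c = t}) \<le> \<bar>a (j, t) - \<mu> * K (j, t)\<bar> + \<mu> * \<bar>K (j, t) - K' (j, t)\<bar>" for j t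
  proof -
    have gK: "real (card {c\<in>\<Omega>. blk c = j \<and> g c = t}) = \<mu> * K' (j, t)"
      unfolding \<Omega>_def \<mu>_def K'_def blk_def g_def
      using card_cell_rank_filter[OF pos(2), of k "\<lambda>i. rank_block s i = j \<and> cls (Z i) = t"] by simp
    have fa: "real (card {c\<in>\<Omega>. blk c = j \<and> cls c = t}) = a (j, t)" by (simp add: a_def ty_def)
    have "real (x - y) \<le> \<bar>real x - real y\<bar>" for x y :: nat by auto
    from this[of "card {c\<in>\<Omega>. blk c = j \<and> cls c = t}" "card {c\<in>\<Omega>. blk c = j \<and> g c = t}"]
    have "real (card {c\<in>\<Omega>. blk c = j \<and> cls c = t} - card {c\<in>\<Omega>. blk c = j \<and> g c = t}) \<le> \<bar>a (j, t) - \<mu> * K' (j, t)\<bar>"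
      unfolding gK fa .
    also have "a (j, t) - \<mu> * K' (j, t) = (a (j, t) - \<mu> * K (j, t)) + \<mu> * (K (j, t) - K' (j, t))"
      by (simp add: right_diff_distrib)
    also have "\<bar>\<dots>\<bar> \<le> \<bar>a (j, t) - \<mu> * K (j, t)\<bar> + \<bar>\<mu> * (K (j, t) - K' (j, t))\<bar>" by (rule abs_triangle_ineq)
    also have "\<bar>\<mu> * (K (j, t) - K' (j, t))\<bar> = \<mu> * \<bar>K (j, t) - K' (j, t)\<bar>" using \<mu> by (simp add: abs_mult)
    finally show ?thesis .
  qed
  have "real (card {c\<in>\<Omega>. cls c \<noteq> g (\<pi> c)}) \<le> (\<Sum>(j, t)\<in>?T. real (card {c\<in>\<Omega>. blk c = j \<and> cls c = t} - card {c\<in>\<Omega>. blk c = j \<and> g c = t}))"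
    using le by (simp add: case_prod_unfold flip: of_nat_sum)
  also have "\<dots> \<le> (\<Sum>y\<in>?T. \<bar>a y - \<mu> * K y\<bar> + \<mu> * \<bar>K y - K' y\<bar>)"
    by (rule sum_mono) (use term_le in auto)
  also have "\<dots> = (\<Sum>y\<in>?T. \<bar>a y - \<mu> * K y\<bar>) + \<mu> * (\<Sum>y\<in>?T. \<bar>K y - K' y\<bar>)"
    by (simp add: sum.distrib sum_distrib_left)
  also have "\<dots> \<le> real (card ?T) * (n * \<tau>) + \<mu> * (2 * (real m * (real m * real R * (real k * \<tau>))))"
  proof (intro add_mono mult_left_mono)
    show "(\<Sum>y\<in>?T. \<bar>a y - \<mu> * K y\<bar>) \<le> real (card ?T) * (n * \<tau>)"
      by (rule sum_bounded_above) (rule counts'(1))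
    have "(\<Sum>y\<in>?T. \<bar>K y - K' y\<bar>) \<le> 2 * real (card {i \<in> ?I. ty (Z i) \<noteq> (rank_block s i, cls (Z i))})"
      unfolding K_def K'_def by (rule sum_abs_diff_card_fibers_le) auto
    also have "{i \<in> ?I. ty (Z i) \<noteq> (rank_block s i, cls (Z i))} = {i \<in> ?I. blk (Z i) \<noteq> rank_block s i}" by (simp add: ty_def)
    finally show "(\<Sum>y\<in>?T. \<bar>K y - K' y\<bar>) \<le> 2 * (real m * (real m * real R * (real k * \<tau>)))"
      using mismatch by linarith
  qed (use \<mu> in simp)
  also have "\<dots> = n * (real m * real R * \<tau> * (1 + 2 * real m))"
    unfolding card_T n(2) by (simp add: algebra_simps)
  finally show thesis using that[OF \<pi>] by (simp add: n_def g_def)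
qed

text \<open>The difference splits into the regularity error, the effect of the misplaced cells, each of which
spoils a row and a column where \<open>U\<close> is bounded by \<open>b0\<close>, and the error on the sample. The last is a matrix on vertices, and each vertex strip
consists of the same number of cells.\<close>
lemma aligned_cut_bound:
  fixes Z :: "nat \<Rightarrow> nat \<times> nat" and cls :: "nat \<times> nat \<Rightarrow> nat" and k l :: nat and G :: "nat \<Rightarrow> nat \<Rightarrow> real"
  defines "\<Omega> \<equiv> grid_cells (k * l)"
  assumes pos: "k > 0" "l > 0" and bij: "bij_betw \<pi> \<Omega> \<Omega>"
    and mis: "real (card {c \<in> \<Omega>. cls c \<noteq> cls (Z (cell_rank l (\<pi> c)))}) \<le> real (card \<Omega>) * \<theta>"
    and U: "\<And>a b. \<bar>U a b\<bar> \<le> b0"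
    and reg: "\<And>A B. A \<subseteq> \<Omega> \<Longrightarrow> B \<subseteq> \<Omega> \<Longrightarrow> \<bar>\<Sum>c\<in>A. \<Sum>d\<in>B. w c d - U (cls c) (cls d)\<bar> \<le> \<epsilon> * (real (card \<Omega>))\<^sup>2"
    and sample: "\<And>S T. S \<subseteq> {1..k} \<Longrightarrow> T \<subseteq> {1..k} \<Longrightarrow> \<bar>\<Sum>i\<in>S. \<Sum>j\<in>T. U (cls (Z i)) (cls (Z j)) - G i j\<bar> \<le> \<gamma> * (real k)\<^sup>2"
    and AB: "A \<subseteq> \<Omega>" "B \<subseteq> \<Omega>"
  shows "\<bar>\<Sum>c\<in>A. \<Sum>d\<in>B. w c d - G (cell_rank l (\<pi> c)) (cell_rank l (\<pi> d))\<bar> \<le> (\<epsilon> + 4 * b0 * \<theta> + \<gamma>) * (real (card \<Omega>))\<^sup>2"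
proof -
  define n where "n = real (card \<Omega>)"
  define \<rho> where "\<rho> c = cell_rank l (\<pi> c)" for c
  define Bad where "Bad = {c \<in> \<Omega>. cls c \<noteq> cls (Z (\<rho> c))}"
  have fin: "finite \<Omega>" "finite A" "finite B" using AB by (auto simp: \<Omega>_def intro: finite_subset[OF _ finite_grid_cells])
  have n: "n = real k * (real l * real (k * l))" using pos by (simp add: n_def \<Omega>_def card_grid_cells)
  have b0: "b0 \<ge> 0" using U[of 0 0] by linarith
  have \<rho>: "\<rho> c \<in> {1..k}" if "c \<in> \<Omega>" for c
  proof -
    have "\<pi> c \<in> \<Omega>" using bij_betwE[OF bij] that by blast
    then show ?thesis unfolding \<rho>_def \<Omega>_def by (rule cell_rank_in[OF pos(2)])
  qed
  have cardA: "real (card X) \<le> n" if "X \<subseteq> \<Omega>" for X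
    using card_mono[OF fin(1) that] by (simp add: n_def)
  have P2: "\<bar>\<Sum>c\<in>A. \<Sum>d\<in>B. U (cls c) (cls d) - U (cls (Z (\<rho> c))) (cls (Z (\<rho> d)))\<bar> \<le> 4 * b0 * \<theta> * n\<^sup>2"
  proof -
    have "\<bar>\<Sum>c\<in>A. \<Sum>d\<in>B. U (cls c) (cls d) - U (cls (Z (\<rho> c))) (cls (Z (\<rho> d)))\<bar>
       \<le> (\<Sum>c\<in>A. \<Sum>d\<in>B. 2 * b0 * of_bool (c \<in> Bad) + 2 * b0 * of_bool (d \<in> Bad))"
    proof (intro order_trans[OF sum_abs] sum_mono)
      fix c d assume "c \<in> A" "d \<in> B"
      then have "c \<in> \<Omega>" "d \<in> \<Omega>" using AB by auto
      then show "\<bar>U (cls c) (cls d) - U (cls (Z (\<rho> c))) (cls (Z (\<rho> d)))\<bar> \<le> 2 * b0 * of_bool (c \<in> Bad) + 2 * b0 * of_bool (d \<in> Bad)"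
        using U[of "cls c" "cls d"] U[of "cls (Z (\<rho> c))" "cls (Z (\<rho> d))"] b0 by (auto simp: Bad_def)
    qed
    also have "\<dots> = 2 * b0 * (real (card (A \<inter> Bad)) * real (card B) + real (card A) * real (card (B \<inter> Bad)))"
      using fin by (simp add: sum.distrib algebra_simps Int_def flip: sum_distrib_left)
    also have "\<dots> \<le> 2 * b0 * ((n * \<theta>) * n + n * (n * \<theta>))"
    proof -
      have bad: "real (card (X \<inter> Bad)) \<le> n * \<theta>" for X
      proof -
        have "card (X \<inter> Bad) \<le> card Bad" using fin by (intro card_mono) (auto simp: Bad_def)
        then show ?thesis using mis by (simp add: Bad_def n_def \<rho>_def)
      qed
      have "0 \<le> n * \<theta>" using bad[of "{}"] by simp
      then show ?thesis using b0 cardA[OF AB(1)] cardA[OF AB(2)] bad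
        by (intro mult_left_mono add_mono mult_mono) auto
    qed
    also have "\<dots> = 4 * b0 * \<theta> * n\<^sup>2" by (simp add: power2_eq_square)
    finally show ?thesis .
  qed
  define K where "K = real (l * (k * l))"
  have K: "K > 0" "n = real k * K" using pos n by (auto simp: K_def)
  have fib: "real (card {c \<in> X. \<rho> c = i}) \<le> K" if "X \<subseteq> \<Omega>" "i \<in> {1..k}" for X i
  proof -
    have "card {c \<in> X. \<rho> c = i} \<le> card {c \<in> \<Omega>. cell_rank l c = i}"
    proof (rule card_inj_on_le)
      show "inj_on \<pi> {c \<in> X. \<rho> c = i}" using bij that(1) by (auto simp: bij_betw_def intro: inj_on_subset)
      show "\<pi> ` {c \<in> X. \<rho> c = i} \<subseteq> {c \<in> \<Omega>. cell_rank l c = i}"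
        using bij_betwE[OF bij] that(1) by (auto simp: \<rho>_def)
    qed (use fin in auto)
    then show ?thesis using card_cell_rank_eq[OF pos(2) that(2)] unfolding \<Omega>_def K_def of_nat_le_iff by simp
  qed
  have P3: "\<bar>\<Sum>c\<in>A. \<Sum>d\<in>B. U (cls (Z (\<rho> c))) (cls (Z (\<rho> d))) - G (\<rho> c) (\<rho> d)\<bar> \<le> \<gamma> * n\<^sup>2"
  proof -
    define E where "E i j = U (cls (Z i)) (cls (Z j)) - G i j" for i j
    have comp: "(\<Sum>c\<in>X. h (\<rho> c)) = (\<Sum>i\<in>{1..k}. real (card {c \<in> X. \<rho> c = i}) * h i)" if "X \<subseteq> \<Omega>" for X and h :: "nat \<Rightarrow> real"
      by (rule sum_fun_comp) (use that \<rho> fin(1) in \<open>auto intro: finite_subset simp del: split_paired_All\<close>)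
    have "(\<Sum>c\<in>A. \<Sum>d\<in>B. E (\<rho> c) (\<rho> d))
      = (\<Sum>i\<in>{1..k}. real (card {c \<in> A. \<rho> c = i}) * (\<Sum>j\<in>{1..k}. real (card {d \<in> B. \<rho> d = j}) * E i j))"
      unfolding comp[OF AB(2)] by (rule comp[OF AB(1)])
    also have "\<dots> = (\<Sum>i\<in>{1..k}. \<Sum>j\<in>{1..k}. real (card {c \<in> A. \<rho> c = i}) * real (card {d \<in> B. \<rho> d = j}) * E i j)"
      by (simp add: sum_distrib_left mult.assoc)
    also have "\<bar>\<dots>\<bar> \<le> K * K * (\<gamma> * (real k)\<^sup>2)"
      by (rule abs_bilinear_le_of_subsets) (use sample fib AB K in \<open>auto simp: E_def\<close>)
    also have "K * K * (\<gamma> * (real k)\<^sup>2) = \<gamma> * n\<^sup>2" by (simp add: K(2) power2_eq_square)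
    finally show ?thesis by (simp add: E_def)
  qed
  have "(\<Sum>c\<in>A. \<Sum>d\<in>B. w c d - G (\<rho> c) (\<rho> d)) = (\<Sum>c\<in>A. \<Sum>d\<in>B. w c d - U (cls c) (cls d))
     + (\<Sum>c\<in>A. \<Sum>d\<in>B. U (cls c) (cls d) - U (cls (Z (\<rho> c))) (cls (Z (\<rho> d))))
     + (\<Sum>c\<in>A. \<Sum>d\<in>B. U (cls (Z (\<rho> c))) (cls (Z (\<rho> d))) - G (\<rho> c) (\<rho> d))"
    by (simp flip: sum.distrib)
  then have "\<bar>\<Sum>c\<in>A. \<Sum>d\<in>B. w c d - G (\<rho> c) (\<rho> d)\<bar> \<le> \<epsilon> * n\<^sup>2 + 4 * b0 * \<theta> * n\<^sup>2 + \<gamma> * n\<^sup>2"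
    using reg[OF AB] P2 P3 unfolding n_def[symmetric] by linarith
  then show ?thesis by (simp add: \<rho>_def n_def algebra_simps)
qed

text \<open>A point and its image lie in the same vertical band, and a band has width at most \<open>s / k\<close>.\<close>
lemma shift_permute_cells_le:
  assumes pos: "k > 0" "l > 0" "s > 0" and bij: "bij_betw \<pi> (grid_cells (k * l)) (grid_cells (k * l))"
    and blk: "\<And>c. c \<in> grid_cells (k * l) \<Longrightarrow> rank_block s (cell_rank l (\<pi> c)) = rank_block s (cell_rank l c)"
  shows "shift (permute_cells (k * l) \<pi>) \<le> real s / real k"
  unfolding shift_def
proof (rule cSUP_least)
  show "unit_square \<noteq> {}" by (auto simp: unit_square_def)
  fix u assume u: "u \<in> unit_square"
  have M: "k * l > 0" using pos by simp
  have range: "real (j * s) / real k < fst v \<and> fst v \<le> (real (j * s) + real s) / real k"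
    if v: "v \<in> cell_region (k * l) c" "c \<in> grid_cells (k * l)" and j: "rank_block s (cell_rank l c) = j" for v c j
  proof -
    have v0: "0 < fst v" "cell_of (k * l) v = c" using mem_cell_region_iff[OF M v(2)] v(1) by auto
    have Qr: "Q k (fst v) = cell_rank l c"
      using Q_coarsen[OF pos(1,2), of "fst v"] v0 by (auto simp: cell_of_def cell_rank_def)
    define r where "r = cell_rank l c"
    have r: "r \<ge> 1" by (simp add: r_def cell_rank_def)
    have rr: "(real r - 1) / real k < fst v" "fst v \<le> real r / real k"
      using Q_eq_iff[OF pos(1) v0(1) r] Qr by (auto simp: r_def)
    have "(r - 1) div s = j" using j by (simp add: r_def rank_block_def)
    then have "j * s \<le> r - 1" "r - 1 < j * s + s"
      using pos(3) dividend_less_div_times[of s "r - 1"] by (auto simp: algebra_simps)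
    then have "real (j * s) \<le> real r - 1" "real r \<le> real (j * s) + real s"
      using r by linarith+
    then have "real (j * s) / real k \<le> (real r - 1) / real k" "real r / real k \<le> (real (j * s) + real s) / real k"
      by (auto intro: divide_right_mono)
    then show ?thesis using rr by linarith
  qed
  show "\<bar>fst u - fst (permute_cells (k * l) \<pi> u)\<bar> \<le> real s / real k"
  proof (cases "0 < fst u \<and> 0 < snd u")
    case True
    define c where "c = cell_of (k * l) u"
    have c: "u \<in> cell_region (k * l) c" "c \<in> grid_cells (k * l)"
      using in_cell_region[OF M u] True by (auto simp: c_def)
    have 1: "real (rank_block s (cell_rank l c) * s) / real k < fst u \<and> fst u \<le> (real (rank_block s (cell_rank l c) * s) + real s) / real k"
      by (rule range[OF c refl])
    have 2: "real (rank_block s (cell_rank l c) * s) / real k < fst (permute_cells (k * l) \<pi> u) \<and>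
        fst (permute_cells (k * l) \<pi> u) \<le> (real (rank_block s (cell_rank l c) * s) + real s) / real k"
    proof (rule range)
      show "permute_cells (k * l) \<pi> u \<in> cell_region (k * l) (\<pi> c)" by (rule permute_cells_region(2)[OF M c(2,1)])
      show "\<pi> c \<in> grid_cells (k * l)" using bij_betwE[OF bij] c(2) by blast
    qed (rule blk[OF c(2)])
    show ?thesis using 1 2 unfolding add_divide_distrib by linarith
  next
    case False
    then have "permute_cells (k * l) \<pi> u = u" unfolding permute_cells_def by (simp only: if_False)
    then show ?thesis by simp
  qed
qed

lemma cut_shift_dist_graph_le:
  assumes W: "W \<in> orderons" and pos: "k > 0" "l > 0" "s > 0"
    and bij: "bij_betw \<pi> (grid_cells (k * l)) (grid_cells (k * l))"
    and blk: "\<And>c. c \<in> grid_cells (k * l) \<Longrightarrow> rank_block s (cell_rank l (\<pi> c)) = rank_block s (cell_rank l c)"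
    and N: "N \<in> sets borel" "emeasure lborel N \<le> ennreal \<eta>" and \<epsilon>: "\<epsilon> \<ge> 0" "\<eta> \<ge> 0"
    and w: "\<And>c d. 0 \<le> w c d \<and> w c d \<le> 1"
      "\<And>u v. u \<in> unit_square \<Longrightarrow> v \<in> unit_square \<Longrightarrow> (u, v) \<notin> N \<Longrightarrow> \<bar>W (u, v) - w (cell_of (k * l) u) (cell_of (k * l) v)\<bar> \<le> \<epsilon>"
    and D: "\<And>A B. A \<subseteq> grid_cells (k * l) \<Longrightarrow> B \<subseteq> grid_cells (k * l) \<Longrightarrow>
      \<bar>\<Sum>c\<in>A. \<Sum>d\<in>B. w c d - of_bool (G (cell_rank l (\<pi> c)) (cell_rank l (\<pi> d)))\<bar> \<le> \<kappa> * (real (card (grid_cells (k * l))))\<^sup>2"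
  shows "cut_shift_dist W (graph_orderon k G) \<le> real s / real k + \<kappa> + \<epsilon> + \<eta>"
proof -
  have M: "k * l > 0" using pos by simp
  let ?f = "permute_cells (k * l) \<pi>"
  have W01: "0 \<le> W (u, v) \<and> W (u, v) \<le> 1" if "u \<in> unit_square" "v \<in> unit_square" for u v
    using W that by (auto simp: orderons_def)
  have "cut_shift_dist W (graph_orderon k G) \<le> shift ?f + cut_norm (\<lambda>z. W z - pullback (graph_orderon k G) ?f z)"
    by (rule cut_shift_dist_le)
       (use W01 permute_cells_mp_bijection[OF M bij] in \<open>auto simp: graph_orderon_def split: prod.split\<close>)
  also have "shift ?f \<le> real s / real k" by (rule shift_permute_cells_le[OF pos bij blk])
  also have "cut_norm (\<lambda>z. W z - pullback (graph_orderon k G) ?f z) \<le> \<kappa> + \<epsilon> + \<eta>"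
  proof (rule cut_norm_le)
    fix S T assume ST: "S \<in> sets lebesgue" "T \<in> sets lebesgue" "S \<subseteq> unit_square" "T \<subseteq> unit_square"
    show "\<bar>LINT z:S \<times> T|lebesgue. W z - pullback (graph_orderon k G) ?f z\<bar> \<le> \<kappa> + \<epsilon> + \<eta>"
    proof (rule abs_integral_cells_le[OF M ST(1,3,2,4) D N \<epsilon>])
      fix c d u v assume cd: "c \<in> grid_cells (k * l)" "d \<in> grid_cells (k * l)"
        and uv: "u \<in> cell_region (k * l) c" "v \<in> cell_region (k * l) d"
      have sq: "u \<in> unit_square" "v \<in> unit_square" using cell_region_subset[OF M] cd uv by blast+
      have cell: "cell_of (k * l) u = c" "cell_of (k * l) v = d"
        using mem_cell_region_iff[OF M cd(1)] mem_cell_region_iff[OF M cd(2)] uv by auto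
      have Qr: "Q k (fst (?f u)) = cell_rank l (\<pi> c)" if "u \<in> cell_region (k * l) c" "c \<in> grid_cells (k * l)" for u c
      proof -
        have \<pi>c: "\<pi> c \<in> grid_cells (k * l)" using bij_betwE[OF bij] that(2) by blast
        have pos': "0 < fst (?f u)" and "cell_of (k * l) (?f u) = \<pi> c"
          using permute_cells_region(2)[OF M that(2,1), of \<pi>] mem_cell_region_iff[OF M \<pi>c] by auto
        from this(2) have "Q (k * l) (fst (?f u)) = fst (\<pi> c)" unfolding cell_of_def by (metis fst_conv)
        then show ?thesis using Q_coarsen[OF pos(1,2), of "fst (?f u)"] pos' by (simp add: cell_rank_def)
      qed
      have "pullback (graph_orderon k G) ?f (u, v) = of_bool (G (cell_rank l (\<pi> c)) (cell_rank l (\<pi> d)))"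
        using Qr[OF uv(1) cd(1)] Qr[OF uv(2) cd(2)] by (simp add: pullback_def graph_orderon_def case_prod_unfold)
      then have eq: "W (u, v) - pullback (graph_orderon k G) ?f (u, v) - (w c d - of_bool (G (cell_rank l (\<pi> c)) (cell_rank l (\<pi> d)))) = W (u, v) - w c d"
        by simp
      show "\<bar>W (u, v) - pullback (graph_orderon k G) ?f (u, v) - (w c d - of_bool (G (cell_rank l (\<pi> c)) (cell_rank l (\<pi> d))))\<bar> \<le> \<epsilon> + indicator N (u, v)"
        unfolding eq
      proof (cases "(u, v) \<in> N")
        case True
        then show "\<bar>W (u, v) - w c d\<bar> \<le> \<epsilon> + indicator N (u, v)"
          using W01[OF sq] w(1)[of c d] \<epsilon>(1) by (auto simp: abs_le_iff)
      next
        case False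
        then show "\<bar>W (u, v) - w c d\<bar> \<le> \<epsilon> + indicator N (u, v)" using w(2)[OF sq False] cell by simp
      qed
    qed
  qed
  finally show ?thesis by simp
qed

section \<open>The distance for a good sample\<close>

text \<open>Cut norms and counts over all sample points are therefore the same before and after sorting.\<close>
lemma sort_perm_bij: "bij_betw (\<lambda>i. sort_perm k p ! (i - 1)) {1..k} {1..k}"
proof -
  let ?\<sigma> = "\<lambda>i. sort_perm k p ! (i - 1)"
  note L = sort_perm_props[of k p]
  have inj: "inj_on ?\<sigma> {1..k}"
  proof (rule inj_onI)
    fix i j assume *: "i \<in> {1..k}" "j \<in> {1..k}" "?\<sigma> i = ?\<sigma> j"
    then have "i - 1 < length (sort_perm k p)" "j - 1 < length (sort_perm k p)" using L(3) by auto
    then have "i - 1 = j - 1" using L(1) *(3) by (simp only: nth_eq_iff_index_eq)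
    then show "i = j" using * by auto
  qed
  moreover have "?\<sigma> ` {1..k} \<subseteq> {1..k}"
  proof
    fix x assume "x \<in> ?\<sigma> ` {1..k}"
    then obtain i where i: "i \<in> {1..k}" "x = ?\<sigma> i" by auto
    then have "i - 1 < length (sort_perm k p)" using L(3) by auto
    then show "x \<in> {1..k}" using L(2) i(2) nth_mem by metis
  qed
  ultimately have "?\<sigma> ` {1..k} = {1..k}" by (intro endo_inj_surj) auto
  with inj show ?thesis by (simp add: bij_betw_def)
qed

lemma fst_ordered_point_mono:
  assumes "i \<in> {1..k}" "j \<in> {1..k}" "i \<le> j"
  shows "fst (ordered_point k p i) \<le> fst (ordered_point k p j)"
proof -
  let ?xs = "sort_key fst (map p [1..<Suc k])"
  have "map fst ?xs ! (i - 1) \<le> map fst ?xs ! (j - 1)"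
    by (rule sorted_nth_mono) (use assms in auto)
  then show ?thesis using assms by (simp add: ordered_point_def)
qed

lemma ordered_point_in_square:
  assumes "p \<in> space (points_measure k)" "i \<in> {1..k}"
  shows "ordered_point k p i \<in> unit_square"
  using ordered_point_eq[OF assms(2)] space_points[OF assms(1)] bij_betwE[OF sort_perm_bij] assms(2) by metis

text \<open>The deterministic part: every estimate needed for the distance is an assumption about the sample points and the
edges. The assumptions on the sample points refer to the unsorted points, as they are invariant under reordering.\<close>
lemma good_sample_cut_shift_dist_le:
  fixes k l s m R :: nat and cls :: "nat \<times> nat \<Rightarrow> nat"
  defines "\<Omega> \<equiv> grid_cells (k * l)" and "blk \<equiv> \<lambda>c. rank_block s (cell_rank l c)"
  assumes W: "W \<in> orderons" and pos: "k > 0" "l > 0" "s > 0" and p: "p \<in> space (points_measure k)"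
    and cls: "\<And>c. cls c < R" and m: "(k - 1) div s < m" and U: "\<And>a b. \<bar>U a b\<bar> \<le> b0"
    and reg: "\<And>A B. A \<subseteq> \<Omega> \<Longrightarrow> B \<subseteq> \<Omega> \<Longrightarrow> \<bar>\<Sum>c\<in>A. \<Sum>d\<in>B. w c d - U (cls c) (cls d)\<bar> \<le> \<epsilon> * (real (card \<Omega>))\<^sup>2"
    and N: "N \<in> sets borel" "emeasure lborel N \<le> ennreal \<eta>" and \<epsilon>: "\<epsilon> \<ge> 0" "\<eta> \<ge> 0"
    and w: "\<And>c d. 0 \<le> w c d \<and> w c d \<le> 1"
      "\<And>u v. u \<in> unit_square \<Longrightarrow> v \<in> unit_square \<Longrightarrow> (u, v) \<notin> N \<Longrightarrow> \<bar>W (u, v) - w (cell_of (k * l) u) (cell_of (k * l) v)\<bar> \<le> \<epsilon>"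
    and avoid: "\<And>i j. i \<in> {1..k} \<Longrightarrow> j \<in> {1..k} \<Longrightarrow> i \<noteq> j \<Longrightarrow> (p i, p j) \<notin> N"
    and cut: "\<And>S T. S \<subseteq> {1..k} \<Longrightarrow> T \<subseteq> {1..k} \<Longrightarrow>
      \<bar>\<Sum>i\<in>S. \<Sum>j\<in>T. w (cell_of (k * l) (p i)) (cell_of (k * l) (p j)) - U (cls (cell_of (k * l) (p i))) (cls (cell_of (k * l) (p j)))\<bar> \<le> \<delta> * (real k)\<^sup>2"
    and counts: "\<And>y. y \<in> {..<m} \<times> {..<R} \<Longrightarrow>
      \<bar>real (card {i \<in> {1..k}. (blk (cell_of (k * l) (p i)), cls (cell_of (k * l) (p i))) = y}) - real k * (real (card {c \<in> \<Omega>. (blk c, cls c) = y}) / real (card \<Omega>))\<bar> \<le> real k * \<tau>"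
    and edges: "\<And>S T. S \<subseteq> {1..k} \<Longrightarrow> T \<subseteq> {1..k} \<Longrightarrow>
      \<bar>\<Sum>i\<in>S. \<Sum>j\<in>T. of_bool (G i j) - W (ordered_point k p i, ordered_point k p j)\<bar> \<le> (real k)\<^sup>2 * \<epsilon> + real k"
  shows "cut_shift_dist W (graph_orderon k G) \<le>
    real s / real k + 4 * b0 * (real m * real R * \<tau> * (1 + 2 * real m)) + \<delta> + 4 * \<epsilon> + 2 / real k + \<eta>"
proof -
  let ?I = "{1..k}" and ?M = "k * l"
  define \<sigma> where "\<sigma> i = sort_perm k p ! (i - 1)" for i
  have \<sigma>: "bij_betw \<sigma> ?I ?I" using sort_perm_bij[of k p] by (simp add: \<sigma>_def[abs_def])
  define q where "q = ordered_point k p"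
  have q: "q i = p (\<sigma> i)" "q i \<in> unit_square" if "i \<in> ?I" for i
    using ordered_point_eq[OF that, of p] ordered_point_in_square[OF p that] by (auto simp: q_def \<sigma>_def)
  have M: "?M > 0" using pos by simp
  define Z where "Z i = cell_of ?M (q i)" for i
  have Z: "Z i \<in> \<Omega>" if "i \<in> ?I" for i
    unfolding Z_def \<Omega>_def by (rule cell_of_in_grid[OF M q(2)[OF that]])
  have Zmono: "fst (Z i) \<le> fst (Z j)" if "i \<in> ?I" "j \<in> ?I" "i \<le> j" for i j
    unfolding Z_def cell_of_def fst_conv
  proof (rule mono_Q)
    show "0 \<le> fst (q i)" using q(2)[OF that(1)] by (auto simp: unit_square_def)
    show "fst (q i) \<le> fst (q j)" using fst_ordered_point_mono[OF that] by (simp add: q_def)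
  qed (rule M)
  have Zcounts: "\<bar>real (card {i \<in> ?I. (blk (Z i), cls (Z i)) = y}) - real k * (real (card {c \<in> \<Omega>. (blk c, cls c) = y}) / real (card \<Omega>))\<bar> \<le> real k * \<tau>"
    if "y \<in> {..<m} \<times> {..<R}" for y
  proof -
    have "bij_betw \<sigma> {i \<in> ?I. (blk (Z i), cls (Z i)) = y} {i \<in> ?I. (blk (cell_of ?M (p i)), cls (cell_of ?M (p i))) = y}"
    proof (rule bij_betw_subset[OF \<sigma>])
      show "\<sigma> ` {i \<in> ?I. (blk (Z i), cls (Z i)) = y} = {i \<in> ?I. (blk (cell_of ?M (p i)), cls (cell_of ?M (p i))) = y}"
      proof (intro equalityI subsetI)
        fix i assume "i \<in> \<sigma> ` {i \<in> ?I. (blk (Z i), cls (Z i)) = y}"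
        then obtain i0 where "i0 \<in> ?I" "(blk (Z i0), cls (Z i0)) = y" "i = \<sigma> i0" by blast
        then show "i \<in> {i \<in> ?I. (blk (cell_of ?M (p i)), cls (cell_of ?M (p i))) = y}"
          using q(1)[of i0] bij_betwE[OF \<sigma>] by (simp add: Z_def del: atLeastAtMost_iff)
      next
        fix i assume i: "i \<in> {i \<in> ?I. (blk (cell_of ?M (p i)), cls (cell_of ?M (p i))) = y}"
        then obtain i0 where "i0 \<in> ?I" "i = \<sigma> i0" using \<sigma> by (auto simp: bij_betw_def simp del: atLeastAtMost_iff)
        then show "i \<in> \<sigma> ` {i \<in> ?I. (blk (Z i), cls (Z i)) = y}"
          using q(1)[of i0] i by (intro image_eqI[of _ _ i0]) (simp_all add: Z_def del: atLeastAtMost_iff)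
      qed
    qed auto
    then have "card {i \<in> ?I. (blk (Z i), cls (Z i)) = y} = card {i \<in> ?I. (blk (cell_of ?M (p i)), cls (cell_of ?M (p i))) = y}"
      by (rule bij_betw_same_card)
    then show ?thesis using counts[OF that] by simp
  qed
  obtain \<pi> where \<pi>: "bij_betw \<pi> \<Omega> \<Omega>" "\<And>c. c \<in> \<Omega> \<Longrightarrow> blk (\<pi> c) = blk c"
    "real (card {c \<in> \<Omega>. cls c \<noteq> cls (Z (cell_rank l (\<pi> c)))}) \<le> real (card \<Omega>) * (real m * real R * \<tau> * (1 + 2 * real m))"
    unfolding \<Omega>_def blk_def
    by (rule aligning_permutation[OF pos, where Z=Z and cls=cls and R=R and m=m and \<tau>=\<tau>])
       (use Z Zmono cls m Zcounts in \<open>auto simp: \<Omega>_def blk_def\<close>)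
  define \<gamma> where "\<gamma> = \<delta> + 2 * \<epsilon> + 2 / real k"
  have sample: "\<bar>\<Sum>i\<in>S. \<Sum>j\<in>T. U (cls (Z i)) (cls (Z j)) - of_bool (G i j)\<bar> \<le> \<gamma> * (real k)\<^sup>2"
    if ST: "S \<subseteq> ?I" "T \<subseteq> ?I" for S T
  proof -
    have fin: "finite S" "finite T" using ST finite_subset by auto
    have 1: "\<bar>\<Sum>i\<in>S. \<Sum>j\<in>T. w (Z i) (Z j) - U (cls (Z i)) (cls (Z j))\<bar> \<le> \<delta> * (real k)\<^sup>2"
    proof -
      define h where "h i j = w (cell_of ?M (p i)) (cell_of ?M (p j)) - U (cls (cell_of ?M (p i))) (cls (cell_of ?M (p j)))" for i j
      have inj: "inj_on \<sigma> S" "inj_on \<sigma> T" and sub: "\<sigma> ` S \<subseteq> ?I" "\<sigma> ` T \<subseteq> ?I"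
        using \<sigma> ST by (auto simp: bij_betw_def intro: inj_on_subset simp del: atLeastAtMost_iff)
      have "(\<Sum>i\<in>S. \<Sum>j\<in>T. w (Z i) (Z j) - U (cls (Z i)) (cls (Z j))) = (\<Sum>i\<in>S. \<Sum>j\<in>T. h (\<sigma> i) (\<sigma> j))"
      proof (intro sum.cong refl)
        fix i j assume "i \<in> S" "j \<in> T"
        then have "i \<in> ?I" "j \<in> ?I" using ST by auto
        then show "w (Z i) (Z j) - U (cls (Z i)) (cls (Z j)) = h (\<sigma> i) (\<sigma> j)" using q(1) by (simp add: Z_def h_def)
      qed
      also have "\<dots> = (\<Sum>i\<in>\<sigma> ` S. \<Sum>j\<in>\<sigma> ` T. h i j)" by (simp add: sum.reindex inj)
      finally show ?thesis using cut[OF sub] by (simp add: h_def)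
    qed
    have 2: "\<bar>\<Sum>i\<in>S. \<Sum>j\<in>T. W (q i, q j) - w (Z i) (Z j)\<bar> \<le> \<epsilon> * (real k)\<^sup>2 + real k"
    proof -
      have "\<bar>\<Sum>i\<in>S. \<Sum>j\<in>T. W (q i, q j) - w (Z i) (Z j)\<bar> \<le> (\<Sum>i\<in>S. \<Sum>j\<in>T. \<bar>W (q i, q j) - w (Z i) (Z j)\<bar>)"
        by (intro order_trans[OF sum_abs] sum_mono sum_abs)
      also have "\<dots> \<le> (\<Sum>i\<in>?I. \<Sum>j\<in>?I. \<bar>W (q i, q j) - w (Z i) (Z j)\<bar>)"
        by (intro order_trans[OF sum_mono sum_mono2] sum_mono2) (use ST in \<open>auto intro: sum_nonneg\<close>)
      also have "\<dots> \<le> (\<Sum>i\<in>?I. \<Sum>j\<in>?I. \<epsilon> + (if j = i then 1 else 0))"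
      proof (intro sum_mono)
        fix i j assume ij: "i \<in> ?I" "j \<in> ?I"
        show "\<bar>W (q i, q j) - w (Z i) (Z j)\<bar> \<le> \<epsilon> + (if j = i then 1 else 0)"
        proof (cases "i = j")
          case True
          have "0 \<le> W (q i, q j) \<and> W (q i, q j) \<le> 1" using W q(2)[OF ij(1)] q(2)[OF ij(2)] by (auto simp: orderons_def)
          then show ?thesis using w(1)[of "Z i" "Z j"] True \<epsilon> by (auto simp: abs_le_iff)
        next
          case False
          then have "\<sigma> i \<noteq> \<sigma> j" using \<sigma> ij by (auto simp: bij_betw_def inj_on_def simp del: atLeastAtMost_iff)
          then have "(q i, q j) \<notin> N" using avoid[of "\<sigma> i" "\<sigma> j"] bij_betwE[OF \<sigma>] ij q(1) by simp
          then show ?thesis using w(2)[OF q(2)[OF ij(1)] q(2)[OF ij(2)]] False by (simp add: Z_def)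
        qed
      qed
      also have "\<dots> = \<epsilon> * (real k)\<^sup>2 + real k" by (simp add: sum.distrib power2_eq_square algebra_simps)
      finally show ?thesis .
    qed
    have 3: "\<bar>\<Sum>i\<in>S. \<Sum>j\<in>T. of_bool (G i j) - W (q i, q j)\<bar> \<le> (real k)\<^sup>2 * \<epsilon> + real k"
      using edges[OF ST] by (simp add: q_def)
    have "(\<Sum>i\<in>S. \<Sum>j\<in>T. U (cls (Z i)) (cls (Z j)) - of_bool (G i j))
      = - (\<Sum>i\<in>S. \<Sum>j\<in>T. w (Z i) (Z j) - U (cls (Z i)) (cls (Z j)))
        - (\<Sum>i\<in>S. \<Sum>j\<in>T. W (q i, q j) - w (Z i) (Z j)) - (\<Sum>i\<in>S. \<Sum>j\<in>T. of_bool (G i j) - W (q i, q j))"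
      by (simp add: sum_subtractf)
    then have "\<bar>\<Sum>i\<in>S. \<Sum>j\<in>T. U (cls (Z i)) (cls (Z j)) - of_bool (G i j)\<bar>
       \<le> \<delta> * (real k)\<^sup>2 + (\<epsilon> * (real k)\<^sup>2 + real k) + ((real k)\<^sup>2 * \<epsilon> + real k)"
      using 1 2 3 by linarith
    also have "\<dots> = \<gamma> * (real k)\<^sup>2" using pos by (simp add: \<gamma>_def algebra_simps power2_eq_square)
    finally show ?thesis .
  qed
  have "cut_shift_dist W (graph_orderon k G) \<le> real s / real k + (\<epsilon> + 4 * b0 * (real m * real R * \<tau> * (1 + 2 * real m)) + \<gamma>) + \<epsilon> + \<eta>"
  proof (rule cut_shift_dist_graph_le[OF W pos _ _ N \<epsilon> w])
    show "bij_betw \<pi> (grid_cells ?M) (grid_cells ?M)" using \<pi>(1) by (simp add: \<Omega>_def)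
    show "rank_block s (cell_rank l (\<pi> c)) = rank_block s (cell_rank l c)" if "c \<in> grid_cells ?M" for c
      using \<pi>(2)[of c] that by (simp add: \<Omega>_def blk_def)
    show "\<bar>\<Sum>c\<in>A. \<Sum>d\<in>B. w c d - of_bool (G (cell_rank l (\<pi> c)) (cell_rank l (\<pi> d)))\<bar>
        \<le> (\<epsilon> + 4 * b0 * (real m * real R * \<tau> * (1 + 2 * real m)) + \<gamma>) * (real (card (grid_cells ?M)))\<^sup>2"
      if "A \<subseteq> grid_cells ?M" "B \<subseteq> grid_cells ?M" for A B
      by (rule aligned_cut_bound[where Z=Z and cls=cls and U=U and G="\<lambda>i j. of_bool (G i j)", OF pos(1,2)])
         (use \<pi>(1,3) U reg sample that in \<open>auto simp: \<Omega>_def\<close>)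
  qed
  then show ?thesis by (simp add: \<gamma>_def)
qed

section \<open>The probability of a bad sample\<close>

text \<open>The bridge between normalised sums over cells, as in the regularity lemma, and expectations, as in the
sampling lemma.\<close>
lemma expectation_pmf_of_set_cut:
  assumes "finite \<Omega>" "\<Omega> \<noteq> {}"
  shows "measure_pmf.expectation (pmf_of_set \<Omega>) (\<lambda>x. indicator S x *
      measure_pmf.expectation (pmf_of_set \<Omega>) (\<lambda>y. indicator T y * V x y))
    = (\<Sum>x\<in>\<Omega> \<inter> S. \<Sum>y\<in>\<Omega> \<inter> T. V x y) / (real (card \<Omega>))\<^sup>2"
proof -
  have ind: "(\<Sum>x\<in>\<Omega>. indicator S x * f x) = (\<Sum>x\<in>\<Omega> \<inter> S. f x)" for S and f :: "'a \<Rightarrow> real"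
    using assms by (intro sum.mono_neutral_cong_right) (auto simp: indicator_def)
  have inner: "measure_pmf.expectation (pmf_of_set \<Omega>) (\<lambda>y. indicator T y * V x y) = (\<Sum>y\<in>\<Omega> \<inter> T. V x y) / real (card \<Omega>)" for x
    using assms by (simp add: integral_pmf_of_set ind)
  show ?thesis
    unfolding inner using assms by (simp add: integral_pmf_of_set ind power2_eq_square flip: sum_divide_distrib)
qed

text \<open>The four terms of the probability are the failures of the cut norm estimate for the sample, of the type counts,
of the avoidance of the exceptional set \<open>N\<close> by all pairs of sample points, and of the estimate for the edges. The grid is fixed only inside
the proof, since its fineness depends on \<open>W\<close>; no bound involves it.\<close>
lemma random_graph_far_prob_le:
  fixes k r s m q :: nat and \<epsilon> \<tau> \<eta> :: real
  assumes W: "W \<in> orderons" and pos: "k > 0" "s > 0" "q > 0" and \<epsilon>: "\<epsilon> > 0" and r: "real r * \<epsilon>\<^sup>2 > 1"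
    and m: "(k - 1) div s < m" and \<tau>: "\<tau> \<ge> 0" and \<eta>: "\<eta> > 0"
  defines "b0 \<equiv> real r * \<epsilon>"
  defines "bound \<equiv> real s / real k + 4 * b0 * (real m * 4 ^ r * \<tau> * (1 + 2 * real m))
    + (3 * \<epsilon> + 4 * (1 + b0) / sqrt (real q) + 8 * (1 + b0) * real q / real k) + 4 * \<epsilon> + 2 / real k + \<eta>"
  shows "measure (random_graph k W) {G. \<not> cut_shift_dist W (graph_orderon k G) \<le> bound} \<le>
      8 * (real k + 1) ^ (2 * q) * exp (- (real k * \<epsilon>\<^sup>2 / (2 * (1 + b0)\<^sup>2)))
      + 2 * (real m * 4 ^ r) * exp (- (real k * \<tau>\<^sup>2 / 2)) + (real k)\<^sup>2 * \<eta>
      + 2 * 4 ^ k * exp (- ((real k)\<^sup>2 * \<epsilon>\<^sup>2 / 8))"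
proof -
  obtain N M0 where N: "N \<in> sets borel" "emeasure lborel N \<le> ennreal \<eta>"
    and approx: "\<And>M. M \<ge> M0 \<Longrightarrow> M > 0 \<Longrightarrow> \<exists>w. (\<forall>c d. 0 \<le> w c d \<and> w c d \<le> (1::real)) \<and>
       (\<forall>u\<in>unit_square. \<forall>v\<in>unit_square. (u, v) \<notin> N \<longrightarrow> \<bar>W (u, v) - w (cell_of M u) (cell_of M v)\<bar> \<le> \<epsilon>)"
    using orderon_grid_approximation[OF W \<epsilon> \<eta>] by metis
  define l where "l = M0 + 1"
  define M where "M = k * l"
  have "1 * l \<le> k * l" using pos by (intro mult_le_mono1) auto
  then have l: "l > 0" and M: "M > 0" "M \<ge> M0" using pos by (auto simp: l_def M_def)
  obtain w where w: "\<And>c d. 0 \<le> w c d \<and> w c d \<le> (1::real)"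
    "\<And>u v. u \<in> unit_square \<Longrightarrow> v \<in> unit_square \<Longrightarrow> (u, v) \<notin> N \<Longrightarrow> \<bar>W (u, v) - w (cell_of M u) (cell_of M v)\<bar> \<le> \<epsilon>"
    using approx[OF M(2,1)] by blast
  define \<Omega> where "\<Omega> = grid_cells M"
  have \<Omega>: "finite \<Omega>" "\<Omega> \<noteq> {}" using M by (auto simp: \<Omega>_def grid_cells_def)
  then have n: "real (card \<Omega>) > 0" by (simp add: card_gt_0_iff)
  have w1: "\<bar>w c d\<bar> \<le> 1" if "c \<in> \<Omega>" "d \<in> \<Omega>" for c d using w(1)[of c d] by auto
  obtain cls :: "nat \<times> nat \<Rightarrow> nat" and U where cls: "\<And>c. cls c < 4 ^ r" and U': "\<And>a b. \<bar>U a b\<bar> \<le> real r * \<epsilon>"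
    and reg: "\<And>A B. A \<subseteq> \<Omega> \<Longrightarrow> B \<subseteq> \<Omega> \<Longrightarrow> \<bar>\<Sum>c\<in>A. \<Sum>d\<in>B. w c d - U (cls c) (cls d)\<bar> \<le> \<epsilon> * (real (card \<Omega>))\<^sup>2"
    by (rule weak_regularity[where w=w, OF \<Omega>(1) w1 \<epsilon> r]) (assumption, assumption, rule that)
  have U: "\<bar>U a b\<bar> \<le> b0" for a b unfolding b0_def by (rule U')
  define V where "V c d = w c d - U (cls c) (cls d)" for c d
  define B where "B = 1 + b0"
  have b0: "b0 \<ge> 0" using \<epsilon> by (simp add: b0_def)
  have B: "B > 0" using b0 by (simp add: B_def)
  have V: "\<bar>V c d\<bar> \<le> B" for c d using w(1)[of c d] U[of "cls c" "cls d"] by (auto simp: V_def B_def abs_le_iff)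
  define D where "D = pmf_of_set \<Omega>"
  define PX where "PX = Pi_pmf {1..k} (0, 0) (\<lambda>_. D)"
  define \<delta> where "\<delta> = 3 * \<epsilon> + 4 * B / sqrt (real q) + 8 * B * real q / real k"
  define ty where "ty c = (rank_block s (cell_rank l c), cls c)" for c
  define Ty where "Ty = {..<m} \<times> {..<(4 ^ r :: nat)}"
  define X1 where "X1 = {x. \<exists>S\<subseteq>{1..k}. \<exists>T\<subseteq>{1..k}. \<delta> * (real k)\<^sup>2 < \<bar>\<Sum>i\<in>S. \<Sum>j\<in>T. V (x i) (x j)\<bar>}"
  define X2 where "X2 = {x. \<exists>y\<in>Ty. real k * \<tau> \<le> \<bar>real (card {i\<in>{1..k}. ty (x i) = y}) - real k * (real (card {c\<in>\<Omega>. ty c = y}) / real (card \<Omega>))\<bar>}"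
  have X1: "measure_pmf.prob PX X1 \<le> 8 * (real k + 1) ^ (2 * q) * exp (- (real k * \<epsilon>\<^sup>2 / (2 * B\<^sup>2)))"
  proof -
    have eq: "(real k)\<^sup>2 * (\<epsilon> + 2 * \<epsilon> + 4 * B / sqrt (real q)) + 8 * B * real q * real k = \<delta> * (real k)\<^sup>2"
      using pos by (simp add: \<delta>_def field_simps power2_eq_square)
    have cut: "\<bar>measure_pmf.expectation D (\<lambda>x. indicator S x * measure_pmf.expectation D (\<lambda>y. indicator T y * V x y))\<bar> \<le> \<epsilon>" for S T
    proof -
      have "\<bar>\<Sum>x\<in>\<Omega> \<inter> S. \<Sum>y\<in>\<Omega> \<inter> T. V x y\<bar> \<le> \<epsilon> * (real (card \<Omega>))\<^sup>2"
        unfolding V_def by (rule reg) auto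
      then show ?thesis unfolding D_def expectation_pmf_of_set_cut[OF \<Omega>] using n by (simp add: abs_divide pos_divide_le_eq)
    qed
    show ?thesis
      using sampled_cut_abs_le[of "{1..k}" V B D \<epsilon> "real k" \<epsilon> q "(0, 0)"] V B cut pos \<epsilon>
      unfolding eq X1_def PX_def by simp
  qed
  have X2: "measure_pmf.prob PX X2 \<le> 2 * (real m * 4 ^ r) * exp (- (real k * \<tau>\<^sup>2 / 2))"
  proof -
    have "measure_pmf.prob D {c. ty c = y} = real (card {c\<in>\<Omega>. ty c = y}) / real (card \<Omega>)" for y
      unfolding D_def using \<Omega> by (simp add: measure_pmf_of_set Int_def)
    moreover have "real (card Ty) = real m * 4 ^ r" by (simp add: Ty_def)
    ultimately show ?thesis
      using sampled_type_counts[of "{1..k}" Ty "real k" \<tau> "(0, 0)" D ty] pos \<tau>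
      unfolding X2_def PX_def by (simp add: Ty_def)
  qed
  define FG where "FG = {G. \<not> cut_shift_dist W (graph_orderon k G) \<le> bound}"
  define eE where "eE = 2 * 4 ^ k * exp (- ((real k)\<^sup>2 * \<epsilon>\<^sup>2 / 8))"
  let ?P = "points_measure k"
  define P1 where "P1 = {p \<in> space ?P. cells_of_points k M p \<in> X1 \<union> X2}"
  define P2 where "P2 = (\<Union>(i, j)\<in>{(i, j) \<in> {1..k} \<times> {1..k}. i \<noteq> j}. {p \<in> space ?P. (p i, p j) \<in> N})"
  have edges: "emeasure (measure_pmf (random_edges k W (ordered_point k p))) FG \<le> ennreal eE"
    if p: "p \<in> space ?P" "p \<notin> P1" "p \<notin> P2" for p
  proof -
    let ?q = "ordered_point k p"
    have q: "?q i \<in> unit_square" if "i \<in> {1..k}" for i by (rule ordered_point_in_square[OF p(1) that])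
    have cells: "cells_of_points k M p i = cell_of M (p i)" if "i \<in> {1..k}" for i using that by (simp add: cells_of_points_def)
    have nX1: "\<bar>\<Sum>i\<in>S. \<Sum>j\<in>T. w (cell_of M (p i)) (cell_of M (p j)) - U (cls (cell_of M (p i))) (cls (cell_of M (p j)))\<bar> \<le> \<delta> * (real k)\<^sup>2"
      if ST: "S \<subseteq> {1..k}" "T \<subseteq> {1..k}" for S T
    proof -
      have "\<bar>\<Sum>i\<in>S. \<Sum>j\<in>T. V (cells_of_points k M p i) (cells_of_points k M p j)\<bar> \<le> \<delta> * (real k)\<^sup>2"
        using p(1,2) ST unfolding P1_def X1_def by (auto simp: not_less)
      moreover have "(\<Sum>i\<in>S. \<Sum>j\<in>T. V (cells_of_points k M p i) (cells_of_points k M p j))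
         = (\<Sum>i\<in>S. \<Sum>j\<in>T. w (cell_of M (p i)) (cell_of M (p j)) - U (cls (cell_of M (p i))) (cls (cell_of M (p j))))"
        by (intro sum.cong refl) (use ST cells in \<open>auto simp: V_def subset_iff\<close>)
      ultimately show ?thesis by simp
    qed
    have nX2: "\<bar>real (card {i\<in>{1..k}. ty (cell_of M (p i)) = y}) - real k * (real (card {c\<in>\<Omega>. ty c = y}) / real (card \<Omega>))\<bar> \<le> real k * \<tau>"
      if "y \<in> Ty" for y
    proof -
      have "{i\<in>{1..k}. ty (cells_of_points k M p i) = y} = {i\<in>{1..k}. ty (cell_of M (p i)) = y}" using cells by auto
      then show ?thesis using p(1,2) that unfolding P1_def X2_def by (auto simp: not_le less_imp_le)
    qed
    have avoid: "(p i, p j) \<notin> N" if "i \<in> {1..k}" "j \<in> {1..k}" "i \<noteq> j" for i j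
      using p(1,3) that unfolding P2_def by blast
    define EG where "EG = {G. \<exists>S\<subseteq>{1..k}. \<exists>T\<subseteq>{1..k}. (real k)\<^sup>2 * \<epsilon> + real k \<le> \<bar>\<Sum>i\<in>S. \<Sum>j\<in>T. of_bool (G i j) - W (?q i, ?q j)\<bar>}"
    have sub: "FG \<subseteq> EG"
    proof (rule subsetI, rule ccontr)
      fix G assume G: "G \<in> FG" "G \<notin> EG"
      have eG: "\<bar>\<Sum>i\<in>S. \<Sum>j\<in>T. of_bool (G i j) - W (?q i, ?q j)\<bar> \<le> (real k)\<^sup>2 * \<epsilon> + real k"
        if "S \<subseteq> {1..k}" "T \<subseteq> {1..k}" for S T
        using G(2) that unfolding EG_def by (auto simp: not_le less_imp_le)
      have "cut_shift_dist W (graph_orderon k G) \<le> real s / real k + 4 * b0 * (real m * real (4 ^ r) * \<tau> * (1 + 2 * real m)) + \<delta> + 4 * \<epsilon> + 2 / real k + \<eta>"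
        by (rule good_sample_cut_shift_dist_le[OF W pos(1) l pos(2) p(1) cls m U reg[unfolded \<Omega>_def M_def] N less_imp_le[OF \<epsilon>] less_imp_le[OF \<eta>]
            w(1) w(2)[unfolded M_def] avoid nX1[unfolded M_def] nX2[unfolded M_def \<Omega>_def ty_def Ty_def] eG]) auto
      also have "\<dots> = bound" by (simp add: bound_def \<delta>_def B_def)
      finally show False using G(1) by (simp add: FG_def)
    qed
    have "measure_pmf.prob (random_edges k W ?q) FG \<le> measure_pmf.prob (random_edges k W ?q) EG"
      by (rule measure_pmf.finite_measure_mono[OF sub]) simp
    also have "\<dots> \<le> eE"
      unfolding EG_def eE_def
      by (rule random_edges_cut_le) (use W q pos \<epsilon> in \<open>auto simp: orderons_def\<close>)
    finally show ?thesis by (simp add: measure_pmf.emeasure_eq_measure ennreal_leI)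
  qed
  have P1m: "P1 \<in> sets ?P" "emeasure ?P P1 = emeasure (measure_pmf PX) (X1 \<union> X2)"
    unfolding P1_def PX_def D_def \<Omega>_def using cells_of_points_distribution[OF M(1), of k "X1 \<union> X2"] by auto
  have P2m: "P2 \<in> sets ?P" "emeasure ?P P2 \<le> ennreal ((real k)\<^sup>2 * \<eta>)"
  proof -
    let ?J = "{(i, j) \<in> {1..k} \<times> {1..k}. i \<noteq> j}"
    have finJ: "finite ?J" by (rule finite_subset[of _ "{1..k} \<times> {1..k}"]) auto
    have J: "card ?J \<le> k * k"
    proof -
      have "card ?J \<le> card ({1..k} \<times> {1..k})" by (rule card_mono) auto
      then show ?thesis by simp
    qed
    have N': "N \<in> sets (borel \<Otimes>\<^sub>M borel)" using N(1) by (subst borel_prod) simp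
    have meas: "{p \<in> space ?P. (p i, p j) \<in> N} \<in> sets ?P" for i j
      using measurable_sets[OF measurable_point_pair N'] by (simp add: vimage_def Int_def conj_commute)
    show "P2 \<in> sets ?P" unfolding P2_def using meas finJ by (intro sets.finite_UN) auto
    have "emeasure ?P P2 \<le> (\<Sum>ij\<in>?J. emeasure ?P {p \<in> space ?P. (p (fst ij), p (snd ij)) \<in> N})"
      unfolding P2_def case_prod_unfold by (rule emeasure_subadditive_finite) (use meas finJ in auto)
    also have "\<dots> \<le> (\<Sum>ij\<in>?J. ennreal \<eta>)"
    proof (rule sum_mono)
      fix ij assume "ij \<in> ?J"
      then have "emeasure ?P {p \<in> space ?P. (p (fst ij), p (snd ij)) \<in> N} \<le> emeasure lborel N"
        by (intro emeasure_point_pair_le[OF _ _ _ N(1)]) auto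
      then show "emeasure ?P {p \<in> space ?P. (p (fst ij), p (snd ij)) \<in> N} \<le> ennreal \<eta>" using N(2) by (rule order_trans)
    qed
    also have "\<dots> = ennreal (real (card ?J) * \<eta>)" using \<eta> by (simp add: ennreal_mult ennreal_of_nat_eq_real_of_nat)
    also have "\<dots> \<le> ennreal ((real k)\<^sup>2 * \<eta>)"
    proof (intro ennreal_leI mult_right_mono)
      have "real (card ?J) \<le> real (k * k)" using J by (simp only: of_nat_le_iff)
      then show "real (card ?J) \<le> (real k)\<^sup>2" by (simp only: of_nat_mult power2_eq_square)
    qed (use \<eta> in simp)
    finally show "emeasure ?P P2 \<le> ennreal ((real k)\<^sup>2 * \<eta>)" .
  qed
  interpret RG: prob_space "random_graph k W" by (rule random_graph_prob_space(1)[OF W])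
  interpret PP: prob_space ?P by (rule prob_space_points)
  have "emeasure (random_graph k W) FG = (\<integral>\<^sup>+p. emeasure (measure_pmf (random_edges k W (ordered_point k p))) FG \<partial>completion ?P)"
    using random_graph_prob_space(4)[OF W] by (simp add: sample_points_def)
  also have "\<dots> \<le> (\<integral>\<^sup>+p. indicator P1 p + (indicator P2 p + ennreal eE) \<partial>completion ?P)"
  proof (rule nn_integral_mono)
    fix p assume p: "p \<in> space (completion ?P)"
    have one: "emeasure (measure_pmf (random_edges k W (ordered_point k p))) FG \<le> 1"
      by (simp add: measure_pmf.emeasure_le_1)
    show "emeasure (measure_pmf (random_edges k W (ordered_point k p))) FG \<le> indicator P1 p + (indicator P2 p + ennreal eE)"
    proof (cases "p \<in> P1 \<union> P2")
      case True
      then have "1 \<le> indicator P1 p + (indicator P2 p + ennreal eE)" by (auto simp: add_increasing2 add_increasing)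
      then show ?thesis using one by (rule order_trans[rotated])
    qed (use edges[of p] p in auto)
  qed
  also have "\<dots> = (\<integral>\<^sup>+p. indicator P1 p + (indicator P2 p + ennreal eE) \<partial>?P)" by (rule nn_integral_completion)
  also have "\<dots> = emeasure ?P P1 + (emeasure ?P P2 + ennreal eE)"
    using P1m(1) P2m(1) by (simp add: nn_integral_add PP.emeasure_space_1 del: One_nat_def)
  also have "\<dots> \<le> ennreal (measure_pmf.prob PX X1 + measure_pmf.prob PX X2) + (ennreal ((real k)\<^sup>2 * \<eta>) + ennreal eE)"
  proof (intro add_mono P2m(2) order_refl)
    show "emeasure ?P P1 \<le> ennreal (measure_pmf.prob PX X1 + measure_pmf.prob PX X2)"
      unfolding P1m(2) measure_pmf.emeasure_eq_measure by (intro ennreal_leI measure_Un_le) auto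
  qed
  also have "\<dots> = ennreal (measure_pmf.prob PX X1 + measure_pmf.prob PX X2 + ((real k)\<^sup>2 * \<eta> + eE))"
    using \<eta> by (simp add: eE_def ennreal_plus[symmetric] del: ennreal_plus)
  finally have "measure (random_graph k W) FG \<le> measure_pmf.prob PX X1 + measure_pmf.prob PX X2 + ((real k)\<^sup>2 * \<eta> + eE)"
    using \<eta> by (subst (asm) RG.emeasure_eq_measure, subst (asm) ennreal_le_iff) (auto simp: eE_def intro!: add_nonneg_nonneg)
  then show ?thesis using X1 X2 unfolding FG_def[symmetric] eE_def B_def by linarith
qed

section \<open>Choice of the parameters\<close>

text \<open>The distance bound of \<open>random_graph_far_prob_le\<close> for \<open>\<epsilon> = ln x powr (-1/3)\<close>, block length \<open>\<epsilon> x\<close>, list length \<open>(ln x)\<^sup>2\<close>,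
\<open>\<tau> = x powr (-1/8)\<close> and \<open>\<eta> = exp (- sqrt x) / x\<^sup>2\<close>. The terms that are constant multiples of \<open>\<epsilon>\<close> add up to
\<open>8 * \<epsilon>\<close>, and all others are of smaller order.\<close>
lemma eventually_distance_bound:
  "\<forall>\<^sub>F x :: real in at_top. (ln x powr (-1/3) + 1 / x)
     + 4 * (3 * ln x powr (1/3)) * ((ln x powr (1/3) + 1) * 4 powr (ln x powr (2/3) + 2) * x powr (-1/8) * (1 + 2 * (ln x powr (1/3) + 1)))
     + (3 * ln x powr (-1/3) + 4 * (1 + 3 * ln x powr (1/3)) / ln x + 8 * (1 + 3 * ln x powr (1/3)) * ((ln x)\<^sup>2 + 2) / x)
     + 4 * ln x powr (-1/3) + 2 / x + exp (- sqrt x) / x\<^sup>2 \<le> 9 * ln x powr (-1/3)"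
  by real_asymp

text \<open>With the same parameters, the exponents in these three terms are \<open>- x\<close>, \<open>- x powr (3/4)\<close> and \<open>- x\<^sup>2\<close> up to powers of \<open>ln x\<close>.\<close>
lemma eventually_probability_bounds:
  "\<forall>\<^sub>F x :: real in at_top. 8 * (x + 1) powr (2 * ((ln x)\<^sup>2 + 2)) * exp (- (x * (ln x powr (-1/3))\<^sup>2 / (2 * (1 + 3 * ln x powr (1/3))\<^sup>2))) \<le> exp (- sqrt x)"
  "\<forall>\<^sub>F x :: real in at_top. 2 * ((ln x powr (1/3) + 1) * 4 powr (ln x powr (2/3) + 2)) * exp (- (x * (x powr (-1/8))\<^sup>2 / 2)) \<le> exp (- sqrt x)"
  "\<forall>\<^sub>F x :: real in at_top. 2 * 4 powr x * exp (- (x\<^sup>2 * (ln x powr (-1/3))\<^sup>2 / 8)) \<le> exp (- sqrt x)"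
  by real_asymp+


text \<open>The parameters are those of the two preceding lemmas, rounded to integers where necessary. In the proof,
\<open>K\<close> is \<open>1 / \<epsilon>\<close>, and the number of regularity steps is the least integer above \<open>K * K\<close>.\<close>
lemma random_graph_close_large:
  "\<exists>k0. \<forall>k\<ge>k0. \<forall>W\<in>orderons.
     measure (random_graph k W) {G. \<not> cut_shift_dist W (graph_orderon k G) \<le> 9 * ln (real k) powr (-1/3)} \<le> 4 * exp (- sqrt (real k))"
proof -
  have "\<forall>\<^sub>F x :: real in at_top. exp 1 \<le> x" by (rule eventually_ge_at_top)
  from eventually_conj[OF eventually_distance_bound eventually_conj[OF eventually_probability_bounds(1)
      eventually_conj[OF eventually_probability_bounds(2) eventually_conj[OF eventually_probability_bounds(3) this]]]]
  obtain X where X: "\<And>x. x \<ge> X \<Longrightarrow>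
      (ln x powr (-1/3) + 1 / x)
       + 4 * (3 * ln x powr (1/3)) * ((ln x powr (1/3) + 1) * 4 powr (ln x powr (2/3) + 2) * x powr (-1/8) * (1 + 2 * (ln x powr (1/3) + 1)))
       + (3 * ln x powr (-1/3) + 4 * (1 + 3 * ln x powr (1/3)) / ln x + 8 * (1 + 3 * ln x powr (1/3)) * ((ln x)\<^sup>2 + 2) / x)
       + 4 * ln x powr (-1/3) + 2 / x + exp (- sqrt x) / x\<^sup>2 \<le> 9 * ln x powr (-1/3)"
    "\<And>x. x \<ge> X \<Longrightarrow> 8 * (x + 1) powr (2 * ((ln x)\<^sup>2 + 2)) * exp (- (x * (ln x powr (-1/3))\<^sup>2 / (2 * (1 + 3 * ln x powr (1/3))\<^sup>2))) \<le> exp (- sqrt x)"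
    "\<And>x. x \<ge> X \<Longrightarrow> 2 * ((ln x powr (1/3) + 1) * 4 powr (ln x powr (2/3) + 2)) * exp (- (x * (x powr (-1/8))\<^sup>2 / 2)) \<le> exp (- sqrt x)"
    "\<And>x. x \<ge> X \<Longrightarrow> 2 * 4 powr x * exp (- (x\<^sup>2 * (ln x powr (-1/3))\<^sup>2 / 8)) \<le> exp (- sqrt x)"
    "\<And>x. x \<ge> X \<Longrightarrow> exp 1 \<le> x"
    unfolding eventually_at_top_linorder by blast
  show ?thesis
  proof (intro exI[of _ "nat \<lceil>X\<rceil>"] allI impI ballI)
    fix k W assume k0: "nat \<lceil>X\<rceil> \<le> k" and W: "W \<in> orderons"
    have kX: "real k \<ge> X" using k0 by linarith
    define x where "x = real k"
    define L where "L = ln x"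
    note X' = X[OF kX, folded x_def, folded L_def]
    have x: "x > 0" using X'(5) exp_gt_zero[of "1::real"] by linarith
    have L: "L \<ge> 1" using X'(5) x ln_ge_iff[of x 1] by (simp add: L_def)
    have k: "k > 0" using x by (simp add: x_def)
    define \<epsilon> where "\<epsilon> = L powr (-1/3)"
    define K where "K = L powr (1/3)"
    have \<epsilon>: "\<epsilon> > 0" using L by (simp add: \<epsilon>_def)
    have K: "K \<ge> 1" unfolding K_def using L by (intro ge_one_powr_ge_zero) auto
    have \<epsilon>K: "\<epsilon> * K = 1" using L by (simp add: \<epsilon>_def K_def flip: powr_add)
    have \<epsilon>1: "\<epsilon> \<le> 1"
    proof -
      have "\<epsilon> * 1 \<le> \<epsilon> * K" using \<epsilon> K by (intro mult_left_mono) auto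
      then show ?thesis using \<epsilon>K by simp
    qed
    have K2: "L powr (2/3) = K * K" using L by (simp add: K_def flip: powr_add)
    define r where "r = nat \<lfloor>L powr (2/3)\<rfloor> + 1"
    have r: "K * K < real r" "real r \<le> K * K + 1"
    proof -
      have "K * K \<ge> 0" using K by simp
      then show "K * K < real r" "real r \<le> K * K + 1" unfolding r_def K2 by linarith+
    qed
    have r\<epsilon>: "real r * \<epsilon>\<^sup>2 > 1"
    proof -
      have "(K * K) * \<epsilon>\<^sup>2 < real r * \<epsilon>\<^sup>2" using r \<epsilon> by (intro mult_strict_right_mono) auto
      moreover have "(K * K) * \<epsilon>\<^sup>2 = (\<epsilon> * K) * (\<epsilon> * K)" by (simp add: power2_eq_square)
      ultimately show ?thesis using \<epsilon>K by simp
    qed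
    have b0: "0 \<le> real r * \<epsilon>" "real r * \<epsilon> \<le> 3 * K"
    proof -
      have "real r * \<epsilon> \<le> (K * K + 1) * \<epsilon>" using r \<epsilon> by (intro mult_right_mono) auto
      also have "\<dots> = K * (\<epsilon> * K) + \<epsilon>" by (simp add: algebra_simps)
      also have "\<dots> \<le> 3 * K" using \<epsilon>K \<epsilon>1 K by simp
      finally show "real r * \<epsilon> \<le> 3 * K" .
    qed (use \<epsilon> in simp)
    define s where "s = nat \<lceil>\<epsilon> * x\<rceil>"
    have \<epsilon>x: "\<epsilon> * x > 0" using \<epsilon> x by simp
    have s: "s > 0" "\<epsilon> * x \<le> real s" "real s \<le> \<epsilon> * x + 1"
      unfolding s_def using \<epsilon>x by (simp, linarith, linarith)
    define m where "m = (k - 1) div s + 1"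
    have m: "(k - 1) div s < m" "real m \<le> K + 1"
    proof -
      have "real ((k - 1) div s) \<le> real (k - 1) / real s" by (rule of_nat_div_le_of_nat)
      also have "\<dots> \<le> x / (\<epsilon> * x)" using s x \<epsilon>x by (intro frac_le) (auto simp: x_def)
      also have "\<dots> = K" using x \<epsilon> \<epsilon>K by (simp add: field_simps)
      finally show "real m \<le> K + 1" by (simp add: m_def)
    qed (simp add: m_def)
    define q where "q = nat \<lceil>L\<^sup>2\<rceil> + 1"
    have q: "q > 0" "L\<^sup>2 \<le> real q" "real q \<le> L\<^sup>2 + 2"
      unfolding q_def using zero_le_power2[of L] by (simp, linarith, linarith)
    have sqrtq: "L \<le> sqrt (real q)" using q(2) L real_le_rsqrt by blast
    define \<tau> where "\<tau> = x powr (-1/8)"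
    define \<eta> where "\<eta> = exp (- sqrt x) / x\<^sup>2"
    have \<tau>: "\<tau> \<ge> 0" by (simp add: \<tau>_def)
    have \<eta>: "\<eta> > 0" using x by (simp add: \<eta>_def)
    have r4: "4 ^ r \<le> 4 powr (K * K + 2)"
    proof -
      have "(4::real) ^ r = 4 powr real r" by (simp add: powr_realpow)
      also have "\<dots> \<le> 4 powr (K * K + 2)" using r by (intro powr_mono) auto
      finally show ?thesis .
    qed
    define R where "R = 4 powr (K * K + 2)"
    have mR: "real m * 4 ^ r \<le> (K + 1) * R" unfolding R_def using m(2) r4 K by (intro mult_mono) auto
    let ?b0 = "real r * \<epsilon>"
    let ?bound = "real s / real k + 4 * ?b0 * (real m * 4 ^ r * \<tau> * (1 + 2 * real m))
      + (3 * \<epsilon> + 4 * (1 + ?b0) / sqrt (real q) + 8 * (1 + ?b0) * real q / real k) + 4 * \<epsilon> + 2 / real k + \<eta>"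
    have bound: "?bound \<le> 9 * \<epsilon>"
    proof -
      have "real s / x \<le> \<epsilon> + 1 / x"
      proof -
        have "real s / x \<le> (\<epsilon> * x + 1) / x" using s x by (intro divide_right_mono) auto
        then show ?thesis using x by (simp add: add_divide_distrib)
      qed
      moreover have "4 * ?b0 * (real m * 4 ^ r * \<tau> * (1 + 2 * real m)) \<le> 4 * (3 * K) * ((K + 1) * R * \<tau> * (1 + 2 * (K + 1)))"
      proof -
        have "4 * b * (a * \<tau> * (1 + 2 * c)) \<le> 4 * (3 * K) * (A * \<tau> * (1 + 2 * (K + 1)))"
          if "0 \<le> b" "b \<le> 3 * K" "0 \<le> a" "a \<le> A" "0 \<le> c" "c \<le> K + 1" for a b c A
          by (intro mult_mono) (use that \<tau> K in auto)
        from this[OF b0 _ mR _ m(2)] show ?thesis by simp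
      qed
      moreover have "4 * (1 + ?b0) / sqrt (real q) \<le> 4 * (1 + 3 * K) / L"
      proof -
        have "4 * (1 + b) / sqrt (real q) \<le> 4 * (1 + 3 * K) / L" if "0 \<le> b" "b \<le> 3 * K" for b
          using sqrtq that L K by (intro frac_le) auto
        from this[OF b0] show ?thesis .
      qed
      moreover have "8 * (1 + ?b0) * real q / x \<le> 8 * (1 + 3 * K) * (L\<^sup>2 + 2) / x"
      proof -
        have "8 * (1 + b) * real q / x \<le> 8 * (1 + 3 * K) * (L\<^sup>2 + 2) / x" if "0 \<le> b" "b \<le> 3 * K" for b
          using q that x K by (intro divide_right_mono mult_mono) auto
        from this[OF b0] show ?thesis .
      qed
      ultimately show ?thesis
        using X'(1) unfolding \<epsilon>_def[symmetric] K_def[symmetric] K2 \<tau>_def[symmetric] R_def[symmetric] \<eta>_def[symmetric] x_def[symmetric] by linarith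
    qed
    have P1: "8 * (x + 1) ^ (2 * q) * exp (- (x * \<epsilon>\<^sup>2 / (2 * (1 + ?b0)\<^sup>2))) \<le> exp (- sqrt x)"
    proof -
      have "(x + 1) ^ (2 * q) = (x + 1) powr real (2 * q)" by (rule powr_realpow[symmetric]) (use x in simp)
      also have "\<dots> \<le> (x + 1) powr (2 * (L\<^sup>2 + 2))" using x q by (intro powr_mono) auto
      finally have 1: "(x + 1) ^ (2 * q) \<le> (x + 1) powr (2 * (L\<^sup>2 + 2))" .
      have "x * \<epsilon>\<^sup>2 / (2 * (1 + 3 * K)\<^sup>2) \<le> x * \<epsilon>\<^sup>2 / (2 * (1 + ?b0)\<^sup>2)"
      proof -
        have "x * \<epsilon>\<^sup>2 / (2 * (1 + 3 * K)\<^sup>2) \<le> x * \<epsilon>\<^sup>2 / (2 * (1 + b)\<^sup>2)" if "0 \<le> b" "b \<le> 3 * K" for b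
          using x that K by (intro divide_left_mono mult_left_mono power_mono mult_pos_pos) auto
        from this[OF b0] show ?thesis .
      qed
      then have "8 * (x + 1) ^ (2 * q) * exp (- (x * \<epsilon>\<^sup>2 / (2 * (1 + ?b0)\<^sup>2))) \<le> 8 * (x + 1) powr (2 * (L\<^sup>2 + 2)) * exp (- (x * \<epsilon>\<^sup>2 / (2 * (1 + 3 * K)\<^sup>2)))"
        using 1 x by (intro mult_mono) auto
      then show ?thesis using X'(2) unfolding \<epsilon>_def[symmetric] K_def[symmetric] by linarith
    qed
    have P2: "2 * (real m * 4 ^ r) * exp (- (x * \<tau>\<^sup>2 / 2)) \<le> exp (- sqrt x)"
    proof -
      have "2 * (real m * 4 ^ r) * exp (- (x * \<tau>\<^sup>2 / 2)) \<le> 2 * ((K + 1) * R) * exp (- (x * \<tau>\<^sup>2 / 2))"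
        using mR by (intro mult_right_mono) auto
      then show ?thesis using X'(3) unfolding K_def[symmetric] K2 \<tau>_def[symmetric] R_def[symmetric] by linarith
    qed
    have P3: "x\<^sup>2 * \<eta> = exp (- sqrt x)" using x by (simp add: \<eta>_def)
    have P4: "2 * 4 ^ k * exp (- (x\<^sup>2 * \<epsilon>\<^sup>2 / 8)) \<le> exp (- sqrt x)"
    proof -
      have "(4::real) ^ k = 4 powr x" by (simp add: x_def powr_realpow)
      then show ?thesis using X'(4) unfolding \<epsilon>_def[symmetric] by simp
    qed
    interpret RG: prob_space "random_graph k W" by (rule random_graph_prob_space(1)[OF W])
    have "measure (random_graph k W) {G. \<not> cut_shift_dist W (graph_orderon k G) \<le> 9 * ln (real k) powr (-1/3)}
       \<le> measure (random_graph k W) {G. \<not> cut_shift_dist W (graph_orderon k G) \<le> ?bound}"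
    proof (rule RG.finite_measure_mono)
      have "9 * ln (real k) powr (-1/3) = 9 * \<epsilon>" by (simp add: \<epsilon>_def L_def x_def)
      then show "{G. \<not> cut_shift_dist W (graph_orderon k G) \<le> 9 * ln (real k) powr (-1/3)} \<subseteq> {G. \<not> cut_shift_dist W (graph_orderon k G) \<le> ?bound}"
        using bound by auto
    qed (simp add: random_graph_prob_space(2)[OF W])
    also have "\<dots> \<le> 8 * (real k + 1) ^ (2 * q) * exp (- (real k * \<epsilon>\<^sup>2 / (2 * (1 + ?b0)\<^sup>2)))
      + 2 * (real m * 4 ^ r) * exp (- (real k * \<tau>\<^sup>2 / 2)) + (real k)\<^sup>2 * \<eta>
      + 2 * 4 ^ k * exp (- ((real k)\<^sup>2 * \<epsilon>\<^sup>2 / 8))"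
      by (rule random_graph_far_prob_le[OF W k s(1) q(1) \<epsilon> r\<epsilon> m(1) \<tau> \<eta>])
    also have "\<dots> \<le> 4 * exp (- sqrt (real k))"
      using P1 P2 P3 P4 unfolding x_def by linarith
    finally show "measure (random_graph k W) {G. \<not> cut_shift_dist W (graph_orderon k G) \<le> 9 * ln (real k) powr (-1/3)} \<le> 4 * exp (- sqrt (real k))" .
  qed
qed

theorem theorem1p4:
  shows "\<exists>C::real. C > 0 \<and>
    (\<forall>k::nat. \<forall>W. k \<ge> 3 \<longrightarrow> W \<in> orderons \<longrightarrow>
      \<P>(G in random_graph k W.
          cut_shift_dist W (graph_orderon k G) \<le> C * (ln (ln (real k)) / ln (real k)) powr (1/3))
      \<ge> 1 - C * exp (- sqrt (real k) / C))"
proof -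
  obtain k0 where k0: "\<And>k W. k \<ge> k0 \<Longrightarrow> W \<in> orderons \<Longrightarrow>
     measure (random_graph k W) {G. \<not> cut_shift_dist W (graph_orderon k G) \<le> 9 * ln (real k) powr (-1/3)} \<le> 4 * exp (- sqrt (real k))"
    using random_graph_close_large by blast
  \<comment> \<open>from \<open>k1\<close> on, \<open>ln (ln k) \<ge> 1\<close>\<close>
  define k1 where "k1 = max k0 (nat \<lceil>exp (exp 1) :: real\<rceil>)"
  \<comment> \<open>below \<open>k1\<close>, \<open>exp (- sqrt k / C) \<ge> exp (-1) \<ge> 1 / 3\<close>, so that the claimed probability is negative\<close>
  define C where "C = 9 + sqrt (real k1)"
  have C: "C \<ge> 9" "sqrt (real k1) \<le> C" by (auto simp: C_def)
  have "1 - C * exp (- sqrt (real k) / C) \<le>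
      \<P>(G in random_graph k W. cut_shift_dist W (graph_orderon k G) \<le> C * (ln (ln (real k)) / ln (real k)) powr (1/3))"
    if k: "k \<ge> 3" and W: "W \<in> orderons" for k W
  proof -
    interpret RG: prob_space "random_graph k W" by (rule random_graph_prob_space(1)[OF W])
    have sp [simp]: "space (random_graph k W) = UNIV" "sets (random_graph k W) = UNIV"
      by (rule random_graph_prob_space(3)[OF W], rule random_graph_prob_space(2)[OF W])
    show ?thesis
    proof (cases "k \<ge> k1")
      case False
      then have "sqrt (real k) \<le> C" using C(2) by (intro order_trans[OF _ C(2)]) auto
      then have "- sqrt (real k) / C \<ge> -1" using C by (simp add: field_simps)
      then have "exp (- sqrt (real k) / C) \<ge> exp (-1)" by simp
      moreover have "exp (-1) \<ge> (1/3 :: real)"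
        using exp_le by (simp add: exp_minus field_simps)
      ultimately have "exp (- sqrt (real k) / C) \<ge> 1 / 3" by linarith
      then have "C * exp (- sqrt (real k) / C) \<ge> 9 * (1 / 3)" using C by (intro mult_mono) auto
      then have "1 - C * exp (- sqrt (real k) / C) \<le> 0" by linarith
      then show ?thesis by (rule order_trans) (rule measure_nonneg)
    next
      case True
      have big: "exp (exp 1) \<le> real k"
      proof -
        have "nat \<lceil>exp (exp 1) :: real\<rceil> \<le> k" using True by (simp add: k1_def)
        then show ?thesis by linarith
      qed
      define L where "L = ln (real k)"
      have Le: "L \<ge> exp 1" using big k ln_ge_iff[of "real k" "exp 1"] by (simp add: L_def)
      then have L: "L > 0" using exp_gt_zero[of "1::real"] by linarith
      have lnL: "ln L \<ge> 1" using Le L ln_ge_iff[of L 1] by simp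
      have "9 * L powr (-1/3) \<le> C * (ln L / L) powr (1/3)"
      proof (intro mult_mono)
        have "L powr (-1/3) = 1 / L powr (1/3)" using powr_minus_divide[of L "1/3"] by simp
        also have "\<dots> = (1 / L) powr (1/3)" using L by (simp add: powr_divide)
        also have "\<dots> \<le> (ln L / L) powr (1/3)" using L lnL by (intro powr_mono2 divide_right_mono) auto
        finally show "L powr (-1/3) \<le> (ln L / L) powr (1/3)" .
      qed (use C in auto)
      then have "{G. \<not> cut_shift_dist W (graph_orderon k G) \<le> C * (ln L / L) powr (1/3)}
          \<subseteq> {G. \<not> cut_shift_dist W (graph_orderon k G) \<le> 9 * L powr (-1/3)}" by auto
      then have "measure (random_graph k W) {G. \<not> cut_shift_dist W (graph_orderon k G) \<le> C * (ln L / L) powr (1/3)}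
         \<le> measure (random_graph k W) {G. \<not> cut_shift_dist W (graph_orderon k G) \<le> 9 * L powr (-1/3)}"
        by (rule RG.finite_measure_mono) simp
      also have "\<dots> \<le> 4 * exp (- sqrt (real k))"
        unfolding L_def by (rule k0) (use True W in \<open>auto simp: k1_def\<close>)
      also have "\<dots> \<le> C * exp (- sqrt (real k) / C)"
      proof (intro mult_mono)
        have "sqrt (real k) / C \<le> sqrt (real k) / 1" using C by (intro divide_left_mono) auto
        then show "exp (- sqrt (real k)) \<le> exp (- sqrt (real k) / C)" by simp
      qed (use C in auto)
      finally have far: "measure (random_graph k W) {G. \<not> cut_shift_dist W (graph_orderon k G) \<le> C * (ln L / L) powr (1/3)} \<le> C * exp (- sqrt (real k) / C)" .
      have "measure (random_graph k W) (space (random_graph k W) - {G. cut_shift_dist W (graph_orderon k G) \<le> C * (ln L / L) powr (1/3)})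
         = 1 - measure (random_graph k W) {G. cut_shift_dist W (graph_orderon k G) \<le> C * (ln L / L) powr (1/3)}"
        by (rule RG.prob_compl) simp
      moreover have "space (random_graph k W) - {G. cut_shift_dist W (graph_orderon k G) \<le> C * (ln L / L) powr (1/3)}
         = {G. \<not> cut_shift_dist W (graph_orderon k G) \<le> C * (ln L / L) powr (1/3)}" by auto
      ultimately show ?thesis using far by (simp add: L_def)
    qed
  qed
  then show ?thesis using C by (intro exI[of _ C]) auto
qed

end
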